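(* Let $U\subset\mathbb{R}^n$ be a smooth bounded domain, $0<s<1$, and let $d$ be a distance on $\mathbb{R}^n$ equivalent to the Euclidean one. For $1<p<+\infty$ consider the eigenvalue problem $$(-\Delta)_p^su=\lambda|u|^{p-2}u\ \text{ in }U,\qquad \mathcal N_{s,p}u=0\ \text{ in }\mathbb{R}^n\setminus\overline U,\qquad (\ast)$$ understood in the weak sense given in the context. (i) For every $1<p<+\infty$, the first (smallest) non-zero eigenvalue of $(\ast)$ is $$\lambda_{s,p}=\inf\left\{\frac{\mathcal H_{s,p}(v)}{2\|v\|_{L^p(U)}^p} : v\in\mathcal W^{s,p}(U)\setminus\{0\},\ \int_U|v|^{p-2}v\,dx=0\right\}.$$ (ii) One has $$\lim_{p\to+\infty}(\lambda_{s,p})^{1/p}=\frac{2}{(\operatorname{diam}_d(U))^s}=\Lambda_{s,\infty}:=\inf\left\{\frac{\mathcal H_{s,\infty}(u)}{\|u\|_{L^\infty(U)}} : u\in\mathcal A\right\},$$ where $$\mathcal A=\Big\{u\in\mathcal W^{s,\infty}(U)\setminus\{0\} : \sup_{x\in U}u(x)+\inf_{x\in U}u(x)=0\Big\}.$$ (iii) If, for each $p$, $u_p$ is a minimizer of $\lambda_{s,p}$ normalized by $\|u_p\|_{L^p(U)}=1$, then, up to a subsequence $p_j\to+\infty$, $u_{p}$ converges in $C(\overline U)$ to some minimizer $u_\infty\in W^{s,\infty}(U)$ of $\Lambda^N_{s,\infty}$.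
   Context: "Equivalent to the Euclidean one" means that there is $C\ge1$ with $C^{-1}|x-y|\le d(x,y)\le C|x-y|$ for all $x,y$. $\operatorname{diam}_d(U)=\max_{x,y\in\overline U}d(x,y)$, $U^c=\mathbb{R}^n\setminus U$, $(U^c)^2=U^c\times U^c$. Operators: $$(-\Delta)_p^su(x)=\mathrm{P.V.}\int_{\mathbb{R}^n}\frac{|u(x)-u(y)|^{p-2}(u(x)-u(y))}{d(x,y)^{n+sp}}\,dy,\qquad \mathcal N_{s,p}u(x)=\int_U\frac{|u(x)-u(y)|^{p-2}(u(x)-u(y))}{d(x,y)^{n+sp}}\,dy\quad (x\in\mathbb{R}^n\setminus\overline U).$$ Functionals: $$\mathcal H_{s,p}(u,v)=\iint_{\mathbb{R}^{2n}\setminus(U^c)^2}\frac{|u(x)-u(y)|^{p-2}(u(x)-u(y))(v(x)-v(y))}{d(x,y)^{n+ps}}\,dx\,dy,\qquad \mathcal H_{s,p}(u)=\mathcal H_{s,p}(u,u),$$ $$\mathcal H_{s,\infty}(u)=\sup\Big\{\frac{|u(x)-u(y)|}{d(x,y)^s} : (x,y)\in\mathbb{R}^{2n}\setminus(U^c)^2\Big\}\quad(\text{over }x\ne y).$$ Spaces: $\mathcal W^{s,p}(U)$ is the set of measurable $u:\mathbb{R}^n\to\mathbb{R}$ with $\|u\|_{L^p(U)}^p+\mathcal H_{s,p}(u)<+\infty$; $\mathcal W^{s,\infty}(U)$ is the set of measurable $u:\mathbb{R}^n\to\mathbb{R}$ with $\|u\|_{L^\infty(U)}+\mathcal H_{s,\infty}(u)<+\infty$.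 Quotients with vanishing denominator are read as $+\infty$. Weak solutions and eigenvalues: $u\in\mathcal W^{s,p}(U)$ is a weak solution of $(\ast)$ if $\frac12\mathcal H_{s,p}(u,v)=\lambda\int_U|u|^{p-2}u\,v\,dx$ for all $v\in\mathcal W^{s,p}(U)$. The number $\lambda$ is an eigenvalue of $(\ast)$ if there is a nontrivial weak solution $u$. A minimizer of $\lambda_{s,p}$ is an admissible function at which the infimum defining $\lambda_{s,p}$ is attained. $\Lambda^N_{s,\infty}=\frac{2}{(\operatorname{diam}_d(U))^s}$. A minimizer of $\Lambda^N_{s,\infty}$ is a function $u\in W^{s,\infty}(U)\setminus\{0\}$ with $\sup_Uu+\inf_Uu=0$ and $\llbracket u\rrbracket_{s,\infty}/\|u\|_{L^\infty(U)}=\Lambda^N_{s,\infty}$, where $\llbracket u\rrbracket_{s,\infty}=\sup_{x\ne y\in U}\frac{|u(x)-u(y)|}{d(x,y)^s}$ and $W^{s,\infty}(U)$ is the set of bounded functions on $U$ with $\llbracket u\rrbracket_{s,\infty}<+\infty$. *)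

theory Defs
  imports "HOL-Analysis.Analysis" "HOL-Probability.Essential_Supremum"
begin

section \<open>Smooth bounded domains\<close>

text \<open>\<open>C_k k f\<close>: all iterated directional derivatives of order at most \<open>k\<close> exist as Frechet
  derivatives evaluated at fixed directions, and are continuous on the whole space.\<close>

primrec C_k :: "nat \<Rightarrow> ('a::euclidean_space \<Rightarrow> real) \<Rightarrow> bool" where
  "C_k 0 f \<longleftrightarrow> continuous_on UNIV f"
| "C_k (Suc k) f \<longleftrightarrow> f differentiable_on UNIV \<and> (\<forall>v. C_k k (\<lambda>x. frechet_derivative f (at x) v))"

definition smooth :: "('a::euclidean_space \<Rightarrow> real) \<Rightarrow> bool" where
  "smooth f \<longleftrightarrow> (\<forall>k. C_k k f)"

text \<open>The boundary is locally the graph of a smooth function, with \<open>U\<close> on one side of it, after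
  choosing a unit vector \<open>e\<close> as the direction of the last coordinate. The function \<open>\<gamma>\<close> is only
  used on the hyperplane orthogonal to \<open>e\<close>; a smooth function on that hyperplane extends to the
  whole space by composition with the orthogonal projection.\<close>

definition smooth_boundary :: "'a::euclidean_space set \<Rightarrow> bool" where
  "smooth_boundary U \<longleftrightarrow>
     (\<forall>x0 \<in> frontier U. \<exists>r>0. \<exists>e. norm e = 1 \<and>
        (\<exists>\<gamma>. smooth \<gamma> \<and>
           U \<inter> ball x0 r = {x \<in> ball x0 r. \<gamma> (x - (x \<bullet> e) *\<^sub>R e) < x \<bullet> e}))"

definition smooth_bounded_domain :: "'a::euclidean_space set \<Rightarrow> bool" where
  "smooth_bounded_domain U \<longleftrightarrow>
     open U \<and> connected U \<and> U \<noteq> {} \<and> bounded U \<and> smooth_boundary U"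

section \<open>The distance\<close>

definition euclidean_equivalent_distance :: "('a::euclidean_space \<Rightarrow> 'a \<Rightarrow> real) \<Rightarrow> bool" where
  "euclidean_equivalent_distance d \<longleftrightarrow>
     Metric_space UNIV d \<and>
     (\<exists>C\<ge>1. \<forall>x y. norm (x - y) / C \<le> d x y \<and> d x y \<le> C * norm (x - y))"

text \<open>The supremum is attained for a bounded \<open>U\<close> and \<open>d\<close> equivalent to the Euclidean distance.\<close>

definition diam_d :: "('a::euclidean_space \<Rightarrow> 'a \<Rightarrow> real) \<Rightarrow> 'a set \<Rightarrow> real" where
  "diam_d d U = (SUP (x, y) \<in> closure U \<times> closure U. d x y)"

section \<open>Functionals and spaces\<close>

text \<open>Functions are Lebesgue measurable real functions on the whole space. Functionals that may be
  infinite take values in \<^typ>\<open>ennreal\<close>.\<close>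

text \<open>The set \<open>\<real>\<^sup>2\<^sup>n \ (U\<^sup>c)\<^sup>2\<close>.\<close>
definition cross_dom :: "'a set \<Rightarrow> ('a \<times> 'a) set" where
  "cross_dom U = UNIV - (- U) \<times> (- U)"

text \<open>The function \<open>|a|\<^bsup>p-2\<^esup> a\<close>; it vanishes at \<open>a = 0\<close> also for \<open>p < 2\<close>.\<close>
definition sgn_pow :: "real \<Rightarrow> real \<Rightarrow> real" where
  "sgn_pow p a = \<bar>a\<bar> powr (p - 2) * a"

text \<open>On the diagonal, a null set, the division by \<open>0\<close> yields \<open>0\<close>.\<close>
definition H_integrand ::
  "('a::euclidean_space \<Rightarrow> 'a \<Rightarrow> real) \<Rightarrow> real \<Rightarrow> real \<Rightarrow> ('a \<Rightarrow> real) \<Rightarrow> ('a \<Rightarrow> real) \<Rightarrow> 'a \<times> 'a \<Rightarrow> real" where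
  "H_integrand d s p u v = (\<lambda>(x, y).
     sgn_pow p (u x - u y) * (v x - v y) / d x y powr (real DIM('a) + p * s))"

text \<open>\<open>H_form\<close> is the two-argument functional, absolutely convergent for arguments in \<open>W_sp\<close>.
  \<open>H_energy u\<close> is its value at \<open>(u, u)\<close>; there the integrand is nonnegative, so it is defined
  (possibly infinite) for every measurable \<open>u\<close>.\<close>

definition H_form ::
  "'a::euclidean_space set \<Rightarrow> ('a \<Rightarrow> 'a \<Rightarrow> real) \<Rightarrow> real \<Rightarrow> real \<Rightarrow> ('a \<Rightarrow> real) \<Rightarrow> ('a \<Rightarrow> real) \<Rightarrow> real" where
  "H_form U d s p u v = (LINT z:cross_dom U|lebesgue. H_integrand d s p u v z)"

definition H_energy ::
  "'a::euclidean_space set \<Rightarrow> ('a \<Rightarrow> 'a \<Rightarrow> real) \<Rightarrow> real \<Rightarrow> real \<Rightarrow> ('a \<Rightarrow> real) \<Rightarrow> ennreal" where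
  "H_energy U d s p u = (\<integral>\<^sup>+ z\<in>cross_dom U. ennreal (H_integrand d s p u u z) \<partial>lebesgue)"

definition H_infty ::
  "'a::euclidean_space set \<Rightarrow> ('a \<Rightarrow> 'a \<Rightarrow> real) \<Rightarrow> real \<Rightarrow> ('a \<Rightarrow> real) \<Rightarrow> ennreal" where
  "H_infty U d s u =
     (SUP (x, y) \<in> {(x, y) \<in> cross_dom U. x \<noteq> y}. ennreal (\<bar>u x - u y\<bar> / d x y powr s))"

text \<open>The \<open>p\<close>-th power of the norm of \<open>L\<^sup>p(U)\<close>.\<close>
definition Lp_norm_pow :: "'a::euclidean_space set \<Rightarrow> real \<Rightarrow> ('a \<Rightarrow> real) \<Rightarrow> ennreal" where
  "Lp_norm_pow U p u = (\<integral>\<^sup>+ x\<in>U. ennreal (\<bar>u x\<bar> powr p) \<partial>lebesgue)"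

definition Linf_norm :: "'a::euclidean_space set \<Rightarrow> ('a \<Rightarrow> real) \<Rightarrow> ennreal" where
  "Linf_norm U u = esssup (lebesgue_on U) (\<lambda>x. ennreal \<bar>u x\<bar>)"

definition W_sp ::
  "'a::euclidean_space set \<Rightarrow> ('a \<Rightarrow> 'a \<Rightarrow> real) \<Rightarrow> real \<Rightarrow> real \<Rightarrow> ('a \<Rightarrow> real) set" where
  "W_sp U d s p =
     {u \<in> borel_measurable lebesgue. Lp_norm_pow U p u + H_energy U d s p u < top}"

definition W_sinf ::
  "'a::euclidean_space set \<Rightarrow> ('a \<Rightarrow> 'a \<Rightarrow> real) \<Rightarrow> real \<Rightarrow> ('a \<Rightarrow> real) set" where
  "W_sinf U d s = {u \<in> borel_measurable lebesgue. Linf_norm U u + H_infty U d s u < top}"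

text \<open>Removing \<open>0\<close> from \<open>W_sp\<close> or \<open>W_sinf\<close> is understood modulo equality almost everywhere
  on the whole space.\<close>
definition nonzero_ae :: "('a::euclidean_space \<Rightarrow> real) \<Rightarrow> bool" where
  "nonzero_ae u \<longleftrightarrow> \<not> (AE x in lebesgue. u x = 0)"

text \<open>Quotients with vanishing denominator are \<open>+\<infinity>\<close>, also \<open>0 / 0\<close>, which is \<open>0\<close> in
  \<^typ>\<open>ennreal\<close>.\<close>
definition quot :: "ennreal \<Rightarrow> ennreal \<Rightarrow> ennreal" where
  "quot a b = (if b = 0 then top else a / b)"

section \<open>The eigenvalue problem\<close>

definition weak_solution ::
  "'a::euclidean_space set \<Rightarrow> ('a \<Rightarrow> 'a \<Rightarrow> real) \<Rightarrow> real \<Rightarrow> real \<Rightarrow> real \<Rightarrow> ('a \<Rightarrow> real) \<Rightarrow> bool" where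
  "weak_solution U d s p l u \<longleftrightarrow> u \<in> W_sp U d s p \<and>
     (\<forall>v \<in> W_sp U d s p.
        1 / 2 * H_form U d s p u v = l * (LINT x:U|lebesgue. sgn_pow p (u x) * v x))"

definition is_eigenvalue ::
  "'a::euclidean_space set \<Rightarrow> ('a \<Rightarrow> 'a \<Rightarrow> real) \<Rightarrow> real \<Rightarrow> real \<Rightarrow> real \<Rightarrow> bool" where
  "is_eigenvalue U d s p l \<longleftrightarrow> (\<exists>u. weak_solution U d s p l u \<and> nonzero_ae u)"

definition is_first_nonzero_eigenvalue ::
  "'a::euclidean_space set \<Rightarrow> ('a \<Rightarrow> 'a \<Rightarrow> real) \<Rightarrow> real \<Rightarrow> real \<Rightarrow> real \<Rightarrow> bool" where
  "is_first_nonzero_eigenvalue U d s p l \<longleftrightarrow>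
     is_eigenvalue U d s p l \<and> l \<noteq> 0 \<and>
     (\<forall>m. is_eigenvalue U d s p m \<and> m \<noteq> 0 \<longrightarrow> l \<le> m)"

definition admissible_sp ::
  "'a::euclidean_space set \<Rightarrow> ('a \<Rightarrow> 'a \<Rightarrow> real) \<Rightarrow> real \<Rightarrow> real \<Rightarrow> ('a \<Rightarrow> real) set" where
  "admissible_sp U d s p =
     {v \<in> W_sp U d s p. nonzero_ae v \<and> (LINT x:U|lebesgue. sgn_pow p (v x)) = 0}"

definition lambda_sp ::
  "'a::euclidean_space set \<Rightarrow> ('a \<Rightarrow> 'a \<Rightarrow> real) \<Rightarrow> real \<Rightarrow> real \<Rightarrow> ennreal" where
  "lambda_sp U d s p =
     (INF v \<in> admissible_sp U d s p. quot (H_energy U d s p v) (2 * Lp_norm_pow U p v))"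

definition is_minimizer_sp ::
  "'a::euclidean_space set \<Rightarrow> ('a \<Rightarrow> 'a \<Rightarrow> real) \<Rightarrow> real \<Rightarrow> real \<Rightarrow> ('a \<Rightarrow> real) \<Rightarrow> bool" where
  "is_minimizer_sp U d s p u \<longleftrightarrow> u \<in> admissible_sp U d s p \<and>
     quot (H_energy U d s p u) (2 * Lp_norm_pow U p u) = lambda_sp U d s p"

section \<open>The limit problem\<close>

text \<open>The supremum and infimum over \<open>U\<close> are real-valued: a member of \<open>W_sinf\<close> is continuous and
  bounded on \<open>U\<close>.\<close>
definition admissible_sinf ::
  "'a::euclidean_space set \<Rightarrow> ('a \<Rightarrow> 'a \<Rightarrow> real) \<Rightarrow> real \<Rightarrow> ('a \<Rightarrow> real) set" where
  "admissible_sinf U d s =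
     {u \<in> W_sinf U d s. nonzero_ae u \<and> (SUP x\<in>U. u x) + (INF x\<in>U. u x) = 0}"

definition Lambda_sinf ::
  "'a::euclidean_space set \<Rightarrow> ('a \<Rightarrow> 'a \<Rightarrow> real) \<Rightarrow> real \<Rightarrow> ennreal" where
  "Lambda_sinf U d s =
     (INF u \<in> admissible_sinf U d s. quot (H_infty U d s u) (Linf_norm U u))"

definition Lambda_N ::
  "'a::euclidean_space set \<Rightarrow> ('a \<Rightarrow> 'a \<Rightarrow> real) \<Rightarrow> real \<Rightarrow> real" where
  "Lambda_N U d s = 2 / (diam_d d U) powr s"

definition Holder_seminorm ::
  "'a::euclidean_space set \<Rightarrow> ('a \<Rightarrow> 'a \<Rightarrow> real) \<Rightarrow> real \<Rightarrow> ('a \<Rightarrow> real) \<Rightarrow> ennreal" where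
  "Holder_seminorm U d s u =
     (SUP (x, y) \<in> {(x, y) \<in> U \<times> U. x \<noteq> y}. ennreal (\<bar>u x - u y\<bar> / d x y powr s))"

text \<open>A function on \<open>U\<close> is represented by any function on the whole space with the same values
  on \<open>U\<close>; no condition refers to values outside \<open>U\<close>.\<close>
definition W_sinf_on ::
  "'a::euclidean_space set \<Rightarrow> ('a \<Rightarrow> 'a \<Rightarrow> real) \<Rightarrow> real \<Rightarrow> ('a \<Rightarrow> real) set" where
  "W_sinf_on U d s = {u. bounded (u ` U) \<and> Holder_seminorm U d s u < top}"

definition is_minimizer_Lambda_N ::
  "'a::euclidean_space set \<Rightarrow> ('a \<Rightarrow> 'a \<Rightarrow> real) \<Rightarrow> real \<Rightarrow> ('a \<Rightarrow> real) \<Rightarrow> bool" where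
  "is_minimizer_Lambda_N U d s u \<longleftrightarrow> u \<in> W_sinf_on U d s \<and> (\<exists>x\<in>U. u x \<noteq> 0) \<and>
     (SUP x\<in>U. u x) + (INF x\<in>U. u x) = 0 \<and>
     quot (Holder_seminorm U d s u) (Linf_norm U u) = ennreal (Lambda_N U d s)"

text \<open>Members of \<open>W_sp\<close> are determined only up to null sets, so convergence in
  \<open>C\<close> of the closure of \<open>U\<close> is uniform convergence of their continuous representatives.\<close>
definition converges_in_C_closure ::
  "'a::euclidean_space set \<Rightarrow> (nat \<Rightarrow> 'a \<Rightarrow> real) \<Rightarrow> ('a \<Rightarrow> real) \<Rightarrow> bool" where
  "converges_in_C_closure U f g \<longleftrightarrow> continuous_on (closure U) g \<and>
     (\<exists>w. (\<forall>j. continuous_on (closure U) (w j) \<and> (AE x in lebesgue_on U. w j x = f j x)) \<and>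
          uniform_limit (closure U) w g sequentially)"

end

theory Submission
  imports Defs "HOL-Complex_Analysis.Great_Picard"
begin

text \<open>The constraint \<open>\<integral> |v|\<^sup>p\<^sup>-\<^sup>2 v = 0\<close> says that \<open>0\<close> is the constant closest to \<open>v\<close> in
  \<open>L\<^sup>p(U)\<close>, so the quotient defining \<open>\<lambda>\<close> may be tested with every member of the space after
  subtracting a constant. This gives the Euler-Lagrange equation of a minimizer without a
  multiplier, and the equation tested with \<open>1\<close> and with \<open>u\<close> shows that every other non-zero
  eigenvalue is at least \<open>\<lambda>\<close>. A minimizer exists because the energy, which charges all of
  \<open>U \<times> \<real>\<^sup>n\<close>, makes a minimizing sequence precompact in \<open>L\<^sup>p(U)\<close>; the values off \<open>U\<close> are
  recovered by uniform convexity.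

  For large \<open>p\<close> a Campanato-type chaining over the sets \<open>U \<inter> B(x, r)\<close>, whose measure is comparable
  to \<open>r\<^sup>n\<close> by smoothness of the boundary, gives an equicontinuity estimate uniform in \<open>p\<close>. A
  uniform limit \<open>g\<close> of normalized minimizers has supremum \<open>1\<close> and infimum \<open>-1\<close> and satisfies
  \<open>|g x - g y| \<le> L d(x, y)\<^sup>s\<close> with \<open>L = lim \<lambda>\<^bsup>1/p\<^esup>\<close>, hence \<open>2 \<le> L diam\<^sup>s\<close>. The reverse
  inequality comes from the single test function \<open>min (d(\<cdot>, x\<^sub>0)) D\<close>, where \<open>x\<^sub>0\<close> is an end point of a
  diameter \<open>D\<close>: its Lipschitz quotient, measured against \<open>d\<^sup>s\<close>, is at most \<open>D\<^bsup>1-s\<^esup>\<close> and its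
  distance to the constants is \<open>D / 2\<close>.\<close>

section \<open>Pointwise inequalities for powers\<close>

text \<open>The norm on \<open>U\<close> and the energy are both integrals of a \<open>p\<close>-th
  power: of \<open>u\<close> against \<open>muU\<close>, and of its jump \<open>dif u\<close>
  against the weighted measure \<open>muH p\<close>. So convexity, differentiation, Fatou and
  completeness are proved once, for \<open>pint\<close> over any measure, and used twice. Tonelli on
  the product asks for Borel functions while the definitions speak of Lebesgue measurable ones;
  hence the work is done with Borel representatives, in \<open>W p\<close>. The obstacle in the
  limit is that constants must be right after the \<open>p\<close>-th root. The chaining loses a
  fixed factor and gives equicontinuity only. The sharp Holder constant comes from averages over two
  cells of a fixed radius: their volumes enter with exponent \<open>2 / p\<close> and drop out, and
  the radius is sent to 0 after \<open>p\<close>. From above, the energy of the truncated distance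
  is at most \<open>D powr ((1 - s) * (p - 2))\<close> times a finite integral at exponent 2, whose
  root tends to 1 or is harmless. The 2 in \<open>2 * lam p\<close> is the one half of the weak form
  and vanishes in the root.\<close>

lemma sgn_pow_zero [simp]: "sgn_pow p 0 = 0"
  by (simp add: sgn_pow_def)

lemma sgn_pow_uminus: "sgn_pow p (- a) = - sgn_pow p a"
  by (simp add: sgn_pow_def)

lemma sgn_pow_mult_self: "sgn_pow p a * a = \<bar>a\<bar> powr p"
proof (cases "a = 0")
  case False
  have "\<bar>a\<bar> powr p = \<bar>a\<bar> powr (p - 2) * \<bar>a\<bar> powr 2"
    by (simp only: powr_add [symmetric]) simp
  also have "\<bar>a\<bar> powr 2 = a * a"
    using False by (simp add: powr_numeral power2_eq_square)
  finally show ?thesis by (simp add: sgn_pow_def)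
qed simp

lemma abs_sgn_pow: "\<bar>sgn_pow p a\<bar> = \<bar>a\<bar> powr (p - 1)"
proof (cases "a = 0")
  case False
  have "\<bar>a\<bar> powr (p - 1) = \<bar>a\<bar> powr (p - 2) * \<bar>a\<bar> powr 1"
    by (simp only: powr_add [symmetric]) simp
  then show ?thesis using False by (simp add: sgn_pow_def abs_mult)
qed simp

text \<open>The defining exponent \<open>p - 2\<close> is negative for \<open>p < 2\<close>. Here
  only \<open>p - 1\<close> occurs, positive for \<open>p > 1\<close>, so continuity at 0 becomes
  visible and bounds can be made separately for each sign.\<close>

lemma sgn_pow_pos_part:
  "sgn_pow p a = max a 0 powr (p - 1) - max (- a) 0 powr (p - 1)"
proof -
  have *: "sgn_pow p a = a powr (p - 1)" if "a > 0" for a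
    using abs_sgn_pow[of p a] that by (simp add: sgn_pow_def)
  show ?thesis
    using *[of a] *[of "-a"] by (cases a "0::real" rule: linorder_cases) (auto simp: max_def sgn_pow_uminus)
qed

lemma continuous_on_sgn_pow: "1 < p \<Longrightarrow> continuous_on UNIV (sgn_pow p)"
  unfolding sgn_pow_pos_part[abs_def]
  by (intro continuous_on_diff continuous_on_powr' continuous_intros) auto

lemma sgn_pow_measurable [measurable]: "sgn_pow p \<in> borel_measurable borel"
  unfolding sgn_pow_def by measurable

lemma sgn_pow_scale: "c > 0 \<Longrightarrow> sgn_pow p (c * a) = c powr (p - 1) * sgn_pow p a"
proof -
  assume "c > 0"
  then have "c powr (p - 1) = c powr (p - 2) * c"
    using powr_add[of c "p - 2" 1] by (simp add: algebra_simps)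
  then show ?thesis using \<open>c > 0\<close> by (simp add: sgn_pow_def abs_mult powr_mult)
qed

text \<open>Strict Bernoulli inequality: for positive \<open>a\<close> the function
  \<open>a powr p - p * a\<close> decreases strictly up to 1 and increases strictly beyond it; for
  \<open>a \<le> 0\<close> the right side is negative.\<close>

lemma powr_gt_tangent_at_one:
  fixes a p :: real
  assumes "1 < p" "a \<noteq> 1"
  shows "\<bar>a\<bar> powr p > 1 + p * (a - 1)"
proof (cases "a \<le> 0")
  case True
  then have "p * a \<le> 0" using assms by (simp add: mult_nonneg_nonpos)
  then have "1 + p * (a - 1) < 0" using assms by (simp add: algebra_simps)
  then show ?thesis by (smt (verit) powr_ge_zero)
next
  case False
  define f where "f x = x powr p - p * x" for x :: real
  have der: "(f has_real_derivative (p * x powr (p - 1) - p)) (at x)" if "x > 0" for x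
    unfolding f_def using that by (auto intro!: derivative_eq_intros)
  have cont: "continuous_on {x..y} f" if "x > 0" for x y
    unfolding f_def using that by (intro continuous_intros) auto
  have "f 1 < f a"
  proof (cases "a > 1")
    case True
    show ?thesis
    proof (rule DERIV_pos_imp_increasing_open[OF True])
      fix x :: real assume x: "1 < x" "x < a"
      have "x powr (p - 1) > 1" using x assms by (intro gr_one_powr) auto
      then show "\<exists>y. (f has_real_derivative y) (at x) \<and> y > 0"
        using der[of x] x assms by (intro exI[of _ "p * x powr (p - 1) - p"]) auto
    qed (use cont in auto)
  next
    case F: False
    then have "a < 1" using assms by auto
    then show ?thesis
    proof (rule DERIV_neg_imp_decreasing_open)
      fix x :: real assume x: "a < x" "x < 1"
      have "x powr (p - 1) < 1 powr (p - 1)" using x assms False by (intro powr_less_mono2) auto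
      then have "x powr (p - 1) < 1" by simp
      then show "\<exists>y. (f has_real_derivative y) (at x) \<and> y < 0"
        using der[of x] x assms False by (intro exI[of _ "p * x powr (p - 1) - p"]) auto
    qed (use cont False in auto)
  qed
  then show ?thesis using False by (simp add: f_def algebra_simps)
qed

text \<open>Division by \<open>m\<close> reduces to the tangent point 1. The slope
  \<open>p * sgn_pow p m\<close> is the derivative of the power at \<open>m\<close>; strictness is
  what makes the midpoint defect positive.\<close>

lemma powr_gt_tangent:
  fixes a m p :: real
  assumes "1 < p" "a \<noteq> m"
  shows "\<bar>a\<bar> powr p > \<bar>m\<bar> powr p + p * sgn_pow p m * (a - m)"
proof (cases "m = 0")
  case True
  then show ?thesis using assms by simp
next
  case False
  then have "\<bar>a / m\<bar> powr p > 1 + p * (a / m - 1)"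
    using assms by (intro powr_gt_tangent_at_one) auto
  then have "\<bar>m\<bar> powr p * \<bar>a / m\<bar> powr p > \<bar>m\<bar> powr p * (1 + p * (a / m - 1))"
    using False by (intro mult_strict_left_mono) auto
  also have "\<bar>m\<bar> powr p * \<bar>a / m\<bar> powr p = \<bar>a\<bar> powr p"
    using False by (simp add: powr_mult[symmetric])
  also have "\<bar>m\<bar> powr p * (1 + p * (a / m - 1)) = \<bar>m\<bar> powr p + p * sgn_pow p m * (a - m)"
    using False unfolding sgn_pow_mult_self[of p m, symmetric] by (simp add: field_simps)
  finally show ?thesis .
qed

lemma powr_ge_tangent:
  fixes a m p :: real
  assumes "1 < p"
  shows "\<bar>a\<bar> powr p \<ge> \<bar>m\<bar> powr p + p * sgn_pow p m * (a - m)"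
  using powr_gt_tangent[OF assms, of a m] by (cases "a = m") auto

section \<open>Uniform convexity of the \<open>p\<close>-th power\<close>

text \<open>The Jensen gap at the midpoint. For two almost minimizers its integral is forced to be
  small.\<close>

definition mid_defect :: "real \<Rightarrow> real \<Rightarrow> real \<Rightarrow> real" where
  "mid_defect p a b = (\<bar>a\<bar> powr p + \<bar>b\<bar> powr p) / 2 - \<bar>(a + b) / 2\<bar> powr p"

lemma mid_defect_pos: "1 < p \<Longrightarrow> a \<noteq> b \<Longrightarrow> mid_defect p a b > 0"
  using powr_gt_tangent[of p a "(a + b) / 2"] powr_gt_tangent[of p b "(a + b) / 2"]
  by (simp add: mid_defect_def field_simps)

lemma mid_defect_nonneg: "1 < p \<Longrightarrow> mid_defect p a b \<ge> 0"
  using mid_defect_pos[of p a b] by (cases "a = b") (auto simp: mid_defect_def)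

lemma mid_defect_scale: "mid_defect p (c * a) (c * b) = \<bar>c\<bar> powr p * mid_defect p a b"
proof -
  have "\<bar>(c * a + c * b) / 2\<bar> powr p = \<bar>c\<bar> powr p * \<bar>(a + b) / 2\<bar> powr p"
    by (simp add: powr_mult[symmetric] abs_mult[symmetric] algebra_simps)
  then show ?thesis
    unfolding mid_defect_def by (simp add: abs_mult powr_mult algebra_simps)
qed

lemma mid_defect_commute: "mid_defect p a b = mid_defect p b a"
  by (simp add: mid_defect_def add.commute)

text \<open>A form of uniform convexity valid for every \<open>p > 1\<close>; by homogeneity it is a compactness
  statement about the pairs \<open>(1, b)\<close> with \<open>\<bar>b\<bar> \<le> 1\<close>.\<close>
lemma diff_powr_le_mid_defect:
  fixes p :: real
  assumes p: "1 < p" and e: "e > 0"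
  obtains C where "C \<ge> 0"
    "\<And>a b. \<bar>a - b\<bar> powr p \<le> e * (\<bar>a\<bar> powr p + \<bar>b\<bar> powr p) + C * mid_defect p a b"
proof -
  \<comment> \<open>The points that the term \<open>e\<close> does not already cover. They form a
    compact set avoiding 1, where the defect has a positive minimum \<open>m\<close>, while the left
    side is at most \<open>2 powr p\<close>.\<close>
  define S where "S = {b \<in> {-1..1::real}. e \<le> \<bar>1 - b\<bar> powr p}"
  have cpow: "continuous_on X (\<lambda>b. \<bar>f b\<bar> powr p)" if "continuous_on X f" for f :: "real \<Rightarrow> real" and X
    using that p by (intro continuous_on_powr' continuous_intros) auto
  have "\<exists>C\<ge>0. \<forall>b\<in>{-1..1}. \<bar>1 - b\<bar> powr p \<le> e + C * mid_defect p 1 b"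
  proof (cases "S = {}")
    case True
    then have "\<bar>1 - b\<bar> powr p \<le> e" if "b \<in> {-1..1}" for b
      using that unfolding S_def by (metis (mono_tags, lifting) empty_iff linear mem_Collect_eq)
    then show ?thesis by (intro exI[of _ 0]) simp
  next
    case False
    have "S = {-1..1} \<inter> {b. e \<le> \<bar>1 - b\<bar> powr p}" by (auto simp: S_def)
    moreover have "closed {b. e \<le> \<bar>1 - b\<bar> powr p}"
      by (intro closed_Collect_le cpow continuous_intros)
    ultimately have "compact S" by (metis compact_Icc compact_Int_closed)
    moreover have "continuous_on S (mid_defect p 1)"
      unfolding mid_defect_def by (intro continuous_intros cpow) auto
    ultimately obtain b0 where b0: "b0 \<in> S" "\<And>b. b \<in> S \<Longrightarrow> mid_defect p 1 b0 \<le> mid_defect p 1 b"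
      using continuous_attains_inf[OF _ False, of "mid_defect p 1"] by blast
    define m where "m = mid_defect p 1 b0"
    have "b0 \<noteq> 1" using b0(1) e p by (auto simp: S_def)
    then have m: "m > 0" unfolding m_def using p by (intro mid_defect_pos) auto
    have "\<bar>1 - b\<bar> powr p \<le> e + 2 powr p / m * mid_defect p 1 b" if b: "b \<in> {-1..1}" for b
    proof (cases "b \<in> S")
      case True
      have "\<bar>1 - b\<bar> powr p \<le> 2 powr p" using b p by (intro powr_mono2) auto
      also have "\<dots> \<le> 2 powr p / m * mid_defect p 1 b"
        using m b0(2)[OF True] by (simp add: m_def field_simps)
      finally show ?thesis using e by simp
    next
      case False
      then have "\<bar>1 - b\<bar> powr p \<le> e" using b by (auto simp: S_def)
      then show ?thesis using m mid_defect_nonneg[OF p, of 1 b]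
        by (smt (verit) divide_nonneg_pos mult_nonneg_nonneg powr_ge_zero)
    qed
    then show ?thesis using m by (intro exI[of _ "2 powr p / m"]) auto
  qed
  then obtain C where C: "C \<ge> 0" "\<And>b. b \<in> {-1..1} \<Longrightarrow> \<bar>1 - b\<bar> powr p \<le> e + C * mid_defect p 1 b"
    by blast
  have main: "\<bar>a - b\<bar> powr p \<le> e * (\<bar>a\<bar> powr p + \<bar>b\<bar> powr p) + C * mid_defect p a b"
    if ab: "\<bar>b\<bar> \<le> \<bar>a\<bar>" for a b :: real
  proof (cases "a = 0")
    case True
    then show ?thesis using ab by (simp add: mid_defect_def)
  next
    case False
    have "b / a \<in> {-1..1}"
      using False ab by (auto simp: field_simps abs_if split: if_splits)
    from C(2)[OF this] have "\<bar>a\<bar> powr p * \<bar>1 - b / a\<bar> powr p \<le> \<bar>a\<bar> powr p * (e + C * mid_defect p 1 (b / a))"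
      by (rule mult_left_mono) simp
    also have "\<bar>a\<bar> powr p * \<bar>1 - b / a\<bar> powr p = \<bar>a - b\<bar> powr p"
      using False by (simp add: powr_mult[symmetric] abs_mult[symmetric] algebra_simps)
    also have "\<bar>a\<bar> powr p * (e + C * mid_defect p 1 (b / a)) = e * \<bar>a\<bar> powr p + C * mid_defect p a b"
      using mid_defect_scale[of p a 1 "b / a"] False by (simp add: algebra_simps)
    finally show ?thesis using e by (smt (verit) mult_nonneg_nonneg powr_ge_zero distrib_left)
  qed
  have "\<bar>a - b\<bar> powr p \<le> e * (\<bar>a\<bar> powr p + \<bar>b\<bar> powr p) + C * mid_defect p a b" for a b
    using main[of b a] main[of a b]
    by (cases "\<bar>b\<bar> \<le> \<bar>a\<bar>") (auto simp: mid_defect_commute[of p b a] abs_minus_commute add.commute)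
  with C(1) that show ?thesis by blast
qed

lemma powr_sum_le:
  fixes a b p :: real
  assumes "0 \<le> p"
  shows "\<bar>a + b\<bar> powr p \<le> 2 powr p * (\<bar>a\<bar> powr p + \<bar>b\<bar> powr p)"
proof -
  have "\<bar>a + b\<bar> powr p \<le> (2 * max \<bar>a\<bar> \<bar>b\<bar>) powr p"
    using assms by (intro powr_mono2) auto
  also have "\<dots> = 2 powr p * max \<bar>a\<bar> \<bar>b\<bar> powr p" by (simp add: powr_mult)
  also have "\<dots> \<le> 2 powr p * (\<bar>a\<bar> powr p + \<bar>b\<bar> powr p)"
    by (intro mult_left_mono) (auto simp: max_def)
  finally show ?thesis .
qed

text \<open>Either \<open>b\<close> is small relative to \<open>a\<close>, with ratio
  \<open>\<delta>\<close> such that \<open>(1 + \<delta>) powr p = 1 + e\<close>, or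
  \<open>a\<close> is controlled by \<open>b\<close>. The leading factor near 1, in place of
  \<open>2 powr p\<close>, is what lets integrals converge.\<close>

lemma powr_sum_le_eps:
  fixes p e :: real
  assumes "1 < p" "e > 0"
  obtains C where "C \<ge> 0" "\<And>a b. \<bar>a + b\<bar> powr p \<le> (1 + e) * \<bar>a\<bar> powr p + C * \<bar>b\<bar> powr p"
proof -
  define \<delta> where "\<delta> = (1 + e) powr (1 / p) - 1"
  have "1 < (1 + e) powr (1 / p)" using assms by (intro gr_one_powr) auto
  then have \<delta>: "\<delta> > 0" by (simp add: \<delta>_def)
  have 1: "(1 + \<delta>) powr p = 1 + e" using assms by (simp add: \<delta>_def powr_powr)
  show ?thesis
  proof (rule that[of "(1 + 1 / \<delta>) powr p"])
    fix a b :: real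
    show "\<bar>a + b\<bar> powr p \<le> (1 + e) * \<bar>a\<bar> powr p + (1 + 1 / \<delta>) powr p * \<bar>b\<bar> powr p"
    proof (cases "\<bar>b\<bar> \<le> \<delta> * \<bar>a\<bar>")
      case True
      have "\<bar>a + b\<bar> powr p \<le> ((1 + \<delta>) * \<bar>a\<bar>) powr p"
        using True assms by (intro powr_mono2) (auto simp: algebra_simps)
      also have "\<dots> = (1 + e) * \<bar>a\<bar> powr p" using \<delta> 1 by (simp add: powr_mult)
      finally show ?thesis by (smt (verit) mult_nonneg_nonneg powr_ge_zero)
    next
      case False
      then have "\<bar>a\<bar> \<le> \<bar>b\<bar> / \<delta>" using \<delta> by (simp add: field_simps)
      then have "\<bar>a + b\<bar> \<le> (1 + 1 / \<delta>) * \<bar>b\<bar>" by (simp add: algebra_simps)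
      then have "\<bar>a + b\<bar> powr p \<le> ((1 + 1 / \<delta>) * \<bar>b\<bar>) powr p"
        using assms by (intro powr_mono2) auto
      also have "\<dots> = (1 + 1 / \<delta>) powr p * \<bar>b\<bar> powr p" using \<delta> by (simp add: powr_mult)
      finally show ?thesis using assms by (smt (verit) mult_nonneg_nonneg powr_ge_zero)
    qed
  qed simp
qed

text \<open>Young's inequality without its sharp constants: both factors are bounded through the
  maximum, whose \<open>p\<close>-th power is one of the summands.\<close>

lemma abs_sgn_pow_mult_le:
  fixes a b p :: real
  assumes "1 < p"
  shows "\<bar>sgn_pow p a * b\<bar> \<le> \<bar>a\<bar> powr p + \<bar>b\<bar> powr p"
proof -
  define m where "m = max \<bar>a\<bar> \<bar>b\<bar>"
  have "\<bar>sgn_pow p a * b\<bar> = \<bar>a\<bar> powr (p - 1) * \<bar>b\<bar>" by (simp add: abs_mult abs_sgn_pow)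
  also have "\<dots> \<le> m powr (p - 1) * m"
    using assms by (intro mult_mono powr_mono2) (auto simp: m_def)
  also have "\<dots> = m powr p"
    using powr_add[of m "p - 1" 1] by (cases "m = 0") (auto simp: m_def)
  also have "\<dots> \<le> \<bar>a\<bar> powr p + \<bar>b\<bar> powr p" by (auto simp: m_def max_def)
  finally show ?thesis .
qed

text \<open>Convexity traps the difference quotient between the slopes at its two end points, which
  supplies both the limit and a majorant for dominated convergence.\<close>

lemma powr_difference_quotient_bounds:
  fixes a b t p :: real
  assumes "1 < p" "t > 0"
  shows "p * (sgn_pow p a * b) \<le> (\<bar>a + t * b\<bar> powr p - \<bar>a\<bar> powr p) / t"
    and "(\<bar>a + t * b\<bar> powr p - \<bar>a\<bar> powr p) / t \<le> p * (sgn_pow p (a + t * b) * b)"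
  using powr_ge_tangent[OF assms(1), of a "a + t * b"] powr_ge_tangent[OF assms(1), of "a + t * b" a] assms
  by (simp_all add: field_simps)

lemma le_powr_inverse:
  fixes x y p :: real
  assumes "p > 0" "x \<ge> 0" "y \<ge> 0" "x powr p \<le> y"
  shows "x \<le> y powr (1 / p)"
proof -
  have "x = (x powr p) powr (1 / p)" using assms by (simp add: powr_powr)
  also have "\<dots> \<le> y powr (1 / p)" using assms by (intro powr_mono2) auto
  finally show ?thesis .
qed

section \<open>Functions with integrable \<open>p\<close>-th power\<close>

definition Lp :: "real \<Rightarrow> 'a measure \<Rightarrow> ('a \<Rightarrow> real) set" where
  "Lp p M = {f \<in> borel_measurable M. integrable M (\<lambda>x. \<bar>f x\<bar> powr p)}"

text \<open>The \<open>p\<close>-th power of the norm. No root is taken; the inequalities for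
  \<open>\<bar>a + b\<bar> powr p\<close> take the place of the triangle inequality.\<close>

definition pint :: "real \<Rightarrow> 'a measure \<Rightarrow> ('a \<Rightarrow> real) \<Rightarrow> real" where
  "pint p M f = (LINT x|M. \<bar>f x\<bar> powr p)"

lemma Lp_measurable: "f \<in> Lp p M \<Longrightarrow> f \<in> borel_measurable M"
  and Lp_integrable: "f \<in> Lp p M \<Longrightarrow> integrable M (\<lambda>x. \<bar>f x\<bar> powr p)"
  by (auto simp: Lp_def)

lemma pint_nonneg: "pint p M f \<ge> 0"
  by (simp add: pint_def)

lemma Lp_dominated:
  assumes "f \<in> borel_measurable M" "integrable M g" "\<And>x. x \<in> space M \<Longrightarrow> \<bar>f x\<bar> powr p \<le> g x"
  shows "f \<in> Lp p M"
proof -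
  have [measurable]: "f \<in> borel_measurable M" by fact
  have "integrable M (\<lambda>x. \<bar>f x\<bar> powr p)"
  proof (rule Bochner_Integration.integrable_bound[OF assms(2)])
    show "AE x in M. norm (\<bar>f x\<bar> powr p) \<le> norm (g x)"
      using assms(3) by (intro AE_I2) (force intro: order_trans[OF _ abs_ge_self])
  qed measurable
  then show ?thesis using assms by (simp add: Lp_def)
qed

lemma Lp_add:
  assumes "f \<in> Lp p M" "g \<in> Lp p M" "0 \<le> p"
  shows "(\<lambda>x. f x + g x) \<in> Lp p M"
proof (rule Lp_dominated)
  show "integrable M (\<lambda>x. 2 powr p * (\<bar>f x\<bar> powr p + \<bar>g x\<bar> powr p))"
    using assms by (intro integrable_mult_right Bochner_Integration.integrable_add Lp_integrable)
qed (use assms in \<open>auto simp: Lp_def intro: powr_sum_le\<close>)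

lemma Lp_cmult:
  assumes "f \<in> Lp p M"
  shows "(\<lambda>x. c * f x) \<in> Lp p M"
  using assms by (auto simp: Lp_def abs_mult powr_mult)

lemma pint_cmult: "pint p M (\<lambda>x. c * f x) = \<bar>c\<bar> powr p * pint p M f"
  by (simp add: pint_def abs_mult powr_mult)

lemma Lp_diff:
  assumes "f \<in> Lp p M" "g \<in> Lp p M" "0 \<le> p"
  shows "(\<lambda>x. f x - g x) \<in> Lp p M"
  using Lp_add[OF assms(1) Lp_cmult[OF assms(2), of "-1"] assms(3)] by simp

lemma pint_uminus: "pint p M (\<lambda>x. - f x) = pint p M f"
  by (simp add: pint_def)

lemma Lp_const: "finite_measure M \<Longrightarrow> (\<lambda>x. c) \<in> Lp p M"
  by (simp add: Lp_def finite_measure.integrable_const)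

lemma nn_integral_eq_pint:
  "f \<in> Lp p M \<Longrightarrow> (\<integral>\<^sup>+x. ennreal (\<bar>f x\<bar> powr p) \<partial>M) = ennreal (pint p M f)"
  unfolding pint_def by (intro nn_integral_eq_integral Lp_integrable) auto

lemma Lp_iff_nn_integral:
  "f \<in> Lp p M \<longleftrightarrow> f \<in> borel_measurable M \<and> (\<integral>\<^sup>+x. ennreal (\<bar>f x\<bar> powr p) \<partial>M) < top"
  by (auto simp: Lp_def integrable_iff_bounded)

lemma pint_add_le:
  assumes "f \<in> Lp p M" "g \<in> Lp p M" "0 \<le> p"
  shows "pint p M (\<lambda>x. f x + g x) \<le> 2 powr p * (pint p M f + pint p M g)"
proof -
  have "pint p M (\<lambda>x. f x + g x) \<le> (LINT x|M. 2 powr p * (\<bar>f x\<bar> powr p + \<bar>g x\<bar> powr p))"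
    unfolding pint_def using assms Lp_add[OF assms]
    by (intro integral_mono powr_sum_le integrable_mult_right Bochner_Integration.integrable_add Lp_integrable)
  also have "\<dots> = 2 powr p * (pint p M f + pint p M g)"
    using assms by (simp add: pint_def Lp_integrable)
  finally show ?thesis .
qed

lemma pint_diff_le:
  assumes "f \<in> Lp p M" "g \<in> Lp p M" "0 \<le> p"
  shows "pint p M (\<lambda>x. f x - g x) \<le> 2 powr p * (pint p M f + pint p M g)"
  using pint_add_le[OF assms(1) Lp_cmult[OF assms(2), of "-1"] assms(3)] by (simp add: pint_uminus)

lemma pint_add_le_eps:
  assumes "1 < p" "e > 0"
  obtains C where "C \<ge> 0" "\<And>f g. f \<in> Lp p M \<Longrightarrow> g \<in> Lp p M \<Longrightarrow>
    pint p M (\<lambda>x. f x + g x) \<le> (1 + e) * pint p M f + C * pint p M g"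
proof -
  obtain C where C: "C \<ge> 0" "\<And>a b. \<bar>a + b\<bar> powr p \<le> (1 + e) * \<bar>a\<bar> powr p + C * \<bar>b\<bar> powr p"
    using powr_sum_le_eps[OF assms] by blast
  show ?thesis
  proof (rule that[OF C(1)])
    fix f g assume fg: "f \<in> Lp p M" "g \<in> Lp p M"
    have "pint p M (\<lambda>x. f x + g x) \<le> (LINT x|M. (1 + e) * \<bar>f x\<bar> powr p + C * \<bar>g x\<bar> powr p)"
      unfolding pint_def using assms fg Lp_add[OF fg]
      by (intro integral_mono C Bochner_Integration.integrable_add integrable_mult_right Lp_integrable) auto
    also have "\<dots> = (1 + e) * pint p M f + C * pint p M g"
      using fg by (simp add: pint_def Lp_integrable)
    finally show "pint p M (\<lambda>x. f x + g x) \<le> (1 + e) * pint p M f + C * pint p M g" .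
  qed
qed

text \<open>The inequality with factor \<open>1 + e\<close>, used once with \<open>f\<close> and
  once with \<open>fk k\<close> as the main term, plays the part of the reverse triangle
  inequality.\<close>

lemma tendsto_pint:
  assumes p: "1 < p" and f: "f \<in> Lp p M" and fk: "\<And>k. fk k \<in> Lp p M"
    and lim: "(\<lambda>k. pint p M (\<lambda>x. fk k x - f x)) \<longlonglongrightarrow> 0"
  shows "(\<lambda>k. pint p M (fk k)) \<longlonglongrightarrow> pint p M f"
proof (rule LIMSEQ_I)
  fix r :: real assume r: "r > 0"
  define A where "A = pint p M f"
  have A: "A \<ge> 0" by (simp add: A_def pint_nonneg)
  \<comment> \<open>Small enough that \<open>e\<close> times the bound \<open>A + r\<close>, valid
    for both integrals, stays below \<open>r / 2\<close>.\<close>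
  define e where "e = min 1 (r / (4 * (A + r + 1)))"
  have e: "e > 0" "e \<le> 1" using r A by (auto simp: e_def)
  have eA: "e * (A + r) < r / 2"
  proof -
    have "e * (A + r) \<le> r / (4 * (A + r + 1)) * (A + r)"
      using A r by (intro mult_right_mono) (auto simp: e_def)
    also have "\<dots> = r / 4 * ((A + r) / (A + r + 1))" using A r by (simp add: field_simps)
    also have "\<dots> \<le> r / 4 * 1" using A r by (intro mult_left_mono) auto
    also have "\<dots> < r / 2" using r by simp
    finally show ?thesis .
  qed
  obtain C where C: "C \<ge> 0" "\<And>f g. f \<in> Lp p M \<Longrightarrow> g \<in> Lp p M \<Longrightarrow>
    pint p M (\<lambda>x. f x + g x) \<le> (1 + e) * pint p M f + C * pint p M g"
    using pint_add_le_eps[OF p e(1), of M] by blast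
  have "eventually (\<lambda>k. pint p M (\<lambda>x. fk k x - f x) < r / (4 * (C + 1))) sequentially"
    using order_tendstoD(2)[OF lim, of "r / (4 * (C + 1))"] r C by simp
  then obtain N where N: "\<And>k. k \<ge> N \<Longrightarrow> pint p M (\<lambda>x. fk k x - f x) < r / (4 * (C + 1))"
    by (auto simp: eventually_sequentially)
  show "\<exists>N. \<forall>k\<ge>N. norm (pint p M (fk k) - pint p M f) < r"
  proof (intro exI allI impI)
    fix k assume k: "k \<ge> N"
    define \<delta> where "\<delta> = pint p M (\<lambda>x. fk k x - f x)"
    have \<delta>0: "\<delta> \<ge> 0" by (simp add: \<delta>_def pint_nonneg)
    have "C * \<delta> \<le> C * (r / (4 * (C + 1)))"
      using N[OF k] C by (intro mult_left_mono) (auto simp: \<delta>_def)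
    also have "\<dots> \<le> r / 4" using C r by (simp add: field_simps)
    finally have C\<delta>: "C * \<delta> \<le> r / 4" .
    have d: "(\<lambda>x. fk k x - f x) \<in> Lp p M" using fk f p by (intro Lp_diff) auto
    have "pint p M (\<lambda>x. f x + (fk k x - f x)) \<le> (1 + e) * A + C * \<delta>"
      using C(2)[OF f d] by (simp add: A_def \<delta>_def)
    then have u: "pint p M (fk k) \<le> (1 + e) * A + C * \<delta>" by simp
    have "pint p M (\<lambda>x. fk k x + (- 1) * (fk k x - f x)) \<le> (1 + e) * pint p M (fk k) + C * pint p M (\<lambda>x. (- 1) * (fk k x - f x))"
      by (rule C(2)[OF fk Lp_cmult[OF d]])
    then have l: "A \<le> (1 + e) * pint p M (fk k) + C * \<delta>"
      unfolding pint_cmult by (simp add: A_def \<delta>_def)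
    have "e * A \<le> e * (A + r)" using e r by (intro mult_left_mono) auto
    moreover have "(1 + e) * A = A + e * A" by (simp add: distrib_right)
    ultimately have "pint p M (fk k) < A + r"
      using u C\<delta> eA r by linarith
    then have "e * pint p M (fk k) \<le> e * (A + r)" using e by (intro mult_left_mono) auto
    moreover have "(1 + e) * pint p M (fk k) = pint p M (fk k) + e * pint p M (fk k)"
      by (simp add: distrib_right)
    ultimately have "A < pint p M (fk k) + r"
      using l C\<delta> eA r by linarith
    with \<open>pint p M (fk k) < A + r\<close> show "norm (pint p M (fk k) - pint p M f) < r"
      unfolding A_def by (simp add: abs_less_iff)
  qed
qed

text \<open>An identity rather than the convexity inequality: what is lost at the midpoint equals
  the integral of the defect, and \<open>diff_powr_le_mid_defect\<close> turns that into a
  distance.\<close>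

lemma pint_midpoint:
  assumes p: "1 < p" and "f \<in> Lp p M" "g \<in> Lp p M"
  shows "(\<lambda>x. (f x + g x) / 2) \<in> Lp p M"
    and "integrable M (\<lambda>x. mid_defect p (f x) (g x))"
    and "pint p M (\<lambda>x. (f x + g x) / 2) + (LINT x|M. mid_defect p (f x) (g x)) = (pint p M f + pint p M g) / 2"
proof -
  show *: "(\<lambda>x. (f x + g x) / 2) \<in> Lp p M"
    using Lp_cmult[OF Lp_add[OF assms(2,3)], of "1/2"] p by simp
  show "integrable M (\<lambda>x. mid_defect p (f x) (g x))"
    "pint p M (\<lambda>x. (f x + g x) / 2) + (LINT x|M. mid_defect p (f x) (g x)) = (pint p M f + pint p M g) / 2"
    unfolding mid_defect_def pint_def
    using Lp_integrable[OF *] Lp_integrable[OF assms(2)] Lp_integrable[OF assms(3)] by simp_all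
qed

lemma pint_midpoint_le:
  assumes p: "1 < p" and "f \<in> Lp p M" "g \<in> Lp p M"
  shows "pint p M (\<lambda>x. (f x + g x) / 2) \<le> (pint p M f + pint p M g) / 2"
proof -
  have "(LINT x|M. mid_defect p (f x) (g x)) \<ge> 0"
    using p by (intro integral_nonneg_AE) (simp add: mid_defect_nonneg)
  then show ?thesis using pint_midpoint(3)[OF assms] by simp
qed

lemma integrable_sgn_pow_mult:
  assumes p: "1 < p" and f: "f \<in> Lp p M" and g: "g \<in> Lp p M"
  shows "integrable M (\<lambda>x. sgn_pow p (f x) * g x)"
proof (rule Bochner_Integration.integrable_bound)
  show "integrable M (\<lambda>x. \<bar>f x\<bar> powr p + \<bar>g x\<bar> powr p)"
    using f g by (simp add: Lp_integrable)
  have [measurable]: "f \<in> borel_measurable M" "g \<in> borel_measurable M"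
    using f g by (auto simp: Lp_def)
  show "(\<lambda>x. sgn_pow p (f x) * g x) \<in> borel_measurable M" by measurable
  show "AE x in M. norm (sgn_pow p (f x) * g x) \<le> norm (\<bar>f x\<bar> powr p + \<bar>g x\<bar> powr p)"
    using abs_sgn_pow_mult_le[OF p, of "f _" "g _"] by (intro AE_I2) simp
qed

lemma pint_ge_tangent:
  assumes p: "1 < p" and f: "f \<in> Lp p M" and g: "g \<in> Lp p M"
  shows "pint p M (\<lambda>x. f x + g x) \<ge> pint p M f + p * (LINT x|M. sgn_pow p (f x) * g x)"
proof -
  note i = integrable_sgn_pow_mult[OF assms]
  have "pint p M f + p * (LINT x|M. sgn_pow p (f x) * g x)
      = (LINT x|M. \<bar>f x\<bar> powr p + p * (sgn_pow p (f x) * g x))"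
    using i f by (simp add: pint_def Lp_integrable)
  also have "\<dots> \<le> pint p M (\<lambda>x. f x + g x)"
    unfolding pint_def
  proof (rule integral_mono)
    show "integrable M (\<lambda>x. \<bar>f x\<bar> powr p + p * (sgn_pow p (f x) * g x))"
      using i f by (simp add: Lp_integrable)
    show "integrable M (\<lambda>x. \<bar>f x + g x\<bar> powr p)"
      using Lp_add[OF f g] p by (simp add: Lp_integrable)
    show "\<bar>f x\<bar> powr p + p * (sgn_pow p (f x) * g x) \<le> \<bar>f x + g x\<bar> powr p" for x
      using powr_ge_tangent[OF p, where a = "f x + g x" and m = "f x"] by (simp add: algebra_simps)
  qed
  finally show ?thesis .
qed

text \<open>Dominated convergence of the difference quotients identifies the one-sided derivative at
  0, and the assumed linear lower bound passes to it. Used for \<open>g\<close> and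
  \<open>- g\<close> it yields stationarity.\<close>

lemma pint_derivative_ge:
  assumes p: "1 < p" and f: "f \<in> Lp p M" and g: "g \<in> Lp p M"
    and ge: "\<And>t. 0 < t \<Longrightarrow> t \<le> 1 \<Longrightarrow> pint p M (\<lambda>x. f x + t * g x) \<ge> pint p M f + t * c"
  shows "p * (LINT x|M. sgn_pow p (f x) * g x) \<ge> c"
proof -
  define t where "t k = 1 / real (Suc k)" for k
  define q where "q k x = (\<bar>f x + t k * g x\<bar> powr p - \<bar>f x\<bar> powr p) / t k" for k x
  have t: "0 < t k" "t k \<le> 1" for k by (auto simp: t_def)
  have t0: "t \<longlonglongrightarrow> 0" unfolding t_def using LIMSEQ_inverse_real_of_nat by (simp add: inverse_eq_divide)
  have [measurable]: "f \<in> borel_measurable M" "g \<in> borel_measurable M"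
    using f g by (auto simp: Lp_def)
  \<comment> \<open>A majorant for all \<open>t\<close> in \<open>(0, 1]\<close>: it dominates the
    slopes at both ends of the quotient.\<close>
  define B where "B x = p * (2 powr p * (\<bar>f x\<bar> powr p + \<bar>g x\<bar> powr p) + \<bar>f x\<bar> powr p + \<bar>g x\<bar> powr p)" for x
  have bound: "\<bar>q k x\<bar> \<le> B x" for k x
  proof -
    have "\<bar>f x + t k * g x\<bar> powr p \<le> 2 powr p * (\<bar>f x\<bar> powr p + \<bar>t k * g x\<bar> powr p)"
      using p by (intro powr_sum_le) auto
    also have "\<dots> \<le> 2 powr p * (\<bar>f x\<bar> powr p + \<bar>g x\<bar> powr p)"
      using t[of k] p by (intro mult_left_mono add_mono powr_mono2) (auto simp: abs_mult mult_left_le_one_le)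
    finally have 1: "\<bar>f x + t k * g x\<bar> powr p \<le> 2 powr p * (\<bar>f x\<bar> powr p + \<bar>g x\<bar> powr p)" .
    have 2: "sgn_pow p (f x + t k * g x) * g x \<le> 2 powr p * (\<bar>f x\<bar> powr p + \<bar>g x\<bar> powr p) + \<bar>g x\<bar> powr p"
      using abs_sgn_pow_mult_le[OF p, of "f x + t k * g x" "g x"] 1 by linarith
    have 3: "- (\<bar>f x\<bar> powr p + \<bar>g x\<bar> powr p) \<le> sgn_pow p (f x) * g x"
      using abs_sgn_pow_mult_le[OF p, of "f x" "g x"] by linarith
    have "q k x \<le> p * (2 powr p * (\<bar>f x\<bar> powr p + \<bar>g x\<bar> powr p) + \<bar>g x\<bar> powr p)"
    proof -
      have "q k x \<le> p * (sgn_pow p (f x + t k * g x) * g x)"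
        unfolding q_def by (rule powr_difference_quotient_bounds(2)[OF p t(1)])
      also have "\<dots> \<le> p * (2 powr p * (\<bar>f x\<bar> powr p + \<bar>g x\<bar> powr p) + \<bar>g x\<bar> powr p)"
        using 2 p by (intro mult_left_mono) auto
      finally show ?thesis .
    qed
    also have "\<dots> \<le> B x" using p by (simp add: B_def)
    finally have u: "q k x \<le> B x" .
    have "- B x \<le> p * (- (\<bar>f x\<bar> powr p + \<bar>g x\<bar> powr p))"
      using p by (simp add: B_def algebra_simps)
    also have "\<dots> \<le> p * (sgn_pow p (f x) * g x)" using 3 p by (intro mult_left_mono) auto
    also have "\<dots> \<le> q k x" unfolding q_def by (rule powr_difference_quotient_bounds(1)[OF p t(1)])
    finally show ?thesis using u by linarith
  qed
  have lim: "(\<lambda>k. q k x) \<longlonglongrightarrow> p * (sgn_pow p (f x) * g x)" for x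
  proof (rule tendsto_sandwich)
    show "\<forall>\<^sub>F k in sequentially. p * (sgn_pow p (f x) * g x) \<le> q k x"
      unfolding q_def using powr_difference_quotient_bounds(1)[OF p t(1)] by (intro always_eventually) blast
    show "\<forall>\<^sub>F k in sequentially. q k x \<le> p * (sgn_pow p (f x + t k * g x) * g x)"
      unfolding q_def using powr_difference_quotient_bounds(2)[OF p t(1)] by (intro always_eventually) blast
    have "(\<lambda>k. f x + t k * g x) \<longlonglongrightarrow> f x + 0 * g x" by (intro tendsto_intros t0)
    then have "(\<lambda>k. sgn_pow p (f x + t k * g x)) \<longlonglongrightarrow> sgn_pow p (f x)"
      using continuous_on_tendsto_compose[OF continuous_on_sgn_pow[OF p]] by (metis UNIV_I add_0_right always_eventually mult_zero_left)
    then show "(\<lambda>k. p * (sgn_pow p (f x + t k * g x) * g x)) \<longlonglongrightarrow> p * (sgn_pow p (f x) * g x)"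
      by (intro tendsto_intros)
  qed simp
  have "(\<lambda>k. LINT x|M. q k x) \<longlonglongrightarrow> (LINT x|M. p * (sgn_pow p (f x) * g x))"
  proof (rule integral_dominated_convergence[where w = B])
    show "integrable M B" unfolding B_def using f g by (simp add: Lp_integrable)
  qed (use lim bound in \<open>auto simp: q_def\<close>)
  moreover have "c \<le> (LINT x|M. q k x)" for k
  proof -
    have "(\<lambda>x. f x + t k * g x) \<in> Lp p M" using f g p by (intro Lp_add Lp_cmult) auto
    then have "(LINT x|M. q k x) = (pint p M (\<lambda>x. f x + t k * g x) - pint p M f) / t k"
      unfolding q_def pint_def using f by (simp add: Lp_integrable)
    moreover have "c \<le> (pint p M (\<lambda>x. f x + t k * g x) - pint p M f) / t k"
      using ge[OF t, of k] t(1)[of k] by (simp add: pos_le_divide_eq mult.commute)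
    ultimately show ?thesis by simp
  qed
  ultimately have "c \<le> (LINT x|M. p * (sgn_pow p (f x) * g x))"
    by (intro LIMSEQ_le_const) auto
  then show ?thesis by simp
qed

section \<open>Fatou's lemma and completeness\<close>

lemma Lp_Fatou:
  fixes g :: "nat \<Rightarrow> 'a \<Rightarrow> real"
  assumes g: "\<And>k. g k \<in> Lp p M" and f: "f \<in> borel_measurable M" and p: "0 < p"
    and lim: "AE x in M. (\<lambda>k. g k x) \<longlonglongrightarrow> f x"
    and bnd: "\<forall>\<^sub>F k in sequentially. pint p M (g k) \<le> B"
  shows "f \<in> Lp p M" "pint p M f \<le> B"
proof -
  have [measurable]: "f \<in> borel_measurable M" "\<And>k. g k \<in> borel_measurable M"
    using f g by (auto simp: Lp_def)
  obtain k where "pint p M (g k) \<le> B" using bnd by (auto simp: eventually_sequentially)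
  then have B: "B \<ge> 0" using pint_nonneg[of p M "g k"] by linarith
  have "(\<integral>\<^sup>+x. ennreal (\<bar>f x\<bar> powr p) \<partial>M) = (\<integral>\<^sup>+x. liminf (\<lambda>k. ennreal (\<bar>g k x\<bar> powr p)) \<partial>M)"
  proof (rule nn_integral_cong_AE)
    show "AE x in M. ennreal (\<bar>f x\<bar> powr p) = liminf (\<lambda>k. ennreal (\<bar>g k x\<bar> powr p))"
      using lim
    proof eventually_elim
      case (elim x)
      have "(\<lambda>k. \<bar>g k x\<bar> powr p) \<longlonglongrightarrow> \<bar>f x\<bar> powr p"
        using elim p by (intro tendsto_powr' tendsto_rabs tendsto_const) auto
      then have "(\<lambda>k. ennreal (\<bar>g k x\<bar> powr p)) \<longlonglongrightarrow> ennreal (\<bar>f x\<bar> powr p)"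
        by (rule tendsto_ennrealI)
      from lim_imp_Liminf[OF _ this] show ?case by simp
    qed
  qed
  also have "\<dots> \<le> liminf (\<lambda>k. \<integral>\<^sup>+x. ennreal (\<bar>g k x\<bar> powr p) \<partial>M)"
    by (rule nn_integral_liminf) measurable
  also have "\<dots> = liminf (\<lambda>k. ennreal (pint p M (g k)))"
    using nn_integral_eq_pint[OF g] by simp
  also have "\<dots> \<le> ennreal B"
  proof -
    have "\<forall>\<^sub>F k in sequentially. ennreal (pint p M (g k)) \<le> ennreal B"
      using bnd by eventually_elim (rule ennreal_leI)
    then have "liminf (\<lambda>k. ennreal (pint p M (g k))) \<le> liminf (\<lambda>k. ennreal B)"
      by (rule Liminf_mono)
    then show ?thesis by (simp add: Liminf_const)
  qed
  finally have le: "(\<integral>\<^sup>+x. ennreal (\<bar>f x\<bar> powr p) \<partial>M) \<le> ennreal B" .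
  then show fL: "f \<in> Lp p M"
    unfolding Lp_iff_nn_integral using f by (auto intro: le_less_trans)
  show "pint p M f \<le> B"
    using le B unfolding nn_integral_eq_pint[OF fL] by (simp add: ennreal_le_iff)
qed

lemma ex_strict_mono_ge:
  fixes N :: "nat \<Rightarrow> nat"
  shows "\<exists>r. strict_mono r \<and> (\<forall>k. N k \<le> r k)"
proof (intro exI conjI allI)
  define r where "r k = (\<Sum>i\<le>k. N i) + k" for k
  show "strict_mono r" unfolding strict_mono_Suc_iff by (simp add: r_def)
  show "N k \<le> r k" for k
    unfolding r_def using member_le_sum[of k "{..k}" N] by simp
qed

text \<open>The subsequence is so fast that the increments, weighted by \<open>w k\<close>, the
  \<open>p\<close>-th power of \<open>2 ^ k\<close>, still have a finite sum of integrals. Almost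
  everywhere the \<open>k\<close>-th increment is then at most a constant times
  \<open>(1/2) ^ k\<close>, and the telescoping series converges. Kept apart from the identification
  of the limit because the jumps of almost minimizers need just this part.\<close>

lemma Lp_Cauchy_AE_convergent_subseq:
  fixes f :: "nat \<Rightarrow> 'a \<Rightarrow> real"
  assumes p: "1 < p" and f: "\<And>k. f k \<in> Lp p M"
    and Cauchy: "\<And>e. e > 0 \<Longrightarrow> \<exists>N. \<forall>k\<ge>N. \<forall>l\<ge>N. pint p M (\<lambda>x. f k x - f l x) \<le> e"
  obtains r where "strict_mono r" "AE x in M. convergent (\<lambda>k. f (r k) x)"
proof -
  define w where "w k = 2 powr (real k * p)" for k
  have wpos: "w k > 0" for k by (simp add: w_def)
  have "\<exists>N. \<forall>n\<ge>N. \<forall>l\<ge>N. pint p M (\<lambda>x. f n x - f l x) \<le> (1/2) ^ k / w k" for k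
    using Cauchy[of "(1/2) ^ k / w k"] wpos by simp
  then obtain N where N: "\<And>k n l. n \<ge> N k \<Longrightarrow> l \<ge> N k \<Longrightarrow> pint p M (\<lambda>x. f n x - f l x) \<le> (1/2) ^ k / w k"
    by metis
  obtain r where r: "strict_mono r" "\<And>k. N k \<le> r k" using ex_strict_mono_ge[of N] by blast
  define D where "D k x = f (r (Suc k)) x - f (r k) x" for k x
  have DL: "D k \<in> Lp p M" for k unfolding D_def using f p by (intro Lp_diff) auto
  have [measurable]: "D k \<in> borel_measurable M" for k using DL by (rule Lp_measurable)
  have Dle: "w k * pint p M (D k) \<le> (1/2) ^ k" for k
  proof -
    have "r k \<le> r (Suc k)" using r(1) by (simp add: strict_mono_less_eq)
    then have "pint p M (D k) \<le> (1/2) ^ k / w k"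
      unfolding D_def using N[of k "r (Suc k)" "r k"] r(2)[of k] by simp
    then show ?thesis using wpos[of k] by (simp add: pos_le_divide_eq mult.commute)
  qed
  have "(\<integral>\<^sup>+x. (\<Sum>k. ennreal (w k * \<bar>D k x\<bar> powr p)) \<partial>M) = (\<Sum>k. \<integral>\<^sup>+x. ennreal (w k * \<bar>D k x\<bar> powr p) \<partial>M)"
    by (rule nn_integral_suminf) measurable
  also have "\<dots> = (\<Sum>k. ennreal (w k * pint p M (D k)))"
  proof (rule suminf_cong)
    fix k
    show "(\<integral>\<^sup>+x. ennreal (w k * \<bar>D k x\<bar> powr p) \<partial>M) = ennreal (w k * pint p M (D k))"
      using less_imp_le[OF wpos[of k]] nn_integral_eq_pint[OF DL[of k]]
      by (simp add: ennreal_mult nn_integral_cmult pint_nonneg)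
  qed
  also have "\<dots> \<le> (\<Sum>k. ennreal ((1/2) ^ k))"
    by (intro suminf_le ennreal_leI Dle) auto
  also have "\<dots> < top"
  proof -
    have "(\<Sum>k. ennreal ((1/2::real) ^ k)) = ennreal (\<Sum>k. (1/2) ^ k)"
      by (intro suminf_ennreal2) (auto intro: summable_geometric)
    then show ?thesis by simp
  qed
  finally have aeS: "AE x in M. (\<Sum>k. ennreal (w k * \<bar>D k x\<bar> powr p)) \<noteq> \<infinity>"
    by (intro nn_integral_noteq_infinite) auto
  have conv: "convergent (\<lambda>k. f (r k) x)"
    if elim: "(\<Sum>k. ennreal (w k * \<bar>D k x\<bar> powr p)) \<noteq> \<infinity>" for x
  proof -
    define S where "S = enn2real (\<Sum>k. ennreal (w k * \<bar>D k x\<bar> powr p))"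
    have S: "(\<Sum>k. ennreal (w k * \<bar>D k x\<bar> powr p)) = ennreal S"
      using elim unfolding S_def by (subst ennreal_enn2real) (simp_all add: top.not_eq_extremum)
    have S0: "S \<ge> 0" unfolding S_def by (rule enn2real_nonneg)
    have "norm (D k x) \<le> S powr (1 / p) * (1/2) ^ k" for k
    proof -
      have "ennreal (w k * \<bar>D k x\<bar> powr p) \<le> (\<Sum>k. ennreal (w k * \<bar>D k x\<bar> powr p))"
        using sum_le_suminf[OF summableI, of "{k}" "\<lambda>k. ennreal (w k * \<bar>D k x\<bar> powr p)"] by simp
      then have "w k * \<bar>D k x\<bar> powr p \<le> S"
        unfolding S using S0 by (simp only: ennreal_le_iff)
      moreover have "(2 ^ k * \<bar>D k x\<bar>) powr p = w k * \<bar>D k x\<bar> powr p"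
      proof -
        have "(2 ^ k * \<bar>D k x\<bar>) powr p = (2 powr real k) powr p * \<bar>D k x\<bar> powr p"
          by (subst powr_mult) (simp add: powr_realpow)
        then show ?thesis by (simp only: powr_powr w_def)
      qed
      ultimately have "(2 ^ k * \<bar>D k x\<bar>) powr p \<le> S" by simp
      then have "2 ^ k * \<bar>D k x\<bar> \<le> S powr (1 / p)"
        using p S0 by (intro le_powr_inverse) simp_all
      then have "\<bar>D k x\<bar> \<le> S powr (1 / p) / 2 ^ k" by (simp add: pos_le_divide_eq mult.commute)
      then show ?thesis by (simp add: power_one_over)
    qed
    then have "summable (\<lambda>k. D k x)"
      by (rule summable_comparison_test'[of "\<lambda>k. S powr (1 / p) * (1/2) ^ k" 0, rotated])
        (intro summable_mult summable_geometric, simp)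
    then have "(\<lambda>n. f (r 0) x + (\<Sum>k<n. D k x)) \<longlonglongrightarrow> f (r 0) x + (\<Sum>k. D k x)"
      by (intro tendsto_intros summable_LIMSEQ)
    moreover have "f (r 0) x + (\<Sum>k<n. D k x) = f (r n) x" for n
      unfolding D_def by (subst sum_lessThan_telescope) simp
    ultimately show ?thesis by (auto simp: convergent_def)
  qed
  have "AE x in M. convergent (\<lambda>k. f (r k) x)"
    by (rule AE_mp[OF aeS], intro AE_I2 impI, rule conv)
  with r(1) that show ?thesis by blast
qed

lemma Lp_Cauchy_limit:
  fixes f :: "nat \<Rightarrow> 'a \<Rightarrow> real"
  assumes p: "1 < p" and f: "\<And>k. f k \<in> Lp p M"
    and Cauchy: "\<And>e. e > 0 \<Longrightarrow> \<exists>N. \<forall>k\<ge>N. \<forall>l\<ge>N. pint p M (\<lambda>x. f k x - f l x) \<le> e"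
  obtains r g where "strict_mono r" "g \<in> Lp p M" "AE x in M. (\<lambda>k. f (r k) x) \<longlonglongrightarrow> g x"
    "(\<lambda>k. pint p M (\<lambda>x. f k x - g x)) \<longlonglongrightarrow> 0"
proof -
  obtain r where r: "strict_mono r" "AE x in M. convergent (\<lambda>k. f (r k) x)"
    using Lp_Cauchy_AE_convergent_subseq[OF assms] by blast
  have [measurable]: "\<And>k. f k \<in> borel_measurable M" using f by (rule Lp_measurable)
  define g where "g x = lim (\<lambda>k. f (r k) x)" for x
  have g[measurable]: "g \<in> borel_measurable M" unfolding g_def by measurable
  have lim: "AE x in M. (\<lambda>k. f (r k) x) \<longlonglongrightarrow> g x"
    using r(2) by eventually_elim (simp add: g_def convergent_LIMSEQ_iff)
  \<comment> \<open>Fatou in the second index, with the first one fixed.\<close>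
  have main: "(\<lambda>x. f k x - g x) \<in> Lp p M \<and> pint p M (\<lambda>x. f k x - g x) \<le> e"
    if N: "\<forall>k\<ge>N. \<forall>l\<ge>N. pint p M (\<lambda>x. f k x - f l x) \<le> e" and k: "k \<ge> N" for N k e
  proof -
    have fl: "(\<lambda>x. f k x - f (r l) x) \<in> Lp p M" for l using f p by (intro Lp_diff) auto
    have "AE x in M. (\<lambda>l. f k x - f (r l) x) \<longlonglongrightarrow> f k x - g x"
      using lim by eventually_elim (intro tendsto_intros)
    moreover have "\<forall>\<^sub>F l in sequentially. pint p M (\<lambda>x. f k x - f (r l) x) \<le> e"
    proof (rule eventually_sequentiallyI)
      fix l assume "N \<le> l"
      then have "N \<le> r l" using seq_suble[OF r(1), of l] by simp
      then show "pint p M (\<lambda>x. f k x - f (r l) x) \<le> e" using N k by blast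
    qed
    ultimately show ?thesis using p by (intro conjI Lp_Fatou[OF fl]) auto
  qed
  obtain N1 where "\<forall>k\<ge>N1. \<forall>l\<ge>N1. pint p M (\<lambda>x. f k x - f l x) \<le> 1" using Cauchy[of 1] by auto
  then have gl: "(\<lambda>x. f N1 x - g x) \<in> Lp p M" using main by blast
  have "(\<lambda>x. f N1 x - (f N1 x - g x)) \<in> Lp p M"
    by (rule Lp_diff[OF f gl]) (use p in simp)
  then have gL: "g \<in> Lp p M" by (simp only: diff_diff_eq2 add_diff_cancel_left')
  have "(\<lambda>k. pint p M (\<lambda>x. f k x - g x)) \<longlonglongrightarrow> 0"
  proof (rule LIMSEQ_I)
    fix e :: real assume "e > 0"
    then obtain N where "\<forall>k\<ge>N. \<forall>l\<ge>N. pint p M (\<lambda>x. f k x - f l x) \<le> e / 2"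
      using Cauchy[of "e / 2"] by auto
    then show "\<exists>N. \<forall>k\<ge>N. norm (pint p M (\<lambda>x. f k x - g x) - 0) < e"
    proof (intro exI allI impI)
      fix k assume "k \<ge> N"
      then have "pint p M (\<lambda>x. f k x - g x) \<le> e / 2"
        using main[OF \<open>\<forall>k\<ge>N. \<forall>l\<ge>N. pint p M (\<lambda>x. f k x - f l x) \<le> e / 2\<close>] by blast
      then show "norm (pint p M (\<lambda>x. f k x - g x) - 0) < e"
        using \<open>e > 0\<close> pint_nonneg[of p M "\<lambda>x. f k x - g x"] by simp
    qed
  qed
  with r(1) gL lim that show ?thesis by blast
qed

text \<open>Jensen's inequality, by integrating the tangent at the mean \<open>m\<close>, whose
  linear part has integral 0. The right side may be infinite, hence \<open>ennreal\<close>.\<close>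

lemma average_powr_le:
  assumes p: "1 < p" and fin: "finite_measure M" and pos: "measure M (space M) > 0"
    and f: "integrable M f"
  shows "ennreal (measure M (space M) * \<bar>c - (LINT x|M. f x) / measure M (space M)\<bar> powr p)
    \<le> (\<integral>\<^sup>+x. ennreal (\<bar>c - f x\<bar> powr p) \<partial>M)"
proof (cases "(\<integral>\<^sup>+x. ennreal (\<bar>c - f x\<bar> powr p) \<partial>M) < top")
  case True
  interpret finite_measure M by fact
  define V where "V = measure M (space M)"
  define m where "m = c - (LINT x|M. f x) / V"
  have [measurable]: "f \<in> borel_measurable M" using f by auto
  have L: "(\<lambda>x. c - f x) \<in> Lp p M" using True by (simp add: Lp_iff_nn_integral)
  have "V * \<bar>m\<bar> powr p = (LINT x|M. \<bar>m\<bar> powr p + p * sgn_pow p m * ((c - f x) - m))"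
  proof -
    have "(LINT x|M. \<bar>m\<bar> powr p + p * sgn_pow p m * ((c - f x) - m))
        = V * \<bar>m\<bar> powr p + p * sgn_pow p m * (V * c - (LINT x|M. f x) - V * m)"
      using f by (simp add: V_def)
    also have "V * c - (LINT x|M. f x) - V * m = 0"
      using pos unfolding m_def V_def[symmetric] by (simp add: right_diff_distrib)
    finally show ?thesis by simp
  qed
  also have "\<dots> \<le> pint p M (\<lambda>x. c - f x)"
    unfolding pint_def
  proof (rule integral_mono)
    show "integrable M (\<lambda>x. \<bar>c - f x\<bar> powr p)" using L by (rule Lp_integrable)
    show "integrable M (\<lambda>x. \<bar>m\<bar> powr p + p * sgn_pow p m * ((c - f x) - m))" using f by simp
    show "\<bar>m\<bar> powr p + p * sgn_pow p m * ((c - f x) - m) \<le> \<bar>c - f x\<bar> powr p" for x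
      by (rule powr_ge_tangent[OF p])
  qed
  finally show ?thesis
    unfolding nn_integral_eq_pint[OF L] by (intro ennreal_leI) (simp add: V_def m_def)
qed (auto simp: not_less top_unique)

section \<open>Borel representatives\<close>

lemma lebesgue_borel_representative:
  fixes u :: "'a::euclidean_space \<Rightarrow> real"
  assumes "u \<in> borel_measurable lebesgue"
  obtains u' where "u' \<in> borel_measurable borel" "AE x in lborel. u x = u' x"
  using completion_ex_borel_measurable_real[OF assms] by auto

text \<open>The exceptional pairs lie in \<open>N \<times> UNIV \<union> UNIV \<times> N\<close>, a
  null set, so a function may be replaced by a representative inside a double integral.\<close>

lemma AE_lborel_fst_snd:
  fixes P :: "'a::euclidean_space \<Rightarrow> bool"
  assumes "AE x in lborel. P x"
  shows "AE z in (lborel :: ('a \<times> 'a) measure). P (fst z) \<and> P (snd z)"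
proof -
  obtain N where N: "{x. \<not> P x} \<subseteq> N" "N \<in> null_sets lborel"
    using assms by (auto simp: eventually_ae_filter)
  have "N \<times> UNIV \<in> null_sets (lborel \<Otimes>\<^sub>M (lborel :: 'a measure))"
    "UNIV \<times> N \<in> null_sets ((lborel :: 'a measure) \<Otimes>\<^sub>M lborel)"
    using N(2) by (auto intro: lborel.times_in_null_sets1 lborel.times_in_null_sets2)
  then have "N \<times> UNIV \<union> UNIV \<times> N \<in> null_sets (lborel :: ('a \<times> 'a) measure)"
    unfolding lborel_prod by (rule null_sets.Un)
  moreover have "{z \<in> space lborel. \<not> (P (fst z) \<and> P (snd z))} \<subseteq> N \<times> UNIV \<union> UNIV \<times> N"
    using N(1) by auto
  ultimately show ?thesis unfolding eventually_ae_filter by blast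
qed

lemma nn_integral_lebesgue_cong_AE:
  assumes "AE x in lborel. f x = g x"
  shows "(\<integral>\<^sup>+x. f x \<partial>lebesgue) = (\<integral>\<^sup>+x. g x \<partial>lborel)"
  unfolding nn_integral_completion by (rule nn_integral_cong_AE[OF assms])

lemma integral_lebesgue_cong_AE:
  fixes f g :: "'a::euclidean_space \<Rightarrow> real"
  assumes g: "g \<in> borel_measurable borel" and ae: "AE x in lborel. f x = g x"
  shows "(LINT x|lebesgue. f x) = (LINT x|lborel. g x)"
proof -
  have ae': "AE x in lebesgue. f x = g x" using ae by (simp add: AE_completion_iff)
  have g': "g \<in> borel_measurable lebesgue" using g by (simp add: measurable_completion)
  have "f \<in> borel_measurable lebesgue"
    using borel_measurable_AE[OF g'] ae' by (auto simp: eq_commute)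
  then have "(LINT x|lebesgue. f x) = (LINT x|lebesgue. g x)"
    using g' ae' by (intro integral_cong_AE) auto
  also have "\<dots> = (LINT x|lborel. g x)" using g by (intro integral_completion) auto
  finally show ?thesis .
qed

section \<open>Density of a smooth domain at its closure\<close>

text \<open>The derivatives along the basis vectors are continuous, hence bounded on the compact
  ball; the sum of their bounds controls the operator norm, and the mean value inequality applies on
  the convex ball.\<close>

lemma smooth_imp_Lipschitz_on_cball:
  fixes \<gamma> :: "'a::euclidean_space \<Rightarrow> real"
  assumes "smooth \<gamma>"
  shows "\<exists>L\<ge>0. \<forall>x\<in>cball c R. \<forall>y\<in>cball c R. \<bar>\<gamma> x - \<gamma> y\<bar> \<le> L * norm (x - y)"
proof -
  have "C_k (Suc 0) \<gamma>" using assms unfolding smooth_def by blast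
  then have diff: "\<gamma> differentiable_on UNIV"
    and cont: "\<And>v. continuous_on UNIV (\<lambda>x. frechet_derivative \<gamma> (at x) v)"
    by auto
  have der: "(\<gamma> has_derivative frechet_derivative \<gamma> (at x)) (at x)" for x
    using diff by (simp add: differentiable_on_def frechet_derivative_works)
  have "\<exists>B. \<forall>x\<in>cball c R. \<bar>frechet_derivative \<gamma> (at x) b\<bar> \<le> B" for b
  proof -
    have "compact ((\<lambda>x. frechet_derivative \<gamma> (at x) b) ` cball c R)"
      by (intro compact_continuous_image continuous_on_subset[OF cont]) auto
    then show ?thesis by (auto dest!: compact_imp_bounded simp: bounded_iff)
  qed
  then obtain B where B: "\<And>b x. x \<in> cball c R \<Longrightarrow> \<bar>frechet_derivative \<gamma> (at x) b\<bar> \<le> B b"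
    by metis
  define L where "L = (\<Sum>b\<in>Basis. \<bar>B b\<bar>)"
  have onorm: "onorm (frechet_derivative \<gamma> (at x)) \<le> L" if x: "x \<in> cball c R" for x
  proof (rule onorm_le)
    fix h :: 'a
    interpret linear "frechet_derivative \<gamma> (at x)"
      using der[of x] by (rule has_derivative_linear)
    have "frechet_derivative \<gamma> (at x) h = frechet_derivative \<gamma> (at x) (\<Sum>b\<in>Basis. (h \<bullet> b) *\<^sub>R b)"
      by (simp add: euclidean_representation)
    also have "\<dots> = (\<Sum>b\<in>Basis. (h \<bullet> b) * frechet_derivative \<gamma> (at x) b)"
      by (simp add: sum scale)
    also have "norm \<dots> \<le> (\<Sum>b\<in>Basis. norm h * \<bar>B b\<bar>)"
    proof (rule sum_norm_le)
      fix b :: 'a assume "b \<in> Basis"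
      then show "norm ((h \<bullet> b) * frechet_derivative \<gamma> (at x) b) \<le> norm h * \<bar>B b\<bar>"
        using B[OF x, of b] by (auto simp: abs_mult Basis_le_norm intro!: mult_mono)
    qed
    finally show "norm (frechet_derivative \<gamma> (at x) h) \<le> L * norm h"
      by (simp add: L_def sum_distrib_left mult.commute)
  qed
  have "\<bar>\<gamma> x - \<gamma> y\<bar> \<le> L * norm (x - y)" if "x \<in> cball c R" "y \<in> cball c R" for x y
  proof -
    have "norm (\<gamma> x - \<gamma> y) \<le> L * norm (x - y)"
      by (rule differentiable_bound[OF convex_cball _ onorm that])
        (use der in \<open>auto intro: has_derivative_at_withinI\<close>)
    then show ?thesis by simp
  qed
  moreover have "L \<ge> 0" by (simp add: L_def sum_nonneg)
  ultimately show ?thesis by blast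
qed

text \<open>An interior corkscrew condition. Moving from \<open>x\<close> by \<open>r / 2\<close>
  along \<open>e\<close> keeps the projection \<open>P x\<close> and raises the height above the
  graph by \<open>r / 2\<close>. Inside a ball of radius \<open>\<kappa> * r\<close> around the new
  point the height varies by at most \<open>(2 * L + 1) * \<kappa> * r\<close>, which is
  \<open>r / 2\<close> by the choice of \<open>\<kappa>\<close>.\<close>

lemma smooth_boundary_interior_balls:
  fixes U :: "'a::euclidean_space set"
  assumes "smooth_boundary U" and x0: "x0 \<in> frontier U"
  shows "\<exists>\<rho>>0. \<exists>\<kappa>>0. \<kappa> \<le> 1 \<and>
    (\<forall>x\<in>U \<inter> ball x0 \<rho>. \<forall>r. 0 < r \<and> r \<le> \<rho> \<longrightarrow> (\<exists>z. ball z (\<kappa> * r) \<subseteq> U \<inter> ball x r))"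
proof -
  obtain R e \<gamma> where R: "R > 0" and e: "norm e = 1" and \<gamma>: "smooth \<gamma>"
    and U: "U \<inter> ball x0 R = {x \<in> ball x0 R. \<gamma> (x - (x \<bullet> e) *\<^sub>R e) < x \<bullet> e}"
    using assms unfolding smooth_boundary_def by blast
  define P where "P x = x - (x \<bullet> e) *\<^sub>R e" for x
  have U_iff: "x \<in> U \<longleftrightarrow> \<gamma> (P x) < x \<bullet> e" if "x \<in> ball x0 R" for x
    using U that unfolding P_def by blast
  have Pdiff: "P x - P y = P (x - y)" for x y
    by (simp add: P_def inner_diff_left algebra_simps)
  have Pnorm: "norm (P x) \<le> 2 * norm x" for x
  proof -
    have "norm (P x) \<le> norm x + norm ((x \<bullet> e) *\<^sub>R e)" unfolding P_def by (rule norm_triangle_ineq4)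
    also have "norm ((x \<bullet> e) *\<^sub>R e) \<le> norm x" using e Cauchy_Schwarz_ineq2[of x e] by simp
    finally show ?thesis by simp
  qed
  have ee: "e \<bullet> e = 1" using e by (simp add: dot_square_norm)
  then have Pe: "P (t *\<^sub>R e + h) = P h" for t h by (simp add: P_def inner_add_left algebra_simps)
  obtain L where L: "L \<ge> 0" "\<And>x y. x \<in> cball (P x0) (2 * R) \<Longrightarrow> y \<in> cball (P x0) (2 * R) \<Longrightarrow>
      \<bar>\<gamma> x - \<gamma> y\<bar> \<le> L * norm (x - y)"
    using smooth_imp_Lipschitz_on_cball[OF \<gamma>, of "P x0" "2 * R"] by blast
  have Pball: "P x \<in> cball (P x0) (2 * R)" if "x \<in> ball x0 R" for x
    using Pnorm[of "x0 - x"] that by (simp add: dist_norm Pdiff)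
  define \<kappa> where "\<kappa> = 1 / (2 * (2 * L + 1))"
  have \<kappa>: "\<kappa> > 0" "\<kappa> \<le> 1/2" "(2 * L + 1) * \<kappa> = 1/2" using L(1) by (auto simp: \<kappa>_def field_simps)
  define \<rho> where "\<rho> = R / 4"
  have "\<exists>z. ball z (\<kappa> * r) \<subseteq> U \<inter> ball x r"
    if x: "x \<in> U" "x \<in> ball x0 \<rho>" and r: "0 < r" "r \<le> \<rho>" for x r
  proof (intro exI subsetI)
    fix y assume y: "y \<in> ball (x + (r / 2) *\<^sub>R e) (\<kappa> * r)"
    define h where "h = y - (x + (r / 2) *\<^sub>R e)"
    have h: "norm h < \<kappa> * r" using y by (simp add: h_def dist_norm norm_minus_commute)
    have yx: "y - x = (r / 2) *\<^sub>R e + h" by (simp add: h_def)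
    have "\<kappa> * r \<le> 1/2 * r" using \<kappa> r by (intro mult_right_mono) auto
    moreover have "norm (y - x) \<le> r / 2 + norm h"
      unfolding yx using norm_triangle_ineq[of "(r / 2) *\<^sub>R e" h] e r by simp
    ultimately have yr: "norm (y - x) < r" using h by simp
    have xR: "x \<in> ball x0 R" using x R by (auto simp: \<rho>_def)
    have "dist x0 y \<le> dist x0 x + norm (y - x)" by (metis dist_commute dist_norm dist_triangle)
    then have yR: "y \<in> ball x0 R" using yr x(2) r R by (simp add: \<rho>_def)
    have "\<gamma> (P y) \<le> \<gamma> (P x) + L * norm (P y - P x)"
      using L(2)[OF Pball[OF yR] Pball[OF xR]] by linarith
    also have "P y - P x = P h" by (simp add: Pdiff yx Pe)
    also have "L * norm (P h) \<le> L * (2 * (\<kappa> * r))"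
      using L(1) Pnorm[of h] h by (intro mult_left_mono) auto
    also have "\<gamma> (P x) < x \<bullet> e" using U_iff[OF xR] x by simp
    finally have "\<gamma> (P y) < x \<bullet> e + L * (2 * (\<kappa> * r))" by simp
    also have "L * (2 * (\<kappa> * r)) = r * ((2 * L + 1) * \<kappa>) - \<kappa> * r" by (simp add: algebra_simps)
    also have "\<dots> = r / 2 - \<kappa> * r" using \<kappa>(3) by simp
    also have "x \<bullet> e + (r / 2 - \<kappa> * r) \<le> y \<bullet> e"
    proof -
      have "y \<bullet> e = x \<bullet> e + r / 2 + h \<bullet> e"
        by (simp add: h_def inner_diff_left inner_add_left ee)
      moreover have "- norm h \<le> h \<bullet> e" using Cauchy_Schwarz_ineq2[of h e] e by simp
      ultimately show ?thesis using h by simp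
    qed
    finally have "y \<in> U" using U_iff[OF yR] by simp
    then show "y \<in> U \<inter> ball x r" using yr by (simp add: dist_norm norm_minus_commute)
  qed
  then show ?thesis using R \<kappa> by (intro exI[of _ \<rho>] conjI exI[of _ \<kappa>]) (auto simp: \<rho>_def)
qed

text \<open>Minima over a finite subcover of the closure make the local constants uniform. A point
  of the closure is first replaced by a point of \<open>U\<close> at distance less than
  \<open>r / 2\<close>, and the remaining radius \<open>r / 2\<close> accounts for the factor
  \<open>k / 2\<close>.\<close>

lemma smooth_bounded_domain_density:
  fixes U :: "'a::euclidean_space set"
  assumes "smooth_bounded_domain U"
  obtains c r0 where "0 < c" "c \<le> 1" "0 < r0" "r0 \<le> 1"
    "\<And>x r. x \<in> closure U \<Longrightarrow> 0 < r \<Longrightarrow> r \<le> r0 \<Longrightarrow> c * r ^ DIM('a) \<le> measure lborel (U \<inter> ball x r)"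
proof -
  have U: "open U" "bounded U" "U \<noteq> {}" "smooth_boundary U"
    using assms by (auto simp: smooth_bounded_domain_def)
  have "\<exists>\<rho>>0. \<exists>\<kappa>>0. \<kappa> \<le> 1 \<and>
    (\<forall>x\<in>U \<inter> ball x0 \<rho>. \<forall>r. 0 < r \<and> r \<le> \<rho> \<longrightarrow> (\<exists>z. ball z (\<kappa> * r) \<subseteq> U \<inter> ball x r))"
    if "x0 \<in> closure U" for x0
  proof (cases "x0 \<in> U")
    case True
    then obtain \<delta> where \<delta>: "\<delta> > 0" "ball x0 \<delta> \<subseteq> U" using U(1) openE by blast
    have "ball x (1 * r) \<subseteq> U \<inter> ball x r" if "x \<in> ball x0 (\<delta> / 2)" "r \<le> \<delta> / 2" for x r
    proof
      fix y assume y: "y \<in> ball x (1 * r)"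
      have "dist x0 y \<le> dist x0 x + dist x y" by (rule dist_triangle)
      then have "y \<in> ball x0 \<delta>" using y that by auto
      then show "y \<in> U \<inter> ball x r" using y \<delta>(2) by auto
    qed
    then show ?thesis using \<delta>(1)
      by (intro exI[of _ "\<delta> / 2"] conjI exI[of _ 1] ballI allI impI) (simp, simp, simp, blast)
  next
    case False
    then have "x0 \<in> frontier U" using that U(1) by (simp add: frontier_def interior_open)
    then show ?thesis by (rule smooth_boundary_interior_balls[OF U(4)])
  qed
  then obtain \<rho> \<kappa> where \<rho>\<kappa>: "\<And>x0. x0 \<in> closure U \<Longrightarrow> \<rho> x0 > 0"
    "\<And>x0. x0 \<in> closure U \<Longrightarrow> \<kappa> x0 > 0 \<and> \<kappa> x0 \<le> 1"
    "\<And>x0 x r. x0 \<in> closure U \<Longrightarrow> x \<in> U \<Longrightarrow> x \<in> ball x0 (\<rho> x0) \<Longrightarrow> 0 < r \<Longrightarrow> r \<le> \<rho> x0 \<Longrightarrow>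
      \<exists>z. ball z (\<kappa> x0 * r) \<subseteq> U \<inter> ball x r"
    by (metis Int_iff)
  have cpt: "compact (closure U)" using U(2) by (simp add: compact_closure)
  have cover: "closure U \<subseteq> (\<Union>x\<in>closure U. ball x (\<rho> x))" using \<rho>\<kappa>(1) by fastforce
  obtain T where T: "T \<subseteq> closure U" "finite T" "closure U \<subseteq> (\<Union>x\<in>T. ball x (\<rho> x))"
    by (rule compactE_image[OF cpt open_ball cover])
  have "T \<noteq> {}" using T(3) U(3) closure_subset by fastforce
  define r1 where "r1 = min 1 (Min (\<rho> ` T))"
  define k where "k = Min (\<kappa> ` T)"
  have r1: "r1 > 0" "r1 \<le> 1" "\<And>t. t \<in> T \<Longrightarrow> r1 \<le> \<rho> t"
    using T \<open>T \<noteq> {}\<close> \<rho>\<kappa>(1) by (auto simp: r1_def min_le_iff_disj)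
  have k: "k > 0" "\<And>t. t \<in> T \<Longrightarrow> k \<le> \<kappa> t"
    using T \<open>T \<noteq> {}\<close> \<rho>\<kappa>(2) by (auto simp: k_def)
  define \<omega> where "\<omega> = unit_ball_vol (real DIM('a))"
  have \<omega>: "\<omega> > 0" by (simp add: \<omega>_def)
  define c where "c = min 1 (\<omega> * (k / 2) ^ DIM('a))"
  have key: "c * r ^ DIM('a) \<le> measure lborel (U \<inter> ball x r)"
    if x: "x \<in> closure U" and r: "0 < r" "r \<le> r1" for x r
  proof -
    obtain x' where x': "x' \<in> U" "dist x' x < r / 2"
      using x r closure_approachable[of x U] half_gt_zero by blast
    have "x' \<in> closure U" using x'(1) closure_subset by blast
    then obtain t where t: "t \<in> T" "x' \<in> ball t (\<rho> t)" using T(3) by blast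
    have "r / 2 \<le> \<rho> t" using r1(3)[OF t(1)] r by simp
    then obtain z where z: "ball z (\<kappa> t * (r / 2)) \<subseteq> U \<inter> ball x' (r / 2)"
      using \<rho>\<kappa>(3)[of t x' "r / 2"] t x'(1) T(1) r by auto
    have "ball z (k * (r / 2)) \<subseteq> ball z (\<kappa> t * (r / 2))"
      using k(2)[OF t(1)] r by (intro subset_ball mult_right_mono) auto
    moreover have "ball x' (r / 2) \<subseteq> ball x r"
    proof
      fix y assume "y \<in> ball x' (r / 2)"
      then show "y \<in> ball x r" using dist_triangle[of x y x'] x'(2) by (simp add: dist_commute)
    qed
    ultimately have sub: "ball z (k * (r / 2)) \<subseteq> U \<inter> ball x r" using z by blast
    have "c * r ^ DIM('a) \<le> (\<omega> * (k / 2) ^ DIM('a)) * r ^ DIM('a)"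
      using r by (intro mult_right_mono) (auto simp: c_def)
    also have "\<dots> = \<omega> * (k * (r / 2)) ^ DIM('a)" by (simp add: power_mult_distrib power_divide)
    also have "\<dots> = measure lborel (ball z (k * (r / 2)))"
      using k(1) r by (simp add: content_ball \<omega>_def)
    also have "\<dots> \<le> measure lborel (U \<inter> ball x r)"
    proof (rule measure_mono_fmeasurable[OF sub])
      show "U \<inter> ball x r \<in> fmeasurable lborel"
        using U(1,2) emeasure_bounded_finite[of "U \<inter> ball x r"] by (intro fmeasurableI) (auto simp: bounded_Int)
    qed auto
    finally show ?thesis .
  qed
  show ?thesis
    by (rule that[of c r1]) (use key r1 k \<omega> in \<open>auto simp: c_def\<close>)
qed

section \<open>Integrability of truncated powers of the norm\<close>

lemma pred_mem_cball [measurable]: "Measurable.pred borel (\<lambda>x::'a::euclidean_space. x \<in> cball c r)"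
  by (simp add: pred_def)

text \<open>Does the work of polar coordinates: a function dominated by constants on a sequence of
  balls has its integral bounded by a geometric series.\<close>

lemma nn_integral_finite_by_balls:
  fixes f :: "'a::euclidean_space \<Rightarrow> ennreal"
  assumes le: "\<And>z. f z \<le> (\<Sum>k. ennreal (\<alpha> k) * indicator (cball 0 (R k)) z)"
    and pos: "\<And>k. \<alpha> k \<ge> 0" "\<And>k. R k \<ge> 0"
    and geo: "\<And>k. \<alpha> k * R k ^ DIM('a) \<le> A * q ^ k" and q: "0 \<le> q" "q < 1"
  shows "(\<integral>\<^sup>+z. f z \<partial>lborel) < top"
proof -
  define \<omega> where "\<omega> = unit_ball_vol (real DIM('a))"
  have \<omega>: "\<omega> \<ge> 0" by (simp add: \<omega>_def)
  have "(\<integral>\<^sup>+z. f z \<partial>lborel) \<le> (\<integral>\<^sup>+z. (\<Sum>k. ennreal (\<alpha> k) * indicator (cball (0::'a) (R k)) z) \<partial>lborel)"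
    by (intro nn_integral_mono le)
  also have "\<dots> = (\<Sum>k. \<integral>\<^sup>+z. ennreal (\<alpha> k) * indicator (cball (0::'a) (R k)) z \<partial>lborel)"
    by (rule nn_integral_suminf) measurable
  also have "\<dots> = (\<Sum>k. ennreal (\<alpha> k) * ennreal (\<omega> * R k ^ DIM('a)))"
    using pos(2) by (simp add: nn_integral_cmult_indicator emeasure_cball \<omega>_def)
  also have "\<dots> \<le> (\<Sum>k. ennreal ((\<omega> * A) * q ^ k))"
  proof (intro suminf_le summableI)
    fix k
    have "\<alpha> k * (\<omega> * R k ^ DIM('a)) = \<omega> * (\<alpha> k * R k ^ DIM('a))" by simp
    also have "\<dots> \<le> \<omega> * (A * q ^ k)" using \<omega> geo by (intro mult_left_mono) auto
    finally show "ennreal (\<alpha> k) * ennreal (\<omega> * R k ^ DIM('a)) \<le> ennreal ((\<omega> * A) * q ^ k)"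
      using pos(1)[of k] \<omega> pos(2)[of k] by (subst ennreal_mult[symmetric]) (auto intro!: ennreal_leI simp: mult.assoc)
  qed
  also have "\<dots> = ennreal (\<Sum>k. (\<omega> * A) * q ^ k)"
  proof (rule suminf_ennreal2)
    have "0 \<le> A" using geo[of 0] pos(1)[of 0] pos(2)[of 0] by (metis mult.right_neutral mult_nonneg_nonneg order_trans power_0 zero_le_power)
    then show "0 \<le> \<omega> * A * q ^ k" for k using \<omega> q by simp
    show "summable (\<lambda>k. \<omega> * A * q ^ k)" using q by (intro summable_mult summable_geometric) auto
  qed
  also have "\<dots> < top" by simp
  finally show ?thesis .
qed

lemma single_le_suminf_ennreal:
  fixes g :: "nat \<Rightarrow> ennreal"
  shows "g k \<le> (\<Sum>k. g k)"
  using sum_le_suminf[OF summableI, of "{k}" g] by simp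

lemma nn_integral_norm_powr_near:
  assumes a: "a > 0"
  shows "(\<integral>\<^sup>+z. indicator (cball 0 1) z * ennreal (norm (z::'a::euclidean_space) powr (a - real DIM('a))) \<partial>lborel) < top"
proof (rule nn_integral_finite_by_balls)
  define b where "b = a - real DIM('a)"
  \<comment> \<open>On the dyadic shell \<open>k\<close> the power of the norm differs from
    \<open>2 powr (- real k * b)\<close> by a factor of at most \<open>2 powr \<bar>b\<bar>\<close>,
    whatever the sign of \<open>b\<close>.\<close>
  define \<alpha> where "\<alpha> k = 2 powr \<bar>b\<bar> * 2 powr (- real k * b)" for k
  define R where "R k = 2 powr (- real k)" for k
  show "\<And>k. \<alpha> k \<ge> 0" "\<And>k. R k \<ge> 0" by (simp_all add: \<alpha>_def R_def)
  show "0 \<le> 2 powr (-a)" "2 powr (-a) < 1" using a by (auto simp: powr_less_one)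
  fix k
  have "R k ^ DIM('a) = 2 powr (- real k * real DIM('a))"
    by (simp add: R_def powr_powr flip: powr_realpow)
  then have "\<alpha> k * R k ^ DIM('a) = 2 powr \<bar>b\<bar> * 2 powr (- real k * b + - real k * real DIM('a))"
    by (simp only: \<alpha>_def powr_add mult.assoc)
  also have "- real k * b + - real k * real DIM('a) = (-a) * real k" by (simp add: b_def algebra_simps)
  also have "2 powr ((-a) * real k) = (2 powr (-a)) ^ k" by (simp add: powr_powr flip: powr_realpow)
  finally show "\<alpha> k * R k ^ DIM('a) \<le> 2 powr \<bar>b\<bar> * (2 powr (-a)) ^ k" by simp
next
  define b where "b = a - real DIM('a)"
  define \<alpha> where "\<alpha> k = 2 powr \<bar>b\<bar> * 2 powr (- real k * b)" for k
  define R where "R k = 2 powr (- real k)" for k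
  fix z :: 'a
  show "indicator (cball 0 1) z * ennreal (norm z powr (a - real DIM('a)))
    \<le> (\<Sum>k. ennreal (2 powr \<bar>a - real DIM('a)\<bar> * 2 powr (- real k * (a - real DIM('a)))) * indicator (cball 0 (2 powr (- real k))) z)"
  proof (cases "z \<in> cball 0 1 \<and> z \<noteq> 0")
    case True
    define t where "t = - log 2 (norm z)"
    define k where "k = nat \<lfloor>t\<rfloor>"
    have nz: "norm z = 2 powr (- t)" using True by (simp add: t_def)
    have t0: "t \<ge> 0" using True by (simp add: t_def)
    then have "real k = of_int \<lfloor>t\<rfloor>" by (simp add: k_def)
    then have k: "real k \<le> t" "t \<le> real k + 1" by linarith+
    have "norm z powr b = 2 powr (- t * b)" unfolding nz by (simp add: powr_powr)
    also have "\<dots> \<le> 2 powr (\<bar>b\<bar> + - real k * b)"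
    proof (rule powr_mono)
      have "(real k - t) * b \<le> \<bar>real k - t\<bar> * \<bar>b\<bar>" by (metis abs_ge_self abs_mult)
      also have "\<dots> \<le> 1 * \<bar>b\<bar>" using k by (intro mult_right_mono) auto
      finally show "- t * b \<le> \<bar>b\<bar> + - real k * b" by (simp add: algebra_simps)
    qed simp
    also have "\<dots> = \<alpha> k" by (simp only: \<alpha>_def powr_add)
    finally have 1: "norm z powr b \<le> \<alpha> k" .
    have 2: "z \<in> cball 0 (R k)" using k by (simp add: R_def nz)
    have "indicator (cball 0 1) z * ennreal (norm z powr b) \<le> ennreal (\<alpha> k) * indicator (cball 0 (R k)) z"
      using True 1 2 by (simp add: ennreal_leI)
    also have "\<dots> \<le> (\<Sum>k. ennreal (\<alpha> k) * indicator (cball 0 (R k)) z)"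
      by (rule single_le_suminf_ennreal)
    finally show ?thesis by (simp add: \<alpha>_def b_def R_def)
  qed auto
qed

lemma nn_integral_norm_powr_far:
  assumes a: "a > 0"
  shows "(\<integral>\<^sup>+z. indicator (- cball 0 1) z * ennreal (norm (z::'a::euclidean_space) powr (- real DIM('a) - a)) \<partial>lborel) < top"
proof (rule nn_integral_finite_by_balls)
  show "\<And>k. 0 \<le> 2 powr (- real k * (real DIM('a) + a))" "\<And>k. 0 \<le> 2 powr (real k + 1)" by simp_all
  show "0 \<le> 2 powr (-a)" "2 powr (-a) < 1" using a by (auto simp: powr_less_one)
  fix k
  have "(2 powr (real k + 1)) ^ DIM('a) = 2 powr ((real k + 1) * real DIM('a))"
    by (simp add: powr_powr flip: powr_realpow)
  then have "2 powr (- real k * (real DIM('a) + a)) * (2 powr (real k + 1)) ^ DIM('a)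
      = 2 powr (- real k * (real DIM('a) + a) + (real k + 1) * real DIM('a))"
    by (simp only: powr_add)
  also have "- real k * (real DIM('a) + a) + (real k + 1) * real DIM('a) = real DIM('a) + (-a) * real k"
    by (simp add: algebra_simps)
  also have "2 powr (real DIM('a) + (-a) * real k) = 2 powr real DIM('a) * (2 powr (-a)) ^ k"
    unfolding powr_add by (simp add: powr_powr flip: powr_realpow)
  finally show "2 powr (- real k * (real DIM('a) + a)) * (2 powr (real k + 1)) ^ DIM('a)
      \<le> 2 powr real DIM('a) * (2 powr (-a)) ^ k" by simp
next
  fix z :: 'a
  show "indicator (- cball 0 1) z * ennreal (norm z powr (- real DIM('a) - a))
    \<le> (\<Sum>k. ennreal (2 powr (- real k * (real DIM('a) + a))) * indicator (cball 0 (2 powr (real k + 1))) z)"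
  proof (cases "z \<in> - cball 0 1")
    case True
    define t where "t = log 2 (norm z)"
    define k where "k = nat \<lfloor>t\<rfloor>"
    have nz1: "norm z > 1" using True by auto
    then have nz0: "norm z > 0" by linarith
    then have nz: "norm z = 2 powr t" unfolding t_def by (subst powr_log_cancel) simp_all
    have t0: "t \<ge> 0" using nz1 nz0 unfolding t_def by (subst zero_le_log_cancel_iff) simp_all
    then have "real k = of_int \<lfloor>t\<rfloor>" by (simp add: k_def)
    then have k: "real k \<le> t" "t \<le> real k + 1" by linarith+
    have "norm z powr (- real DIM('a) - a) = 2 powr (- t * (real DIM('a) + a))"
      unfolding nz powr_powr by (rule arg_cong[where f = "\<lambda>x. 2 powr x"]) (simp add: algebra_simps)
    also have "\<dots> \<le> 2 powr (- real k * (real DIM('a) + a))"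
      using k a by (intro powr_mono) (auto intro: mult_right_mono)
    finally have 1: "norm z powr (- real DIM('a) - a) \<le> 2 powr (- real k * (real DIM('a) + a))" .
    have 2: "z \<in> cball 0 (2 powr (real k + 1))" using k by (simp add: nz)
    have "indicator (- cball 0 1) z * ennreal (norm z powr (- real DIM('a) - a))
      \<le> ennreal (2 powr (- real k * (real DIM('a) + a))) * indicator (cball 0 (2 powr (real k + 1))) z"
      using True ennreal_leI[OF 1] 2 by simp
    also have "\<dots> \<le> (\<Sum>k. ennreal (2 powr (- real k * (real DIM('a) + a))) * indicator (cball 0 (2 powr (real k + 1))) z)"
      by (rule single_le_suminf_ennreal)
    finally show ?thesis .
  qed auto
qed

lemma nn_integral_norm_powr_truncated:
  fixes a b :: real
  assumes "a > 0" "b > 0"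
  shows "(\<integral>\<^sup>+z. ennreal (if norm (z::'a::euclidean_space) \<le> 1 then norm z powr (a - real DIM('a))
      else norm z powr (- real DIM('a) - b)) \<partial>lborel) < top"
proof -
  have "(\<integral>\<^sup>+z. ennreal (if norm (z::'a) \<le> 1 then norm z powr (a - real DIM('a))
      else norm z powr (- real DIM('a) - b)) \<partial>lborel)
    = (\<integral>\<^sup>+z. indicator (cball 0 1) z * ennreal (norm (z::'a) powr (a - real DIM('a)))
       + indicator (- cball 0 1) z * ennreal (norm (z::'a) powr (- real DIM('a) - b)) \<partial>lborel)"
    by (intro nn_integral_cong) (auto simp: indicator_def)
  also have "\<dots> = (\<integral>\<^sup>+z. indicator (cball 0 1) z * ennreal (norm (z::'a) powr (a - real DIM('a))) \<partial>lborel)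
       + (\<integral>\<^sup>+z. indicator (- cball 0 1) z * ennreal (norm (z::'a) powr (- real DIM('a) - b)) \<partial>lborel)"
    by (rule nn_integral_add) measurable
  finally show ?thesis
    using nn_integral_norm_powr_near[OF assms(1)] nn_integral_norm_powr_far[OF assms(2)]
    by (simp add: less_top)
qed

section \<open>The nonlocal energy\<close>

lemma nn_integral_lborel_pair:
  fixes F :: "'a::euclidean_space \<times> 'a \<Rightarrow> ennreal"
  assumes "F \<in> borel_measurable borel"
  shows "(\<integral>\<^sup>+z. F z \<partial>lborel) = (\<integral>\<^sup>+x. \<integral>\<^sup>+y. F (x, y) \<partial>lborel \<partial>lborel)"
    and "(\<lambda>x. \<integral>\<^sup>+y. F (x, y) \<partial>lborel) \<in> borel_measurable borel"
    and "(\<integral>\<^sup>+z. F z \<partial>lborel) = (\<integral>\<^sup>+y. \<integral>\<^sup>+x. F (x, y) \<partial>lborel \<partial>lborel)"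
proof -
  have F: "F \<in> borel_measurable ((lborel :: 'a measure) \<Otimes>\<^sub>M (lborel :: 'a measure))"
    unfolding lborel_prod using assms by simp
  show "(\<integral>\<^sup>+z. F z \<partial>lborel) = (\<integral>\<^sup>+x. \<integral>\<^sup>+y. F (x, y) \<partial>lborel \<partial>lborel)"
    using lborel.nn_integral_fst[OF F] by (simp add: lborel_prod)
  show "(\<lambda>x. \<integral>\<^sup>+y. F (x, y) \<partial>lborel) \<in> borel_measurable borel"
    using lborel.borel_measurable_nn_integral_fst[OF F] by simp
  show "(\<integral>\<^sup>+z. F z \<partial>lborel) = (\<integral>\<^sup>+y. \<integral>\<^sup>+x. F (x, y) \<partial>lborel \<partial>lborel)"
    using lborel_pair.nn_integral_snd[OF F] by (simp add: lborel_prod)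
qed

definition dif :: "('a \<Rightarrow> real) \<Rightarrow> 'a \<times> 'a \<Rightarrow> real" where
  "dif u z = u (fst z) - u (snd z)"

lemma measurable_fst_borel [measurable]: "fst \<in> borel_measurable (borel :: ('a::euclidean_space \<times> 'a) measure)"
  and measurable_snd_borel [measurable]: "snd \<in> borel_measurable (borel :: ('a::euclidean_space \<times> 'a) measure)"
  by (intro borel_measurable_continuous_onI continuous_intros)+

lemma dif_measurable [measurable]:
  "u \<in> borel_measurable borel \<Longrightarrow> dif u \<in> borel_measurable (borel :: ('a::euclidean_space \<times> 'a) measure)"
  unfolding dif_def[abs_def]
  by (intro borel_measurable_diff measurable_compose[OF measurable_fst_borel] measurable_compose[OF measurable_snd_borel])

lemma dif_const [simp]: "dif (\<lambda>x. c) = (\<lambda>z. 0)"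
  by (auto simp: dif_def)

lemma dif_linear: "dif (\<lambda>x. u x + t * v x) = (\<lambda>z. dif u z + t * dif v z)"
  and dif_cmult: "dif (\<lambda>x. t * v x) = (\<lambda>z. t * dif v z)"
  and dif_diff_const: "dif (\<lambda>x. u x - c) = dif u"
  and dif_midpoint: "dif (\<lambda>x. (u x + v x) / 2) = (\<lambda>z. (dif u z + dif v z) / 2)"
  by (auto simp: dif_def algebra_simps diff_divide_distrib add_divide_distrib)

text \<open>The common ground of the eigenvalue problem and the limit problem. The regularity of the
  boundary enters through the volume bound that \<open>dense_setting\<close> adds.\<close>

locale nonlocal_setting =
  fixes U :: "'a::euclidean_space set" and d :: "'a \<Rightarrow> 'a \<Rightarrow> real" and s C :: real
  assumes U_open: "open U" and U_bounded: "bounded U" and U_ne: "U \<noteq> {}"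
    and s0: "0 < s" and s1: "s < 1"
    and d_metric: "Metric_space UNIV d" and C1: "1 \<le> C"
    and d_lower: "\<And>x y. norm (x - y) / C \<le> d x y"
    and d_upper: "\<And>x y. d x y \<le> C * norm (x - y)"
begin

lemma d_nonneg [simp]: "0 \<le> d x y"
  and d_commute: "d x y = d y x"
  and d_triangle: "d x z \<le> d x y + d y z"
  and d_zero_iff: "d x y = 0 \<longleftrightarrow> x = y"
  using Metric_space.nonneg[OF d_metric] Metric_space.commute[OF d_metric]
    Metric_space.triangle[OF d_metric] Metric_space.zero[OF d_metric] by auto

lemma d_pos: "x \<noteq> y \<Longrightarrow> 0 < d x y"
  using d_nonneg[of x y] d_zero_iff[of x y] by linarith

lemma continuous_d: "continuous_on UNIV (\<lambda>z. d (fst z) (snd z))"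
proof -
  have bd: "\<bar>d x y - d x' y'\<bar> \<le> C * norm (x - x') + C * norm (y - y')" for x y x' y'
  proof -
    have "d x y \<le> d x x' + d x' y" "d x' y \<le> d x' y' + d y' y"
      "d x' y' \<le> d x' x + d x y'" "d x y' \<le> d x y + d y y'"
      by (rule d_triangle)+
    moreover have "d x x' \<le> C * norm (x - x')" "d y y' \<le> C * norm (y - y')" by (rule d_upper)+
    ultimately show ?thesis using d_commute[of x x'] d_commute[of y y'] by linarith
  qed
  have "(2 * C)-lipschitz_on UNIV (\<lambda>z. d (fst z) (snd z))"
  proof (rule lipschitz_onI)
    fix z w :: "'a \<times> 'a"
    have "C * norm (fst z - fst w) \<le> C * dist z w" "C * norm (snd z - snd w) \<le> C * dist z w"
      using C1 dist_fst_le[of z w] dist_snd_le[of z w] by (auto simp: dist_norm)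
    then show "dist (d (fst z) (snd z)) (d (fst w) (snd w)) \<le> 2 * C * dist z w"
      using bd[of "fst z" "snd z" "fst w" "snd w"] by (simp add: dist_real_def)
  qed (use C1 in simp)
  then show ?thesis by (rule lipschitz_on_continuous_on)
qed

lemma d_measurable [measurable]:
  "(\<lambda>z. d (fst z) (snd z)) \<in> borel_measurable borel"
  by (intro borel_measurable_continuous_onI continuous_d)

lemma continuous_d_left: "continuous_on UNIV (\<lambda>x. d x y)"
proof -
  have "continuous_on UNIV (\<lambda>x. (x, y))" by (intro continuous_intros)
  from continuous_on_compose2[OF continuous_d this] show ?thesis by simp
qed

lemma U_sets [measurable]: "U \<in> sets borel"
  using U_open by simp

lemma emeasure_U: "emeasure lborel U < top"
  using emeasure_bounded_finite[OF U_bounded] by simp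

definition volU :: real where "volU = measure lborel U"

lemma volU_pos: "volU > 0"
proof -
  have "emeasure lborel U \<noteq> 0"
    using open_not_negligible[OF U_open U_ne] U_sets
    by (auto simp: negligible_iff_null_sets null_sets_completion_iff null_sets_def)
  then show ?thesis
    using emeasure_U unfolding volU_def measure_def by (simp add: enn2real_positive_iff zero_less_iff_neq_zero)
qed

lemma emeasure_U_eq: "emeasure lborel U = ennreal volU"
  using emeasure_U unfolding volU_def by (simp add: emeasure_eq_ennreal_measure top.not_eq_extremum)

section \<open>The energy kernel and the two reference measures\<close>

lemma cross_dom_sets [measurable]: "cross_dom U \<in> sets (borel :: ('a \<times> 'a) measure)"
proof -
  have "cross_dom U = fst -` U \<union> snd -` U" by (auto simp: cross_dom_def)
  moreover have "open (fst -` U \<union> snd -` U :: ('a \<times> 'a) set)"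
    using U_open by (intro open_Un open_vimage continuous_intros)
  ultimately show ?thesis by simp
qed

text \<open>The domain of integration is built in as an indicator, so the energy is an integral over
  the whole product. On the diagonal division by 0 gives 0, which is why \<open>kern_pos\<close>
  asks for distinct points.\<close>

definition kern :: "real \<Rightarrow> 'a \<times> 'a \<Rightarrow> real" where
  "kern p z = indicator (cross_dom U) z / d (fst z) (snd z) powr (real DIM('a) + p * s)"

lemma kern_measurable [measurable]: "kern p \<in> borel_measurable borel"
  unfolding kern_def[abs_def] by measurable

lemma kern_nonneg [simp]: "0 \<le> kern p z"
  by (simp add: kern_def)

lemma kern_pos: "z \<in> cross_dom U \<Longrightarrow> fst z \<noteq> snd z \<Longrightarrow> 0 < kern p z"
  using d_pos[of "fst z" "snd z"] by (simp add: kern_def)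

definition muU :: "'a measure" where "muU = density lborel (indicator U)"
definition muH :: "real \<Rightarrow> ('a \<times> 'a) measure" where "muH p = density lborel (\<lambda>z. ennreal (kern p z))"

lemma sets_muU [simp, measurable_cong]: "sets muU = sets borel"
  and space_muU [simp]: "space muU = UNIV"
  and sets_muH [simp, measurable_cong]: "sets (muH p) = sets borel"
  and space_muH [simp]: "space (muH p) = UNIV"
  by (auto simp: muU_def muH_def)

lemma nn_integral_muU: "f \<in> borel_measurable borel \<Longrightarrow> (\<integral>\<^sup>+x. f x \<partial>muU) = (\<integral>\<^sup>+x. indicator U x * f x \<partial>lborel)"
  unfolding muU_def by (subst nn_integral_density) auto

lemma integral_muU:
  fixes f :: "'a \<Rightarrow> real"
  assumes "f \<in> borel_measurable borel"
  shows "(LINT x|muU. f x) = (LINT x|lborel. indicator U x * f x)"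
proof -
  have "muU = density lborel (\<lambda>x. ennreal (indicator U x))"
    unfolding muU_def by (simp add: ennreal_indicator)
  then show ?thesis using assms by (simp add: integral_density)
qed

lemma AE_muU: "(AE x in muU. P x) \<longleftrightarrow> (AE x in lborel. x \<in> U \<longrightarrow> P x)"
  unfolding muU_def by (subst AE_density) (auto simp: indicator_def)

lemma emeasure_muU: "emeasure muU UNIV = ennreal volU"
  unfolding muU_def by (subst emeasure_density) (auto simp: emeasure_U_eq)

lemma finite_measure_muU: "finite_measure muU"
  by (rule finite_measureI) (simp add: emeasure_muU)

lemma measure_muU: "measure muU UNIV = volU"
  using volU_pos by (simp add: measure_def emeasure_muU)

lemma nn_integral_muH:
  "f \<in> borel_measurable borel \<Longrightarrow> (\<integral>\<^sup>+z. f z \<partial>muH p) = (\<integral>\<^sup>+z. ennreal (kern p z) * f z \<partial>lborel)"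
  unfolding muH_def by (subst nn_integral_density) auto

lemma integral_muH:
  fixes f :: "'a \<times> 'a \<Rightarrow> real"
  assumes "f \<in> borel_measurable borel"
  shows "(LINT z|muH p. f z) = (LINT z|lborel. kern p z * f z)"
  using assms unfolding muH_def by (simp add: integral_density)

lemma AE_muH: "(AE z in muH p. P z) \<longleftrightarrow> (AE z in lborel. 0 < kern p z \<longrightarrow> P z)"
  unfolding muH_def by (subst AE_density) auto

definition W :: "real \<Rightarrow> ('a \<Rightarrow> real) set" where
  "W p = {u \<in> borel_measurable borel. u \<in> Lp p muU \<and> dif u \<in> Lp p (muH p)}"

abbreviation energy :: "real \<Rightarrow> ('a \<Rightarrow> real) \<Rightarrow> real" where
  "energy p u \<equiv> pint p (muH p) (dif u)"

abbreviation norm_pow :: "real \<Rightarrow> ('a \<Rightarrow> real) \<Rightarrow> real" where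
  "norm_pow p u \<equiv> pint p muU u"

lemma W_D:
  assumes "u \<in> W p"
  shows "u \<in> borel_measurable borel" "u \<in> Lp p muU" "dif u \<in> Lp p (muH p)"
  using assms by (auto simp: W_def)

lemma W_linear: "u \<in> W p \<Longrightarrow> v \<in> W p \<Longrightarrow> 1 < p \<Longrightarrow> (\<lambda>x. u x + t * v x) \<in> W p"
  unfolding W_def by (auto simp: dif_linear intro!: Lp_add Lp_cmult)

lemma W_cmult: "u \<in> W p \<Longrightarrow> (\<lambda>x. t * u x) \<in> W p"
  unfolding W_def by (auto simp: dif_cmult intro!: Lp_cmult)

lemma W_diff: "u \<in> W p \<Longrightarrow> v \<in> W p \<Longrightarrow> 1 < p \<Longrightarrow> (\<lambda>x. u x - v x) \<in> W p"
  using W_linear[of u p v "-1"] by simp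

lemma W_const: "(\<lambda>x. c) \<in> W p"
  unfolding W_def using Lp_const[OF finite_measure_muU] by (auto simp: Lp_def)

lemma W_midpoint: "u \<in> W p \<Longrightarrow> v \<in> W p \<Longrightarrow> 1 < p \<Longrightarrow> (\<lambda>x. (u x + v x) / 2) \<in> W p"
  using W_cmult[OF W_linear[of u p v 1], of "1/2"] by simp

subsection \<open>Borel representatives of members of the spaces\<close>

lemma Lp_norm_pow_representative:
  assumes "u' \<in> borel_measurable borel" "AE x in lborel. u x = u' x"
  shows "Lp_norm_pow U p u = (\<integral>\<^sup>+x. ennreal (\<bar>u' x\<bar> powr p) \<partial>muU)"
proof -
  have [measurable]: "u' \<in> borel_measurable borel" by fact
  have "Lp_norm_pow U p u = (\<integral>\<^sup>+x. indicator U x * ennreal (\<bar>u' x\<bar> powr p) \<partial>lborel)"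
    unfolding Lp_norm_pow_def
    by (rule nn_integral_lebesgue_cong_AE) (use assms(2) in \<open>eventually_elim, simp add: mult.commute\<close>)
  then show ?thesis by (simp add: nn_integral_muU)
qed

lemma kern_H_integrand:
  "indicator (cross_dom U) z * H_integrand d s p u v z = kern p z * (sgn_pow p (dif u z) * dif v z)"
  by (cases z) (simp add: H_integrand_def kern_def dif_def)

lemma H_energy_representative:
  assumes "u' \<in> borel_measurable borel" "AE x in lborel. u x = u' x"
  shows "H_energy U d s p u = (\<integral>\<^sup>+z. ennreal (\<bar>dif u' z\<bar> powr p) \<partial>muH p)"
proof -
  have [measurable]: "u' \<in> borel_measurable borel" by fact
  have "H_energy U d s p u = (\<integral>\<^sup>+z. ennreal (kern p z) * ennreal (\<bar>dif u' z\<bar> powr p) \<partial>lborel)"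
    unfolding H_energy_def
  proof (rule nn_integral_lebesgue_cong_AE)
    show "AE z in lborel. ennreal (H_integrand d s p u u z) * indicator (cross_dom U) z
        = ennreal (kern p z) * ennreal (\<bar>dif u' z\<bar> powr p)"
      using AE_lborel_fst_snd[OF assms(2)]
    proof eventually_elim
      case (elim z)
      have "ennreal (H_integrand d s p u u z) * indicator (cross_dom U) z
          = ennreal (indicator (cross_dom U) z * H_integrand d s p u u z)"
        by (simp add: indicator_def)
      also have "\<dots> = ennreal (kern p z * (sgn_pow p (dif u z) * dif u z))"
        by (simp only: kern_H_integrand)
      also have "dif u z = dif u' z" using elim by (simp add: dif_def)
      finally show ?case by (simp add: sgn_pow_mult_self ennreal_mult)
    qed
  qed
  also have "\<dots> = (\<integral>\<^sup>+z. ennreal (\<bar>dif u' z\<bar> powr p) \<partial>muH p)"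
    by (rule nn_integral_muH[symmetric]) measurable
  finally show ?thesis .
qed

lemma H_form_representative:
  assumes u: "u' \<in> borel_measurable borel" "AE x in lborel. u x = u' x"
    and v: "v' \<in> borel_measurable borel" "AE x in lborel. v x = v' x"
  shows "H_form U d s p u v = (LINT z|muH p. sgn_pow p (dif u' z) * dif v' z)"
proof -
  have [measurable]: "u' \<in> borel_measurable borel" "v' \<in> borel_measurable borel" by fact+
  have "H_form U d s p u v = (LINT z|lborel. kern p z * (sgn_pow p (dif u' z) * dif v' z))"
    unfolding H_form_def set_lebesgue_integral_def
  proof (rule integral_lebesgue_cong_AE)
    show "AE z in lborel. indicator (cross_dom U) z *\<^sub>R H_integrand d s p u v z
        = kern p z * (sgn_pow p (dif u' z) * dif v' z)"
      using AE_lborel_fst_snd[OF u(2)] AE_lborel_fst_snd[OF v(2)]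
    proof eventually_elim
      case (elim z)
      then have "dif u z = dif u' z" "dif v z = dif v' z" by (simp_all add: dif_def)
      then show ?case using kern_H_integrand[of z p u v] by simp
    qed
  qed measurable
  then show ?thesis by (simp add: integral_muH)
qed

lemma sgn_pow_integral_representative:
  assumes u: "u' \<in> borel_measurable borel" "AE x in lborel. u x = u' x"
    and v: "v' \<in> borel_measurable borel" "AE x in lborel. v x = v' x"
  shows "(LINT x:U|lebesgue. sgn_pow p (u x) * v x) = (LINT x|muU. sgn_pow p (u' x) * v' x)"
proof -
  have [measurable]: "u' \<in> borel_measurable borel" "v' \<in> borel_measurable borel" by fact+
  have "(LINT x:U|lebesgue. sgn_pow p (u x) * v x) = (LINT x|lborel. indicator U x * (sgn_pow p (u' x) * v' x))"
    unfolding set_lebesgue_integral_def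
    by (rule integral_lebesgue_cong_AE) (measurable, use u(2) v(2) in \<open>eventually_elim, simp\<close>)
  then show ?thesis by (simp add: integral_muU)
qed

lemma W_sp_representative:
  assumes u: "u' \<in> borel_measurable borel" "AE x in lborel. u x = u' x"
    and m: "u \<in> borel_measurable lebesgue"
  shows "u \<in> W_sp U d s p \<longleftrightarrow> u' \<in> W p"
proof -
  have [measurable]: "u' \<in> borel_measurable borel" by fact
  show ?thesis
    using m u unfolding W_sp_def W_def
    by (simp add: Lp_norm_pow_representative[OF u] H_energy_representative[OF u] Lp_iff_nn_integral)
qed

lemma W_sp_obtain:
  assumes "u \<in> W_sp U d s p"
  obtains u' where "u' \<in> W p" "AE x in lborel. u x = u' x"
proof -
  have "u \<in> borel_measurable lebesgue" using assms by (simp add: W_sp_def)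
  then obtain u' where "u' \<in> borel_measurable borel" "AE x in lborel. u x = u' x"
    using lebesgue_borel_representative by blast
  with W_sp_representative[OF this \<open>u \<in> borel_measurable lebesgue\<close>] assms that show ?thesis by blast
qed

lemma W_subset_W_sp: "u \<in> W p \<Longrightarrow> u \<in> W_sp U d s p"
  using W_sp_representative[of u u p] W_D(1)[of u p] by (auto simp: measurable_completion)

lemma Lp_norm_pow_W:
  assumes "u' \<in> W p" "AE x in lborel. u x = u' x"
  shows "Lp_norm_pow U p u = ennreal (norm_pow p u')"
  using Lp_norm_pow_representative[OF W_D(1)[OF assms(1)] assms(2)] nn_integral_eq_pint[OF W_D(2)[OF assms(1)]] by simp

lemma H_energy_W:
  assumes "u' \<in> W p" "AE x in lborel. u x = u' x"
  shows "H_energy U d s p u = ennreal (energy p u')"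
  using H_energy_representative[OF W_D(1)[OF assms(1)] assms(2)] nn_integral_eq_pint[OF W_D(3)[OF assms(1)]] by simp

lemma nonzero_ae_cong:
  assumes "AE x in lborel. u x = u' x"
  shows "nonzero_ae u \<longleftrightarrow> \<not> (AE x in lborel. u' x = 0)"
proof -
  have "(AE x in lborel. u x = 0) \<longleftrightarrow> (AE x in lborel. u' x = 0)"
  proof
    assume "AE x in lborel. u x = 0"
    with assms show "AE x in lborel. u' x = 0" by eventually_elim simp
  next
    assume "AE x in lborel. u' x = 0"
    with assms show "AE x in lborel. u x = 0" by eventually_elim simp
  qed
  then show ?thesis by (simp add: nonzero_ae_def AE_completion_iff)
qed

text \<open>All jumps across \<open>U\<close> are charged, so vanishing energy forces a function to be constant on the
  whole space, even when \<open>U\<close> is not connected.\<close>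
lemma energy_zero_imp_const:
  assumes u: "u \<in> W p" and zero: "energy p u = 0"
  obtains c where "AE x in lborel. u x = c"
proof -
  have [measurable]: "u \<in> borel_measurable borel" by (rule W_D(1)[OF u])
  have "AE z in muH p. \<bar>dif u z\<bar> powr p = 0"
    using zero W_D(3)[OF u] unfolding pint_def
    by (subst (asm) integral_nonneg_eq_0_iff_AE) (auto intro: Lp_integrable)
  then have "AE z in lborel. z \<in> cross_dom U \<longrightarrow> u (fst z) = u (snd z)"
    unfolding AE_muH
  proof eventually_elim
    case (elim z)
    then show ?case using kern_pos[of z p] by (cases "fst z = snd z") (auto simp: dif_def)
  qed
  then have "AE z in (lborel :: 'a measure) \<Otimes>\<^sub>M lborel. z \<in> cross_dom U \<longrightarrow> u (fst z) = u (snd z)"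
    by (subst lborel_prod)
  then have "AE x in lborel. AE y in lborel. (x, y) \<in> cross_dom U \<longrightarrow> u (fst (x, y)) = u (snd (x, y))"
    by (rule lborel_pair.AE_pair)
  then have ae: "AE x in lborel. x \<in> U \<longrightarrow> (AE y in lborel. u y = u x)"
  proof eventually_elim
    case (elim x)
    show ?case
    proof
      assume "x \<in> U"
      then show "AE y in lborel. u y = u x" using elim by (auto simp: cross_dom_def elim!: eventually_mono)
    qed
  qed
  have "\<exists>x\<in>U. AE y in lborel. u y = u x"
  proof (rule ccontr)
    assume "\<not> ?thesis"
    then have "AE x in lborel. x \<notin> U" using ae by (auto elim!: eventually_mono)
    then have "U \<in> null_sets lborel" by (simp add: AE_iff_null_sets)
    then show False using volU_pos by (simp add: volU_def measure_def null_sets_def)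
  qed
  then show ?thesis using that by blast
qed

subsection \<open>Finiteness of the energy of truncated distances\<close>

text \<open>Near the diagonal the integrand is of order \<open>d powr (a - n)\<close> with
  \<open>a = p * (1 - s) > 0\<close>; far from it the truncation leaves
  \<open>d powr (- n - b)\<close> with \<open>b = p * s > 0\<close>. Both are integrable in the
  difference variable, and one of the two points stays in \<open>U\<close>, of finite
  volume.\<close>

lemma truncated_kernel_finite:
  assumes p: "1 < p" and D: "0 < D"
  shows "(\<integral>\<^sup>+z. ennreal (kern p z * min (d (fst z) (snd z)) D powr p) \<partial>lborel) < top"
proof -
  define a b where "a = p * (1 - s)" and "b = p * s"
  have ab: "a > 0" "b > 0" using p s0 s1 by (auto simp: a_def b_def)
  define n where "n = real DIM('a)"
  define \<phi> where "\<phi> h = (if norm (h::'a) \<le> 1 then norm h powr (a - n) else norm h powr (- n - b))" for h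
  \<comment> \<open>The first summand serves the near part, where the sign of \<open>a - n\<close>
    decides whether the upper or the lower bound for \<open>d\<close> is used; the second serves the
    far part.\<close>
  define K where "K = C powr \<bar>a - n\<bar> + D powr p * C powr (n + b)"
  have K: "K \<ge> 0" by (simp add: K_def)
  have [measurable]: "\<phi> \<in> borel_measurable borel" unfolding \<phi>_def[abs_def] by measurable
  have \<phi>0: "\<phi> h \<ge> 0" for h by (simp add: \<phi>_def)
  have bound: "min (d x y) D powr p / d x y powr (n + p * s) \<le> K * \<phi> (y - x)" for x y
  proof (cases "x = y")
    case True
    then show ?thesis using K \<phi>0[of 0] d_zero_iff[of y y] by simp
  next
    case False
    then have h: "norm (y - x) > 0" by simp
    have dp: "d x y > 0" using d_pos[OF False] .
    have dl: "norm (y - x) / C \<le> d x y" and du: "d x y \<le> C * norm (y - x)"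
      using d_lower[of x y] d_upper[of x y] by (simp_all add: norm_minus_commute)
    show ?thesis
    proof (cases "norm (y - x) \<le> 1")
      case True
      have "min (d x y) D powr p / d x y powr (n + p * s) \<le> d x y powr p / d x y powr (n + p * s)"
        using p D dp by (intro divide_right_mono powr_mono2) auto
      also have "\<dots> = d x y powr (a - n)"
        unfolding powr_diff[symmetric] by (simp add: a_def algebra_simps)
      also have "\<dots> \<le> C powr \<bar>a - n\<bar> * norm (y - x) powr (a - n)"
      proof (cases "a - n \<ge> 0")
        case True
        have "d x y powr (a - n) \<le> (C * norm (y - x)) powr (a - n)"
          using True du dp by (intro powr_mono2) auto
        then show ?thesis using True C1 by (simp add: powr_mult)
      next
        case F: False
        have "d x y powr (a - n) \<le> (norm (y - x) / C) powr (a - n)"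
          using F dl h C1 by (intro powr_mono2') auto
        also have "\<dots> = norm (y - x) powr (a - n) / C powr (a - n)" using C1 by (simp add: powr_divide)
        also have "\<dots> = C powr (- (a - n)) * norm (y - x) powr (a - n)" by (simp only: powr_minus_divide) simp
        finally show ?thesis using F by simp
      qed
      also have "\<dots> \<le> K * norm (y - x) powr (a - n)"
        by (intro mult_right_mono) (auto simp: K_def)
      finally show ?thesis using True by (simp add: \<phi>_def)
    next
      case F: False
      have "min (d x y) D powr p / d x y powr (n + p * s) \<le> D powr p / d x y powr (n + p * s)"
        using p D dp by (intro divide_right_mono powr_mono2) auto
      also have "\<dots> = D powr p * d x y powr (- (n + b))"
        by (simp only: powr_minus_divide b_def) simp
      also have "\<dots> \<le> D powr p * (norm (y - x) / C) powr (- (n + b))"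
        using dl h C1 ab by (intro mult_left_mono powr_mono2') (auto simp: n_def)
      also have "(norm (y - x) / C) powr (- (n + b)) = C powr (n + b) * norm (y - x) powr (- n - b)"
        using C1 by (simp add: powr_divide powr_minus_divide powr_diff powr_add)
      finally have "min (d x y) D powr p / d x y powr (n + p * s) \<le> D powr p * C powr (n + b) * norm (y - x) powr (- n - b)"
        by (simp add: mult.assoc)
      also have "\<dots> \<le> K * norm (y - x) powr (- n - b)"
        by (intro mult_right_mono) (auto simp: K_def)
      finally show ?thesis using F by (simp add: \<phi>_def)
    qed
  qed
  define I where "I = (\<integral>\<^sup>+h. ennreal (\<phi> h) \<partial>lborel)"
  have I: "I < top" unfolding I_def \<phi>_def n_def by (rule nn_integral_norm_powr_truncated[OF ab])
  have shift: "(\<integral>\<^sup>+y. ennreal (\<phi> (y - x)) \<partial>lborel) = I" for x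
  proof -
    have "I = (\<integral>\<^sup>+h. ennreal (\<phi> h) \<partial>distr lborel borel ((+) (- x)))"
      unfolding I_def by (simp add: lborel_distr_plus)
    also have "\<dots> = (\<integral>\<^sup>+y. ennreal (\<phi> (y - x)) \<partial>lborel)"
      by (subst nn_integral_distr) auto
    finally show ?thesis by simp
  qed
  have sym: "\<phi> (x - y) = \<phi> (y - x)" for x y by (simp add: \<phi>_def norm_minus_commute)
  have "(\<integral>\<^sup>+z. ennreal (kern p z * min (d (fst z) (snd z)) D powr p) \<partial>lborel)
    \<le> (\<integral>\<^sup>+z. indicator U (fst z) * ennreal (K * \<phi> (snd z - fst z))
          + indicator U (snd z) * ennreal (K * \<phi> (fst z - snd z)) \<partial>lborel)"
  proof (rule nn_integral_mono)
    fix z :: "'a \<times> 'a"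
    have "kern p z * min (d (fst z) (snd z)) D powr p
        = indicator (cross_dom U) z * (min (d (fst z) (snd z)) D powr p / d (fst z) (snd z) powr (n + p * s))"
      by (simp add: kern_def n_def)
    also have "\<dots> \<le> indicator (cross_dom U) z * (K * \<phi> (snd z - fst z))"
      by (intro mult_left_mono bound) auto
    finally have le: "ennreal (kern p z * min (d (fst z) (snd z)) D powr p)
        \<le> ennreal (indicator (cross_dom U) z * (K * \<phi> (snd z - fst z)))" by (rule ennreal_leI)
    show "ennreal (kern p z * min (d (fst z) (snd z)) D powr p)
        \<le> indicator U (fst z) * ennreal (K * \<phi> (snd z - fst z))
          + indicator U (snd z) * ennreal (K * \<phi> (fst z - snd z))"
      using le by (cases z) (auto simp: cross_dom_def indicator_def sym split: if_splits intro: add_increasing)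
  qed
  also have "\<dots> = (\<integral>\<^sup>+z. indicator U (fst z) * ennreal (K * \<phi> (snd z - fst z)) \<partial>lborel)
          + (\<integral>\<^sup>+z. indicator U (snd z) * ennreal (K * \<phi> (fst z - snd z)) \<partial>lborel)"
    by (rule nn_integral_add) measurable
  also have "(\<integral>\<^sup>+z. indicator U (fst z) * ennreal (K * \<phi> (snd z - fst z)) \<partial>lborel) = ennreal K * I * ennreal volU"
  proof -
    have "(\<integral>\<^sup>+z. indicator U (fst z) * ennreal (K * \<phi> (snd z - fst z)) \<partial>lborel)
        = (\<integral>\<^sup>+x. \<integral>\<^sup>+y. indicator U x * ennreal (K * \<phi> (y - x)) \<partial>lborel \<partial>lborel)"
      by (subst nn_integral_lborel_pair(1)) simp_all
    also have "\<dots> = (\<integral>\<^sup>+x. (ennreal K * I) * indicator U x \<partial>lborel)"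
      using K \<phi>0 by (simp add: nn_integral_cmult ennreal_mult shift mult_ac)
    finally show ?thesis by (simp add: nn_integral_cmult_indicator emeasure_U_eq)
  qed
  also have "(\<integral>\<^sup>+z. indicator U (snd z) * ennreal (K * \<phi> (fst z - snd z)) \<partial>lborel) = ennreal K * I * ennreal volU"
  proof -
    have "(\<integral>\<^sup>+z. indicator U (snd z) * ennreal (K * \<phi> (fst z - snd z)) \<partial>lborel)
        = (\<integral>\<^sup>+y. \<integral>\<^sup>+x. indicator U y * ennreal (K * \<phi> (x - y)) \<partial>lborel \<partial>lborel)"
      by (subst nn_integral_lborel_pair(3)) simp_all
    also have "\<dots> = (\<integral>\<^sup>+x. (ennreal K * I) * indicator U x \<partial>lborel)"
      using K \<phi>0 by (simp add: nn_integral_cmult ennreal_mult shift mult_ac)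
    finally show ?thesis by (simp add: nn_integral_cmult_indicator emeasure_U_eq)
  qed
  also have "ennreal K * I * ennreal volU + ennreal K * I * ennreal volU < top"
    using I by (simp add: ennreal_mult_less_top)
  finally show ?thesis .
qed

section \<open>The truncated distance as a test function\<close>

text \<open>The distance to \<open>x0\<close> is 1-Lipschitz for \<open>d\<close>, but the energy
  also charges pairs with one point far from \<open>U\<close>; the cap \<open>D\<close> keeps those
  contributions finite.\<close>

definition truncd :: "'a \<Rightarrow> real \<Rightarrow> 'a \<Rightarrow> real" where
  "truncd x0 D x = min (d x x0) D"

lemma truncd_measurable [measurable]: "truncd x0 D \<in> borel_measurable borel"
  unfolding truncd_def[abs_def]
  by (intro borel_measurable_continuous_onI continuous_intros continuous_d_left)

lemma dif_truncd_le: "D > 0 \<Longrightarrow> \<bar>dif (truncd x0 D) z\<bar> \<le> min (d (fst z) (snd z)) D"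
  using d_triangle[of "fst z" x0 "snd z"] d_triangle[of "snd z" x0 "fst z"] d_commute[of "fst z" "snd z"]
    d_nonneg[of "fst z" x0] d_nonneg[of "snd z" x0]
  unfolding dif_def truncd_def by linarith

lemma truncd_W:
  assumes p: "1 < p" and D: "0 < D"
  shows "truncd x0 D \<in> W p"
    and "energy p (truncd x0 D) \<le> (LINT z|lborel. kern p z * min (d (fst z) (snd z)) D powr p)"
proof -
  have int: "integrable lborel (\<lambda>z. kern p z * min (d (fst z) (snd z)) D powr p)"
    using truncated_kernel_finite[OF assms] by (simp add: integrable_iff_bounded)
  have *: "truncd x0 D \<in> Lp p muU"
  proof (rule Lp_dominated)
    show "integrable muU (\<lambda>x. D powr p)" using finite_measure.integrable_const[OF finite_measure_muU] by auto
    show "\<bar>truncd x0 D x\<bar> powr p \<le> D powr p" for x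
      using p D by (intro powr_mono2) (auto simp: truncd_def abs_of_nonneg)
  qed measurable
  have le: "kern p z * \<bar>dif (truncd x0 D) z\<bar> powr p \<le> kern p z * min (d (fst z) (snd z)) D powr p" for z
    using p by (intro mult_left_mono powr_mono2 dif_truncd_le[OF D]) auto
  have int2: "integrable lborel (\<lambda>z. kern p z * \<bar>dif (truncd x0 D) z\<bar> powr p)"
    by (rule Bochner_Integration.integrable_bound[OF int]) (auto intro!: AE_I2 le)
  then have "integrable (muH p) (\<lambda>z. \<bar>dif (truncd x0 D) z\<bar> powr p)"
    unfolding muH_def by (subst integrable_density) auto
  then have **: "dif (truncd x0 D) \<in> Lp p (muH p)" by (simp add: Lp_def)
  with * show "truncd x0 D \<in> W p" by (simp add: W_def)
  show "energy p (truncd x0 D) \<le> (LINT z|lborel. kern p z * min (d (fst z) (snd z)) D powr p)"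
    unfolding pint_def by (subst integral_muH, measurable) (intro integral_mono int int2 le)
qed

text \<open>Interpolation: \<open>m = m powr s * m powr (1 - s)\<close> is at most
  \<open>t powr s * D powr (1 - s)\<close>. Raised to the power \<open>p - 2\<close>, the first
  factor cancels the growth of the kernel from exponent 2 to \<open>p\<close>; the second is the
  exact growth in \<open>p\<close>.\<close>

lemma truncated_kernel_mono:
  assumes p: "2 \<le> p" and D: "0 < D"
  shows "(LINT z|lborel. kern p z * min (d (fst z) (snd z)) D powr p)
    \<le> D powr ((1 - s) * (p - 2)) * (LINT z|lborel. kern 2 z * min (d (fst z) (snd z)) D powr 2)"
proof -
  have int: "integrable lborel (\<lambda>z. kern q z * min (d (fst z) (snd z)) D powr q)" if "1 < q" for q
    using truncated_kernel_finite[OF that D] by (simp add: integrable_iff_bounded)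
  have le: "kern p z * min (d (fst z) (snd z)) D powr p
    \<le> D powr ((1 - s) * (p - 2)) * (kern 2 z * min (d (fst z) (snd z)) D powr 2)" for z
  proof (cases "fst z = snd z")
    case True
    then show ?thesis using d_zero_iff[of "snd z" "snd z"] by (simp add: kern_def)
  next
    case False
    define t where "t = d (fst z) (snd z)"
    define m where "m = min t D"
    have t: "t > 0" using d_pos[OF False] by (simp add: t_def)
    have m: "m > 0" "m \<le> t" "m \<le> D" using t D by (auto simp: m_def)
    have "m = m powr s * m powr (1 - s)" using m by (simp flip: powr_add)
    also have "\<dots> \<le> t powr s * D powr (1 - s)"
      using m s0 s1 by (intro mult_mono powr_mono2) auto
    finally have "m powr (p - 2) \<le> (t powr s * D powr (1 - s)) powr (p - 2)"
      using m p by (intro powr_mono2) auto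
    also have "\<dots> = t powr (s * (p - 2)) * D powr ((1 - s) * (p - 2))"
      by (simp add: powr_mult powr_powr)
    finally have 1: "m powr (p - 2) \<le> t powr (s * (p - 2)) * D powr ((1 - s) * (p - 2))" .
    have "m powr p = m powr (p - 2) * m powr 2" by (simp only: powr_add [symmetric]) simp
    also have "\<dots> \<le> t powr (s * (p - 2)) * D powr ((1 - s) * (p - 2)) * m powr 2"
      by (intro mult_right_mono 1) simp
    finally have "m powr p / t powr (real DIM('a) + p * s)
        \<le> t powr (s * (p - 2)) * D powr ((1 - s) * (p - 2)) * m powr 2 / t powr (real DIM('a) + p * s)"
      by (intro divide_right_mono) simp_all
    also have "\<dots> = D powr ((1 - s) * (p - 2)) * (m powr 2 / t powr (real DIM('a) + 2 * s))"
    proof -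
      have "t powr (real DIM('a) + p * s) = t powr (real DIM('a) + 2 * s) * t powr (s * (p - 2))"
        by (simp only: powr_add [symmetric]) (simp add: algebra_simps)
      then show ?thesis using t by (simp only:) simp
    qed
    finally have "indicator (cross_dom U) z * (m powr p / t powr (real DIM('a) + p * s))
        \<le> indicator (cross_dom U) z * (D powr ((1 - s) * (p - 2)) * (m powr 2 / t powr (real DIM('a) + 2 * s)))"
      by (intro mult_left_mono) simp_all
    then show ?thesis by (simp add: kern_def m_def t_def mult_ac)
  qed
  have "(LINT z|lborel. kern p z * min (d (fst z) (snd z)) D powr p)
    \<le> (LINT z|lborel. D powr ((1 - s) * (p - 2)) * (kern 2 z * min (d (fst z) (snd z)) D powr 2))"
    using p by (intro integral_mono le int integrable_mult_right) auto
  then show ?thesis by simp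
qed

section \<open>The constraint and the variational eigenvalue\<close>

definition balanced :: "real \<Rightarrow> ('a \<Rightarrow> real) \<Rightarrow> bool" where
  "balanced p u \<longleftrightarrow> (LINT x|muU. sgn_pow p (u x)) = 0"

lemma Lp_const_muU: "(\<lambda>x. c) \<in> Lp p muU"
  by (rule Lp_const[OF finite_measure_muU])

lemma norm_pow_const: "norm_pow p (\<lambda>x. c) = \<bar>c\<bar> powr p * volU"
  by (simp add: pint_def measure_muU)

text \<open>Unlike the vanishing of the integral, minimality passes to limits in \<open>L\<^sup>p(U)\<close> at once.\<close>
lemma balanced_iff:
  assumes p: "1 < p" and u: "u \<in> Lp p muU"
  shows "balanced p u \<longleftrightarrow> (\<forall>c. norm_pow p u \<le> norm_pow p (\<lambda>x. u x - c))"
proof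
  assume b: "balanced p u"
  show "\<forall>c. norm_pow p u \<le> norm_pow p (\<lambda>x. u x - c)"
  proof
    fix c
    have "norm_pow p u + p * (LINT x|muU. sgn_pow p (u x) * (- c)) \<le> norm_pow p (\<lambda>x. u x + (- c))"
      by (rule pint_ge_tangent[OF p u Lp_const_muU])
    then show "norm_pow p u \<le> norm_pow p (\<lambda>x. u x - c)" using b by (simp add: balanced_def)
  qed
next
  assume m: "\<forall>c. norm_pow p u \<le> norm_pow p (\<lambda>x. u x - c)"
  have "p * (LINT x|muU. sgn_pow p (u x) * e) \<ge> 0" for e :: real
  proof (rule pint_derivative_ge[OF p u Lp_const_muU])
    fix t :: real
    show "norm_pow p u + t * 0 \<le> norm_pow p (\<lambda>x. u x + t * e)"
      using m[rule_format, of "- (t * e)"] by simp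
  qed
  from this[of 1] this[of "-1"] p show "balanced p u"
    by (simp add: balanced_def zero_le_mult_iff mult_le_0_iff)
qed

text \<open>The shift is a closest constant, found by minimizing a continuous coercive function of
  \<open>c\<close>.\<close>

lemma exists_balanced_shift:
  assumes p: "1 < p" and u: "u \<in> Lp p muU"
  obtains c where "balanced p (\<lambda>x. u x - c)"
proof -
  define F where "F c = norm_pow p (\<lambda>x. u x - c)" for c
  have L: "(\<lambda>x. u x - c) \<in> Lp p muU" for c
    using Lp_diff[OF u Lp_const_muU, of c] p by simp
  have cont: "continuous_on UNIV F"
  proof (rule continuous_on_sequentiallyI)
    fix ck :: "nat \<Rightarrow> real" and c assume lim: "ck \<longlonglongrightarrow> c"
    have "(\<lambda>k. \<bar>c - ck k\<bar> powr p * volU) \<longlonglongrightarrow> \<bar>c - c\<bar> powr p * volU"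
      using p by (intro tendsto_mult tendsto_powr' tendsto_rabs tendsto_diff lim tendsto_const) auto
    then have "(\<lambda>k. norm_pow p (\<lambda>x. c - ck k)) \<longlonglongrightarrow> 0"
      unfolding norm_pow_const using p by simp
    then have "(\<lambda>k. norm_pow p (\<lambda>x. (u x - ck k) - (u x - c))) \<longlonglongrightarrow> 0" by simp
    then show "(\<lambda>k. F (ck k)) \<longlonglongrightarrow> F c"
      unfolding F_def by (rule tendsto_pint[OF p L L])
  qed
  \<comment> \<open>Every \<open>c\<close> with \<open>F c \<le> F 0\<close> satisfies
    \<open>\<bar>c\<bar> \<le> R\<close>, so a minimum over the interval is global.\<close>
  define R where "R = (2 powr p * (2 * F 0) / volU) powr (1 / p)"
  have "\<exists>c0\<in>{-R..R}. \<forall>c\<in>{-R..R}. F c0 \<le> F c"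
    by (rule continuous_attains_inf) (auto intro: continuous_on_subset[OF cont] simp: R_def)
  then obtain c0 where c0: "c0 \<in> {-R..R}" "\<And>c. c \<in> {-R..R} \<Longrightarrow> F c0 \<le> F c" by blast
  have min: "F c0 \<le> F c" for c
  proof (cases "F c \<le> F 0")
    case True
    have "norm_pow p (\<lambda>x. u x - (u x - c)) \<le> 2 powr p * (norm_pow p u + norm_pow p (\<lambda>x. u x - c))"
      using p by (intro pint_diff_le u L) simp
    then have "\<bar>c\<bar> powr p * volU \<le> 2 powr p * (F 0 + F c)"
      by (simp add: norm_pow_const F_def)
    also have "\<dots> \<le> 2 powr p * (2 * F 0)" using True by (intro mult_left_mono) auto
    finally have "\<bar>c\<bar> powr p \<le> 2 powr p * (2 * F 0) / volU" using volU_pos by (simp add: pos_le_divide_eq)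
    then have "\<bar>c\<bar> \<le> R" unfolding R_def using p volU_pos
      by (intro le_powr_inverse) (auto simp: F_def pint_nonneg)
    then show ?thesis using c0(2)[of c] by (auto simp: abs_le_iff)
  next
    case False
    moreover have "F c0 \<le> F 0" using c0(2)[of 0] by (simp add: R_def)
    ultimately show ?thesis by linarith
  qed
  have "balanced p (\<lambda>x. u x - c0)"
    unfolding balanced_iff[OF p L] using min unfolding F_def by (simp add: diff_diff_eq)
  then show ?thesis using that by blast
qed

lemma balanced_scale: "t > 0 \<Longrightarrow> balanced p (\<lambda>x. t * u x) \<longleftrightarrow> balanced p u"
  by (simp add: balanced_def sgn_pow_scale)

lemma W_shift: "u \<in> W p \<Longrightarrow> 1 < p \<Longrightarrow> (\<lambda>x. u x - c) \<in> W p"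
  by (rule W_diff[OF _ W_const])

lemma sgn_pow_integral_balanced:
  assumes "u' \<in> borel_measurable borel" "AE x in lborel. u x = u' x"
  shows "(LINT x:U|lebesgue. sgn_pow p (u x)) = 0 \<longleftrightarrow> balanced p u'"
  using sgn_pow_integral_representative[OF assms, of "\<lambda>x. 1" "\<lambda>x. 1" p] by (simp add: balanced_def)

lemma quot_ennreal: "0 \<le> a \<Longrightarrow> 0 < b \<Longrightarrow> quot (ennreal a) (ennreal b) = ennreal (a / b)"
  by (simp add: quot_def divide_ennreal)

lemma two_ennreal_mult: "0 \<le> a \<Longrightarrow> 2 * ennreal a = ennreal (2 * a)"
  by (simp add: ennreal_mult)

lemma lambda_sp_le:
  assumes p: "1 < p" and u: "u \<in> W p" and b: "balanced p u" and pos: "norm_pow p u > 0"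
  shows "lambda_sp U d s p \<le> ennreal (energy p u / (2 * norm_pow p u))"
proof -
  have "\<not> (AE x in lborel. u x = 0)"
  proof
    assume "AE x in lborel. u x = 0"
    then have "AE x in muU. u x = 0" unfolding AE_muU by eventually_elim simp
    then have "norm_pow p u = 0" unfolding pint_def by (intro integral_eq_zero_AE) (auto elim!: eventually_mono)
    with pos show False by simp
  qed
  then have "u \<in> admissible_sp U d s p"
    using W_subset_W_sp[OF u] b sgn_pow_integral_balanced[OF W_D(1)[OF u], of u p] nonzero_ae_cong[of u u]
    by (simp add: admissible_sp_def)
  then have "lambda_sp U d s p \<le> quot (H_energy U d s p u) (2 * Lp_norm_pow U p u)"
    unfolding lambda_sp_def by (rule INF_lower)
  also have "\<dots> = ennreal (energy p u / (2 * norm_pow p u))"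
    using pos by (simp add: H_energy_W[OF u] Lp_norm_pow_W[OF u] two_ennreal_mult quot_ennreal pint_nonneg)
  finally show ?thesis .
qed

lemma measure_open_inter_pos:
  assumes "open V" "x \<in> closure U" "x \<in> V"
  shows "measure lborel (U \<inter> V) > 0"
proof -
  have "U \<inter> V \<noteq> {}" using assms open_Int_closure_eq_empty[of V U] by blast
  moreover have o: "open (U \<inter> V)" using assms U_open by blast
  ultimately have "emeasure lborel (U \<inter> V) \<noteq> 0"
    using open_not_negligible[OF o]
    by (auto simp: negligible_iff_null_sets null_sets_completion_iff null_sets_def)
  moreover have "emeasure lborel (U \<inter> V) < top"
    using emeasure_bounded_finite[of "U \<inter> V"] U_bounded by (simp add: bounded_Int)
  ultimately show ?thesis
    unfolding measure_def by (simp add: enn2real_positive_iff zero_less_iff_neq_zero)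
qed

text \<open>Chebyshev's inequality for a prescribed set.\<close>

lemma set_muU_lower:
  assumes f: "f \<in> Lp p muU" and A: "A \<in> sets borel" "A \<subseteq> U" and p: "0 < p"
    and h: "0 \<le> h" "\<And>x. x \<in> A \<Longrightarrow> h \<le> \<bar>f x\<bar>"
  shows "h powr p * measure lborel A \<le> norm_pow p f"
proof -
  have Afin: "emeasure lborel A < top"
    using emeasure_bounded_finite[OF bounded_subset[OF U_bounded A(2)]] by simp
  have "h powr p * measure lborel A = h powr p * measure muU A"
  proof -
    have "emeasure muU A = emeasure lborel A"
      unfolding muU_def using A by (subst emeasure_density) (auto simp: indicator_inter_arith[symmetric] Int_absorb1)
    then show ?thesis by (simp add: measure_def)
  qed
  also have "\<dots> = (LINT x|muU. h powr p * indicator A x)" using A by simp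
  also have "\<dots> \<le> norm_pow p f"
    unfolding pint_def
  proof (rule integral_mono)
    show "integrable muU (\<lambda>x. h powr p * indicator A x)"
      using A finite_measure.emeasure_finite[OF finite_measure_muU, of A]
      by (intro integrable_mult_right integrable_real_indicator) (auto simp: top.not_eq_extremum)
    show "integrable muU (\<lambda>x. \<bar>f x\<bar> powr p)" using f by (rule Lp_integrable)
    show "h powr p * indicator A x \<le> \<bar>f x\<bar> powr p" for x
      using h p by (auto simp: indicator_def intro!: powr_mono2)
  qed
  finally show ?thesis .
qed

text \<open>Near \<open>x0\<close> the function is close to 0 and near \<open>y0\<close> close to
  \<open>D\<close>, so \<open>c\<close> misses one of these values by \<open>D / 2 - e\<close>,
  depending on its side of \<open>D / 2\<close>. The measures of the two neighbourhoods depend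
  neither on \<open>p\<close> nor on \<open>c\<close>.\<close>

lemma truncd_shift_norm_lower:
  assumes xy: "x0 \<in> closure U" "y0 \<in> closure U" and D: "D = d x0 y0" "D > 0" and e: "0 < e" "e < D / 2"
  obtains \<mu> where "\<mu> > 0" "\<And>p c. 1 < p \<Longrightarrow> (D / 2 - e) powr p * \<mu> \<le> norm_pow p (\<lambda>x. truncd x0 D x - c)"
proof -
  define V where "V y = {x. d x y < e}" for y
  have V: "open (V y)" for y
    unfolding V_def using continuous_d_left by (intro open_Collect_less continuous_on_const)
  define \<mu> where "\<mu> = min (measure lborel (U \<inter> V x0)) (measure lborel (U \<inter> V y0))"
  have self: "x \<in> V x" for x using e d_zero_iff[of x x] by (simp add: V_def)
  have "\<mu> > 0" unfolding \<mu>_def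
    using measure_open_inter_pos[OF V xy(1) self] measure_open_inter_pos[OF V xy(2) self] by simp
  moreover have "(D / 2 - e) powr p * \<mu> \<le> norm_pow p (\<lambda>x. truncd x0 D x - c)" if p: "1 < p" for p c
  proof -
    have L: "(\<lambda>x. truncd x0 D x - c) \<in> Lp p muU"
      using W_D(2)[OF W_shift[OF truncd_W(1)[OF p D(2)] p]] .
    have sets: "U \<inter> V y \<in> sets borel" for y using V U_open by simp
    show ?thesis
    proof (cases "c \<ge> D / 2")
      case True
      have "(D / 2 - e) powr p * \<mu> \<le> (D / 2 - e) powr p * measure lborel (U \<inter> V x0)"
        by (intro mult_left_mono) (auto simp: \<mu>_def)
      also have "\<dots> \<le> norm_pow p (\<lambda>x. truncd x0 D x - c)"
      proof (rule set_muU_lower[OF L sets])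
        fix x assume "x \<in> U \<inter> V x0"
        then show "D / 2 - e \<le> \<bar>truncd x0 D x - c\<bar>" using True e by (auto simp: V_def truncd_def)
      qed (use p e in auto)
      finally show ?thesis .
    next
      case False
      have "(D / 2 - e) powr p * \<mu> \<le> (D / 2 - e) powr p * measure lborel (U \<inter> V y0)"
        by (intro mult_left_mono) (auto simp: \<mu>_def)
      also have "\<dots> \<le> norm_pow p (\<lambda>x. truncd x0 D x - c)"
      proof (rule set_muU_lower[OF L sets])
        fix x assume "x \<in> U \<inter> V y0"
        then have "d x y0 < e" by (simp add: V_def)
        moreover have "D \<le> d x0 x + d x y0" unfolding D(1) by (rule d_triangle)
        ultimately have "truncd x0 D x \<ge> D - e" using e d_commute[of x x0] by (simp add: truncd_def)
        then show "D / 2 - e \<le> \<bar>truncd x0 D x - c\<bar>" using False by linarith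
      qed (use p e in auto)
      finally show ?thesis .
    qed
  qed
  ultimately show ?thesis using that by blast
qed

text \<open>Any two points of \<open>U\<close> give a truncated distance which, shifted to be
  balanced, is admissible with positive norm.\<close>

lemma lambda_sp_finite:
  assumes p: "1 < p"
  shows "lambda_sp U d s p < top"
proof -
  obtain x0 where x0: "x0 \<in> U" using U_ne by blast
  have "U \<noteq> {x0}" using U_open not_open_singleton by blast
  then obtain y0 where y0: "y0 \<in> U" "y0 \<noteq> x0" using x0 by blast
  define D where "D = d x0 y0"
  have D: "D > 0" using d_pos[of x0 y0] y0 by (simp add: D_def)
  obtain c where b: "balanced p (\<lambda>x. truncd x0 D x - c)"
    using exists_balanced_shift[OF p W_D(2)[OF truncd_W(1)[OF p D]]] by blast
  have cl: "x0 \<in> closure U" "y0 \<in> closure U" using x0 y0 closure_subset by auto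
  obtain \<mu> where \<mu>: "\<mu> > 0" "\<And>p c. 1 < p \<Longrightarrow> (D / 2 - D / 4) powr p * \<mu> \<le> norm_pow p (\<lambda>x. truncd x0 D x - c)"
    by (rule truncd_shift_norm_lower[OF cl D_def D, of "D / 4"]) (use D in auto)
  have "0 < (D / 2 - D / 4) powr p * \<mu>" using D \<mu>(1) by simp
  also have "\<dots> \<le> norm_pow p (\<lambda>x. truncd x0 D x - c)" by (rule \<mu>(2)[OF p])
  finally have "lambda_sp U d s p \<le> ennreal (energy p (\<lambda>x. truncd x0 D x - c) / (2 * norm_pow p (\<lambda>x. truncd x0 D x - c)))"
    by (rule lambda_sp_le[OF p W_shift[OF truncd_W(1)[OF p D] p] b])
  then show ?thesis by (rule le_less_trans) simp
qed

definition lam :: "real \<Rightarrow> real" where "lam p = enn2real (lambda_sp U d s p)"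

lemma lam_nonneg [simp]: "0 \<le> lam p"
  by (simp add: lam_def)

lemma lambda_sp_eq: "1 < p \<Longrightarrow> lambda_sp U d s p = ennreal (lam p)"
  using lambda_sp_finite[of p] by (simp add: lam_def)

lemma lam_le:
  assumes p: "1 < p" and u: "u \<in> W p" and b: "balanced p u"
  shows "2 * lam p * norm_pow p u \<le> energy p u"
proof (cases "norm_pow p u = 0")
  case False
  then have pos: "norm_pow p u > 0" using pint_nonneg[of p muU u] by linarith
  have "ennreal (lam p) \<le> ennreal (energy p u / (2 * norm_pow p u))"
    using lambda_sp_le[OF p u b pos] by (simp add: lambda_sp_eq[OF p])
  then have "lam p \<le> energy p u / (2 * norm_pow p u)"
    using pos by (subst (asm) ennreal_le_iff) (auto simp: pint_nonneg)
  then show ?thesis using pos by (simp add: pos_le_divide_eq mult_ac)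
qed (simp add: pint_nonneg)

text \<open>The energy ignores constants, so the constraint is met by a shift: a Poincare inequality
  for the whole space.\<close>

lemma lam_le_shift:
  assumes p: "1 < p" and u: "u \<in> W p"
  obtains c where "balanced p (\<lambda>x. u x - c)" "2 * lam p * norm_pow p (\<lambda>x. u x - c) \<le> energy p u"
proof -
  obtain c where b: "balanced p (\<lambda>x. u x - c)" using exists_balanced_shift[OF p W_D(2)[OF u]] by blast
  from that[OF b] lam_le[OF p W_shift[OF u p] b] show ?thesis by (simp add: dif_diff_const)
qed

lemma normalize:
  assumes p: "1 < p" and u: "u \<in> W p" and b: "balanced p u" and pos: "norm_pow p u > 0"
  obtains v where "v \<in> W p" "balanced p v" "norm_pow p v = 1" "energy p v = energy p u / norm_pow p u"
proof -
  define t where "t = norm_pow p u powr (- 1 / p)"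
  have t: "t > 0" using pos by (simp add: t_def)
  have tp: "\<bar>t\<bar> powr p = 1 / norm_pow p u"
  proof -
    have "\<bar>t\<bar> powr p = norm_pow p u powr (- 1 / p * p)" using t by (simp only: t_def powr_powr abs_of_pos)
    also have "- 1 / p * p = - 1" using p by simp
    finally show ?thesis using pos by (simp only: powr_minus_divide) simp
  qed
  show ?thesis
  proof (rule that[of "\<lambda>x. t * u x"])
    show "(\<lambda>x. t * u x) \<in> W p" by (rule W_cmult[OF u])
    show "balanced p (\<lambda>x. t * u x)" using balanced_scale[OF t] b by simp
    show "norm_pow p (\<lambda>x. t * u x) = 1" unfolding pint_cmult tp using pos by simp
    show "energy p (\<lambda>x. t * u x) = energy p u / norm_pow p u" unfolding dif_cmult pint_cmult tp by simp
  qed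
qed

lemma minimizing_function:
  assumes p: "1 < p" and e: "e > 0"
  shows "\<exists>v. v \<in> W p \<and> balanced p v \<and> norm_pow p v = 1 \<and> energy p v \<le> 2 * lam p + e"
proof -
  have "lambda_sp U d s p < ennreal (lam p + e / 2)"
    using e lambda_sp_eq[OF p] by (simp add: ennreal_less_iff)
  then obtain u where u: "u \<in> admissible_sp U d s p"
    "quot (H_energy U d s p u) (2 * Lp_norm_pow U p u) < ennreal (lam p + e / 2)"
    unfolding lambda_sp_def INF_less_iff by blast
  have "u \<in> W_sp U d s p" using u(1) by (simp add: admissible_sp_def)
  then obtain u' where u': "u' \<in> W p" "AE x in lborel. u x = u' x" by (rule W_sp_obtain)
  have b: "balanced p u'"
    using u(1) sgn_pow_integral_balanced[OF W_D(1)[OF u'(1)] u'(2)] by (simp add: admissible_sp_def)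
  have q: "quot (ennreal (energy p u')) (ennreal (2 * norm_pow p u')) < ennreal (lam p + e / 2)"
    using u(2) by (simp add: H_energy_W[OF u'] Lp_norm_pow_W[OF u'] two_ennreal_mult pint_nonneg)
  \<comment> \<open>A vanishing denominator would make the quotient \<open>top\<close>.\<close>
  have "norm_pow p u' \<noteq> 0" using q by (auto simp: quot_def)
  then have pos: "norm_pow p u' > 0" using pint_nonneg[of p muU u'] by linarith
  have "energy p u' / (2 * norm_pow p u') < lam p + e / 2"
    using q pos e by (simp add: quot_ennreal pint_nonneg ennreal_less_iff del: ennreal_plus)
  then have le: "energy p u' / norm_pow p u' \<le> 2 * lam p + e"
    using pos by (simp add: field_simps)
  obtain v where "v \<in> W p" "balanced p v" "norm_pow p v = 1" "energy p v = energy p u' / norm_pow p u'"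
    using normalize[OF p u'(1) b pos] by blast
  with le show ?thesis by (intro exI[of _ v]) simp
qed

end

text \<open>Values all above the average would contradict strict monotonicity of the integral.
  \<open>f\<close> may be infinite; under the negated claim the integral is automatically finite.
  This selects the sample points of the step approximation.\<close>

lemma exists_point_below_average:
  fixes f :: "'b \<Rightarrow> ennreal"
  assumes f[measurable]: "f \<in> borel_measurable M" and A: "A \<in> sets M" "emeasure M A \<noteq> 0" "emeasure M A < top"
  shows "\<exists>y\<in>A. f y * emeasure M A \<le> (\<integral>\<^sup>+x. indicator A x * f x \<partial>M)"
proof (rule ccontr)
  assume neg: "\<not> ?thesis"
  define I where "I = (\<integral>\<^sup>+x. indicator A x * f x \<partial>M)"
  define c where "c = I / emeasure M A"
  have less: "I < f y * emeasure M A" if "y \<in> A" for y using neg that by (auto simp: I_def not_le)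
  have "A \<noteq> {}" using A(2) by auto
  then have "I < top" using less by (metis ex_in_conv less_top neq_top_trans order_less_imp_le top.not_eq_extremum top_greatest)
  have cA: "c * emeasure M A = I" unfolding c_def using A(2,3)
    by (simp add: ennreal_divide_times top.not_eq_extremum)
  have cf: "c < f y" if "y \<in> A" for y
  proof (rule ccontr)
    assume "\<not> c < f y"
    then have "f y * emeasure M A \<le> c * emeasure M A" by (intro mult_right_mono) auto
    then show False using less[OF that] by (simp add: cA)
  qed
  have "(\<integral>\<^sup>+x. c * indicator A x \<partial>M) < (\<integral>\<^sup>+x. indicator A x * f x \<partial>M)"
  proof (rule nn_integral_less)
    show "(\<integral>\<^sup>+x. c * indicator A x \<partial>M) \<noteq> \<infinity>"
      using A \<open>I < top\<close> by (simp add: nn_integral_cmult_indicator cA)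
    show "AE x in M. c * indicator A x \<le> indicator A x * f x"
      using cf by (intro AE_I2) (auto simp: indicator_def intro: less_imp_le)
    show "\<not> (AE x in M. indicator A x * f x \<le> c * indicator A x)"
    proof
      assume "AE x in M. indicator A x * f x \<le> c * indicator A x"
      then have "AE x in M. x \<notin> A"
      proof eventually_elim
        case (elim x)
        then show ?case using cf[of x] by (auto simp: indicator_def not_le)
      qed
      then have "A \<in> null_sets M" using A(1) by (simp add: AE_iff_null_sets)
      then show False using A(2) by auto
    qed
  qed (use A(1) in measurable)
  then show False using A by (simp add: nn_integral_cmult_indicator cA flip: I_def)
qed

context nonlocal_setting
begin

section \<open>Compactness in \<open>L\<^sup>p(U)\<close>\<close>

text \<open>For pairs at distance at most \<open>\<rho>\<close> the singular weight is removed at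
  the price of a power of \<open>\<rho>\<close>. Compactness and chaining both rest on this.\<close>

lemma dif_powr_le_kern:
  assumes "z \<in> cross_dom U" "d (fst z) (snd z) \<le> \<rho>" "1 < p"
  shows "\<bar>dif u z\<bar> powr p \<le> \<rho> powr (real DIM('a) + p * s) * (kern p z * \<bar>dif u z\<bar> powr p)"
proof (cases "fst z = snd z")
  case False
  define t where "t = d (fst z) (snd z)"
  have t: "0 < t" "t \<le> \<rho>" using d_pos[OF False] assms by (auto simp: t_def)
  have q: "0 \<le> real DIM('a) + p * s" using assms s0 by simp
  have "1 = t powr (real DIM('a) + p * s) * kern p z"
    using assms t by (simp add: kern_def t_def)
  also have "\<dots> \<le> \<rho> powr (real DIM('a) + p * s) * kern p z"
    using t q by (intro mult_right_mono powr_mono2) auto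
  finally have "1 * \<bar>dif u z\<bar> powr p \<le> (\<rho> powr (real DIM('a) + p * s) * kern p z) * \<bar>dif u z\<bar> powr p"
    by (rule mult_right_mono) simp
  then show ?thesis by (simp add: mult.assoc)
qed (simp add: dif_def)

lemma nn_integral_dif_kern:
  assumes u: "u \<in> W p"
  shows "(\<integral>\<^sup>+z. ennreal (kern p z * \<bar>dif u z\<bar> powr p) \<partial>lborel) = ennreal (energy p u)"
proof -
  have [measurable]: "u \<in> borel_measurable borel" by (rule W_D(1)[OF u])
  have "ennreal (energy p u) = (\<integral>\<^sup>+z. ennreal (kern p z) * ennreal (\<bar>dif u z\<bar> powr p) \<partial>lborel)"
    unfolding nn_integral_eq_pint[OF W_D(3)[OF u], symmetric] by (rule nn_integral_muH) measurable
  then show ?thesis by (simp add: ennreal_mult)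
qed

text \<open>On each cell \<open>u\<close> is replaced by its value at a well-chosen point of a ball around the cell; the
  ball may leave \<open>U\<close>, which is why no regularity of the boundary is needed here.\<close>
lemma step_approximation:
  assumes p: "1 < p" and B: "0 \<le> B" and \<eta>: "0 < \<eta>"
  shows "\<exists>(N::nat) (P :: nat \<Rightarrow> 'a set) M. 1 \<le> M \<and> (\<forall>i. P i \<in> sets borel) \<and>
    (\<forall>u\<in>W p. energy p u \<le> B \<longrightarrow> norm_pow p u \<le> 1 \<longrightarrow>
      (\<exists>c. (\<forall>i. \<bar>c i\<bar> \<le> M) \<and> (\<lambda>x. \<Sum>i<N. c i * indicator (P i) x) \<in> Lp p muU \<and>
        norm_pow p (\<lambda>x. u x - (\<Sum>i<N. c i * indicator (P i) x)) \<le> \<eta>))"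
proof -
  define n where "n = real DIM('a)"
  define q where "q = n + p * s"
  define \<omega> where "\<omega> = unit_ball_vol n"
  have \<omega>: "\<omega> > 0" by (simp add: \<omega>_def n_def)
  have ps: "p * s > 0" using p s0 by simp
  define K where "K = (2 * C) powr q"
  have K: "K > 0" using C1 by (simp add: K_def)
  \<comment> \<open>Solves \<open>\<rho> powr q * B \<le> \<eta> * \<beta>\<close>:
    \<open>\<rho>\<close> bounds \<open>d\<close> inside a ball of radius \<open>\<epsilon>\<close>,
    \<open>\<beta>\<close> is the volume of that ball, and their ratio
    \<open>\<rho> powr q / \<beta>\<close> is \<open>K * \<epsilon> powr (p * s) / \<omega>\<close>.
    The summand 1 admits \<open>B = 0\<close>.\<close>
  define \<theta> where "\<theta> = \<eta> * \<omega> / (K * (B + 1))"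
  have \<theta>: "\<theta> > 0" using \<eta> \<omega> K B by (simp add: \<theta>_def)
  define \<epsilon> where "\<epsilon> = \<theta> powr (1 / (p * s))"
  have \<epsilon>: "\<epsilon> > 0" using \<theta> by (simp add: \<epsilon>_def)
  define \<rho> where "\<rho> = 2 * C * \<epsilon>"
  have \<rho>: "\<rho> > 0" using C1 \<epsilon> by (simp add: \<rho>_def)
  define \<beta> where "\<beta> = \<omega> * \<epsilon> ^ DIM('a)"
  have \<beta>: "\<beta> > 0" using \<omega> \<epsilon> by (simp add: \<beta>_def)
  have \<rho>\<beta>: "\<rho> powr q * B \<le> \<eta> * \<beta>"
  proof -
    have "\<rho> powr q = K * \<epsilon> powr (n + p * s)" using C1 \<epsilon> by (simp add: \<rho>_def K_def powr_mult q_def)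
    also have "\<epsilon> powr (n + p * s) = \<epsilon> powr n * \<epsilon> powr (p * s)" by (rule powr_add)
    also have "\<epsilon> powr n = \<epsilon> ^ DIM('a)" using \<epsilon> by (simp add: n_def powr_realpow)
    also have "\<epsilon> powr (p * s) = \<theta>"
    proof -
      have "(\<theta> powr (1 / a)) powr a = \<theta>" if "a > 0" for a using that \<theta> by (simp add: powr_powr)
      then show ?thesis using ps by (simp only: \<epsilon>_def)
    qed
    finally have "\<rho> powr q * B = \<epsilon> ^ DIM('a) * (\<theta> * K * B)" by simp
    also have "\<dots> \<le> \<epsilon> ^ DIM('a) * (\<eta> * \<omega>)"
    proof (rule mult_left_mono)
      have "\<theta> * K * B \<le> \<theta> * K * (B + 1)" using \<theta> K by simp
      also have "\<dots> = \<eta> * \<omega>" using K B by (simp add: \<theta>_def)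
      finally show "\<theta> * K * B \<le> \<eta> * \<omega>" .
    qed (use \<epsilon> in simp)
    finally show ?thesis by (simp add: \<beta>_def mult_ac)
  qed
  have cpt: "compact (closure U)" using U_bounded by (simp add: compact_closure)
  have cover: "closure U \<subseteq> (\<Union>x\<in>closure U. ball x \<epsilon>)" using \<epsilon> by auto
  obtain T where T: "T \<subseteq> closure U" "finite T" "closure U \<subseteq> (\<Union>x\<in>T. ball x \<epsilon>)"
    by (rule compactE_image[OF cpt open_ball cover])
  obtain N and t :: "nat \<Rightarrow> 'a" where Tt: "T = t ` {i. i < N}"
    using T(2) unfolding finite_conv_nat_seg_image by blast
  define Bs where "Bs i = ball (t i) \<epsilon>" for i
  define P where "P = disjointed (\<lambda>i. U \<inter> Bs i)"
  have Bs_sets [measurable]: "Bs i \<in> sets borel" for i by (simp add: Bs_def)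
  have P_sets [measurable]: "P i \<in> sets borel" for i
  proof -
    have "range (\<lambda>i. U \<inter> Bs i) \<subseteq> sets borel" using U_open by (auto simp: Bs_def)
    then show ?thesis unfolding P_def using sets.range_disjointed_sets[of "\<lambda>i. U \<inter> Bs i" borel] by blast
  qed
  have P_sub: "P i \<subseteq> U" "P i \<subseteq> Bs i" for i
    unfolding P_def using disjointed_subset[of "\<lambda>i. U \<inter> Bs i" i] by auto
  have P_disj: "x \<in> P i \<Longrightarrow> x \<in> P j \<Longrightarrow> i = j" for x i j
    using disjoint_family_disjointed[of "\<lambda>i. U \<inter> Bs i"] unfolding P_def disjoint_family_on_def by blast
  have P_cover: "\<exists>i<N. x \<in> P i" if "x \<in> U" for x
  proof -
    have "x \<in> closure U" using that closure_subset by blast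
    then obtain i where "i < N" "x \<in> ball (t i) \<epsilon>" using T(3) unfolding Tt by blast
    then have "x \<in> (\<Union>i\<in>{0..<N}. U \<inter> Bs i)" using that unfolding Bs_def by auto
    also have "\<dots> = (\<Union>i\<in>{0..<N}. P i)" unfolding P_def by (rule finite_UN_disjointed_eq[symmetric])
    finally show ?thesis by auto
  qed
  have Bs_measure: "emeasure lborel (Bs i) = ennreal \<beta>" for i
    using \<epsilon> by (simp add: Bs_def emeasure_ball \<beta>_def \<omega>_def n_def)
  \<comment> \<open>A bound for the coefficients independent of \<open>u\<close>: the step function
    has norm power at most \<open>2 powr p * (1 + \<eta>)\<close>, and Chebyshev on the cell
    \<open>P i\<close> bounds its value there.\<close>
  define M where "M = 1 + (\<Sum>i<N. (2 powr p * (1 + \<eta>) / measure lborel (P i)) powr (1 / p))"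
  have M1: "1 \<le> M" by (simp add: M_def sum_nonneg)
  have main: "\<exists>c. (\<forall>i. \<bar>c i\<bar> \<le> M) \<and> (\<lambda>x. \<Sum>i<N. c i * indicator (P i) x) \<in> Lp p muU \<and>
      norm_pow p (\<lambda>x. u x - (\<Sum>i<N. c i * indicator (P i) x)) \<le> \<eta>"
    if u: "u \<in> W p" and uB: "energy p u \<le> B" and u1: "norm_pow p u \<le> 1" for u
  proof -
    have [measurable]: "u \<in> borel_measurable borel" by (rule W_D(1)[OF u])
    define G where "G i z = indicator (P i) (fst z) * ennreal (\<bar>dif u z\<bar> powr p)" for i and z :: "'a \<times> 'a"
    have G_meas [measurable]: "G i \<in> borel_measurable borel" for i
      unfolding G_def[abs_def] by measurable
    define F where "F i y = (\<integral>\<^sup>+x. G i (x, y) \<partial>lborel)" for i y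
    have F_meas [measurable]: "F i \<in> borel_measurable borel" for i
    proof -
      have "(\<lambda>z. G i (snd z, fst z)) \<in> borel_measurable borel"
        by (rule measurable_compose[OF _ G_meas]) (intro borel_measurable_continuous_onI continuous_intros)
      from nn_integral_lborel_pair(2)[OF this] show ?thesis unfolding F_def[abs_def] by simp
    qed
    have "\<exists>y\<in>Bs i. F i y * emeasure lborel (Bs i) \<le> (\<integral>\<^sup>+y. indicator (Bs i) y * F i y \<partial>lborel)" for i
      by (rule exists_point_below_average) (use \<beta> in \<open>auto simp: Bs_measure\<close>)
    then have "\<forall>i. \<exists>y. F i y * ennreal \<beta> \<le> (\<integral>\<^sup>+y. indicator (Bs i) y * F i y \<partial>lborel)"
      unfolding Bs_measure by blast
    from choice[OF this] obtain y
      where y: "\<And>i. F i (y i) * ennreal \<beta> \<le> (\<integral>\<^sup>+y. indicator (Bs i) y * F i y \<partial>lborel)" by blast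
    \<comment> \<open>Null cells get the value 0, because the sampled value has no bound by
      \<open>M\<close> there; almost every point avoids them.\<close>
    define c where "c i = (if i < N \<and> measure lborel (P i) \<noteq> 0 then u (y i) else 0)" for i
    define g where "g x = (\<Sum>i<N. c i * indicator (P i) x)" for x
    have g_meas [measurable]: "g \<in> borel_measurable borel" unfolding g_def[abs_def] by measurable
    have gval: "g x = c i" if "x \<in> P i" "i < N" for x i
    proof -
      have "x \<notin> P j" if "j \<noteq> i" for j using P_disj[of x i j] \<open>x \<in> P i\<close> that by blast
      then have "g x = (\<Sum>j<N. if j = i then c i else 0)"
        unfolding g_def using \<open>x \<in> P i\<close> by (intro sum.cong) (simp_all add: indicator_def)
      then show ?thesis using that by simp
    qed
    have ae: "AE x in lborel. \<forall>i\<in>{..<N}. measure lborel (P i) = 0 \<longrightarrow> x \<notin> P i"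
    proof (rule AE_finite_allI)
      fix i
      show "AE x in lborel. measure lborel (P i) = 0 \<longrightarrow> x \<notin> P i"
      proof (cases "measure lborel (P i) = 0")
        case True
        have "emeasure lborel (P i) < top"
          using emeasure_bounded_finite[OF bounded_subset[OF U_bounded P_sub(1)]] by simp
        then have "P i \<in> null_sets lborel" using True
          by (auto simp: null_sets_def measure_def enn2real_eq_0_iff)
        then show ?thesis by (auto dest: AE_not_in)
      qed simp
    qed simp
    have "ennreal \<beta> * (\<integral>\<^sup>+x. ennreal (\<bar>u x - g x\<bar> powr p) \<partial>muU) \<le> ennreal \<beta> * (\<Sum>i<N. F i (y i))"
    proof (rule mult_left_mono)
      have "(\<integral>\<^sup>+x. ennreal (\<bar>u x - g x\<bar> powr p) \<partial>muU) = (\<integral>\<^sup>+x. indicator U x * ennreal (\<bar>u x - g x\<bar> powr p) \<partial>lborel)"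
        by (rule nn_integral_muU) measurable
      also have "\<dots> \<le> (\<integral>\<^sup>+x. (\<Sum>i<N. G i (x, y i)) \<partial>lborel)"
      proof (rule nn_integral_mono_AE)
        show "AE x in lborel. indicator U x * ennreal (\<bar>u x - g x\<bar> powr p) \<le> (\<Sum>i<N. G i (x, y i))"
          using ae
        proof eventually_elim
          case (elim x)
          show ?case
          proof (cases "x \<in> U")
            case True
            then obtain i where i: "i < N" "x \<in> P i" using P_cover by blast
            then have "measure lborel (P i) \<noteq> 0" using elim by auto
            then have "g x = u (y i)" using gval[OF i(2,1)] i(1) by (simp add: c_def)
            then have "indicator U x * ennreal (\<bar>u x - g x\<bar> powr p) = G i (x, y i)"
              using True i by (simp add: G_def dif_def)
            also have "\<dots> \<le> (\<Sum>i<N. G i (x, y i))" using i by (intro member_le_sum) auto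
            finally show ?thesis .
          qed simp
        qed
      qed
      also have "\<dots> = (\<Sum>i<N. F i (y i))"
        unfolding F_def
      proof (rule nn_integral_sum)
        fix i
        show "(\<lambda>x. G i (x, y i)) \<in> borel_measurable lborel"
          by (simp add: G_def dif_def) measurable
      qed
      finally show "(\<integral>\<^sup>+x. ennreal (\<bar>u x - g x\<bar> powr p) \<partial>muU) \<le> (\<Sum>i<N. F i (y i))" .
    qed simp
    also have "\<dots> = (\<Sum>i<N. F i (y i) * ennreal \<beta>)" by (simp add: sum_distrib_left mult.commute)
    also have "\<dots> \<le> (\<Sum>i<N. \<integral>\<^sup>+y. indicator (Bs i) y * F i y \<partial>lborel)" by (intro sum_mono y)
    also have "\<dots> = (\<Sum>i<N. \<integral>\<^sup>+z. indicator (Bs i) (snd z) * G i z \<partial>lborel)"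
    proof (rule sum.cong[OF refl])
      fix i
      have "(\<integral>\<^sup>+z. indicator (Bs i) (snd z) * G i z \<partial>lborel)
          = (\<integral>\<^sup>+y. \<integral>\<^sup>+x. indicator (Bs i) y * G i (x, y) \<partial>lborel \<partial>lborel)"
        by (subst nn_integral_lborel_pair(3)) simp_all
      also have "\<dots> = (\<integral>\<^sup>+y. indicator (Bs i) y * F i y \<partial>lborel)"
        unfolding F_def
      proof (intro nn_integral_cong nn_integral_cmult)
        fix y
        show "(\<lambda>x. G i (x, y)) \<in> borel_measurable lborel"
          by (simp add: G_def dif_def) measurable
      qed
      finally show "(\<integral>\<^sup>+y. indicator (Bs i) y * F i y \<partial>lborel) = (\<integral>\<^sup>+z. indicator (Bs i) (snd z) * G i z \<partial>lborel)" by simp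
    qed
    also have "\<dots> = (\<integral>\<^sup>+z. (\<Sum>i<N. indicator (Bs i) (snd z) * G i z) \<partial>lborel)"
      by (rule nn_integral_sum[symmetric]) measurable
    \<comment> \<open>The cells are disjoint, so at most one summand survives, and then both points
      lie in one ball of radius \<open>\<epsilon>\<close>, at \<open>d\<close>-distance at most
      \<open>\<rho>\<close>.\<close>
    also have "\<dots> \<le> (\<integral>\<^sup>+z. ennreal (\<rho> powr q) * ennreal (kern p z * \<bar>dif u z\<bar> powr p) \<partial>lborel)"
    proof (rule nn_integral_mono)
      fix z :: "'a \<times> 'a"
      show "(\<Sum>i<N. indicator (Bs i) (snd z) * G i z) \<le> ennreal (\<rho> powr q) * ennreal (kern p z * \<bar>dif u z\<bar> powr p)"
      proof (cases "\<exists>i<N. fst z \<in> P i \<and> snd z \<in> Bs i")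
        case True
        then obtain i where i: "i < N" "fst z \<in> P i" "snd z \<in> Bs i" by blast
        have "fst z \<notin> P j" if "j \<noteq> i" for j using P_disj[of "fst z" i j] i(2) that by blast
        then have "(\<Sum>j<N. indicator (Bs j) (snd z) * G j z) = (\<Sum>j<N. if j = i then G i z else 0)"
          using i by (intro sum.cong) (simp_all add: indicator_def G_def)
        also have "\<dots> = ennreal (\<bar>dif u z\<bar> powr p)" using i by (simp add: G_def)
        also have "\<dots> \<le> ennreal (\<rho> powr q * (kern p z * \<bar>dif u z\<bar> powr p))"
          unfolding q_def n_def
        proof (intro ennreal_leI dif_powr_le_kern[OF _ _ p])
          show "z \<in> cross_dom U" using i(2) P_sub(1)[of i] by (cases z) (auto simp: cross_dom_def)
          have "norm (fst z - snd z) \<le> dist (fst z) (t i) + dist (t i) (snd z)"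
            unfolding dist_norm[symmetric] by (rule dist_triangle)
          also have "\<dots> \<le> 2 * \<epsilon>" using i P_sub(2)[of i] by (auto simp: Bs_def dist_commute)
          finally have "C * norm (fst z - snd z) \<le> C * (2 * \<epsilon>)" using C1 by (intro mult_left_mono) auto
          then show "d (fst z) (snd z) \<le> \<rho>" using d_upper[of "fst z" "snd z"] by (simp add: \<rho>_def)
        qed
        finally show ?thesis by (simp add: ennreal_mult)
      next
        case False
        then have "(\<Sum>i<N. indicator (Bs i) (snd z) * G i z) = 0"
          by (intro sum.neutral) (auto simp: G_def indicator_def)
        then show ?thesis by simp
      qed
    qed
    also have "\<dots> = ennreal (\<rho> powr q) * ennreal (energy p u)"
      by (subst nn_integral_cmult) (measurable, simp add: nn_integral_dif_kern[OF u])
    also have "\<dots> = ennreal (\<rho> powr q * energy p u)" by (simp add: ennreal_mult pint_nonneg)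
    also have "\<dots> \<le> ennreal (\<beta> * \<eta>)"
    proof (rule ennreal_leI)
      have "\<rho> powr q * energy p u \<le> \<rho> powr q * B" using uB by (intro mult_left_mono) auto
      then show "\<rho> powr q * energy p u \<le> \<beta> * \<eta>" using \<rho>\<beta> by (simp add: mult.commute)
    qed
    also have "\<dots> = ennreal \<beta> * ennreal \<eta>" using \<beta> \<eta> by (simp add: ennreal_mult)
    finally have le: "(\<integral>\<^sup>+x. ennreal (\<bar>u x - g x\<bar> powr p) \<partial>muU) \<le> ennreal \<eta>"
      using \<beta> by (subst (asm) ennreal_mult_le_mult_iff) auto
    then have L: "(\<lambda>x. u x - g x) \<in> Lp p muU"
      unfolding Lp_iff_nn_integral by (auto intro: le_less_trans)
    then have np: "norm_pow p (\<lambda>x. u x - g x) \<le> \<eta>"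
      using le \<eta> unfolding nn_integral_eq_pint[OF L] by (simp add: ennreal_le_iff)
    have "(\<lambda>x. u x - (u x - g x)) \<in> Lp p muU"
      by (rule Lp_diff[OF W_D(2)[OF u] L]) (use p in simp)
    then have gL: "g \<in> Lp p muU" by simp
    have "norm_pow p (\<lambda>x. u x - (u x - g x)) \<le> 2 powr p * (norm_pow p u + norm_pow p (\<lambda>x. u x - g x))"
      by (rule pint_diff_le[OF W_D(2)[OF u] L]) (use p in simp)
    also have "\<dots> \<le> 2 powr p * (1 + \<eta>)" using u1 np by (intro mult_left_mono) auto
    finally have gle: "norm_pow p g \<le> 2 powr p * (1 + \<eta>)" by simp
    have "\<bar>c i\<bar> \<le> M" for i
    proof (cases "i < N \<and> measure lborel (P i) \<noteq> 0")
      case True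
      then have pos: "measure lborel (P i) > 0" using measure_nonneg[of lborel "P i"] by linarith
      have "\<bar>c i\<bar> powr p * measure lborel (P i) \<le> norm_pow p g"
      proof (rule set_muU_lower[OF gL P_sets P_sub(1)])
        fix x assume "x \<in> P i"
        then show "\<bar>c i\<bar> \<le> \<bar>g x\<bar>" using gval[of x i] True by simp
      qed (use p in simp_all)
      then have "\<bar>c i\<bar> powr p \<le> 2 powr p * (1 + \<eta>) / measure lborel (P i)"
        using gle pos by (simp add: pos_le_divide_eq)
      then have "\<bar>c i\<bar> \<le> (2 powr p * (1 + \<eta>) / measure lborel (P i)) powr (1 / p)"
        using p \<eta> by (intro le_powr_inverse) auto
      also have "\<dots> \<le> (\<Sum>i<N. (2 powr p * (1 + \<eta>) / measure lborel (P i)) powr (1 / p))"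
        using True by (intro member_le_sum) auto
      finally show ?thesis by (simp add: M_def)
    next
      case False
      then show ?thesis using M1 by (auto simp: c_def)
    qed
    with np gL show ?thesis unfolding g_def by blast
  qed
  show ?thesis
    by (rule exI[of _ N], rule exI[of _ P], rule exI[of _ M], rule conjI[OF M1],
        rule conjI[OF allI[OF P_sets]], intro ballI impI, rule main)
qed

text \<open>At each precision \<open>\<eta> m\<close> the functions are described by finitely many
  bounded coefficients. One diagonal subsequence makes all coefficients converge for all
  \<open>m\<close>, and the step functions then carry the Cauchy property over.\<close>

lemma Lp_compactness:
  fixes v :: "nat \<Rightarrow> 'a \<Rightarrow> real"
  assumes p: "1 < p" and v: "\<And>k. v k \<in> W p" and v1: "\<And>k. norm_pow p (v k) \<le> 1"
    and vB: "\<And>k. energy p (v k) \<le> B"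
  shows "\<exists>r::nat \<Rightarrow> nat. strict_mono r \<and>
    (\<forall>e>0. \<exists>N. \<forall>k\<ge>N. \<forall>l\<ge>N. norm_pow p (\<lambda>x. v (r k) x - v (r l) x) \<le> e)"
proof -
  have B: "0 \<le> B" using vB[of 0] pint_nonneg[of p "muH p" "dif (v 0)"] by linarith
  define \<eta> where "\<eta> m = 1 / real (Suc m)" for m
  have \<eta>: "\<eta> m > 0" for m by (simp add: \<eta>_def)
  define approx where "approx m u N P M c \<longleftrightarrow>
      (\<forall>i. \<bar>c i\<bar> \<le> M) \<and> (\<lambda>x. \<Sum>i<N. c i * indicator (P i) x) \<in> Lp p muU \<and>
        norm_pow p (\<lambda>x. u x - (\<Sum>i<N. c i * indicator (P i) x)) \<le> \<eta> m"
    for m u and N :: nat and P :: "nat \<Rightarrow> 'a set" and M and c :: "nat \<Rightarrow> real"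
  have "\<exists>N P M. 1 \<le> M \<and> (\<forall>k. \<exists>c. approx m (v k) N P M c)" for m
  proof -
    obtain N :: nat and P :: "nat \<Rightarrow> 'a set" and M where "1 \<le> M" and *: "\<forall>u\<in>W p. energy p u \<le> B \<longrightarrow> norm_pow p u \<le> 1 \<longrightarrow>
      (\<exists>c. (\<forall>i. \<bar>c i\<bar> \<le> M) \<and> (\<lambda>x. \<Sum>i<N. c i * indicator (P i) x) \<in> Lp p muU \<and>
        norm_pow p (\<lambda>x. u x - (\<Sum>i<N. c i * indicator (P i) x)) \<le> \<eta> m)"
      using step_approximation[OF p B \<eta>[of m]] by blast
    moreover have "\<exists>c. approx m (v k) N P M c" for k
      using *[rule_format, OF v vB v1, of k] unfolding approx_def by blast
    ultimately show ?thesis by blast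
  qed
  then obtain N P M where M1: "\<And>m. 1 \<le> M m" and "\<And>m k. \<exists>c. approx m (v k) (N m) (P m) (M m) c"
    by metis
  then obtain c where c: "\<And>m k. approx m (v k) (N m) (P m) (M m) (c m k)"
    by metis
  have c_le: "\<bar>c m k i\<bar> \<le> M m"
    and gL: "(\<lambda>x. \<Sum>i<N m. c m k i * indicator (P m i) x) \<in> Lp p muU"
    and app: "norm_pow p (\<lambda>x. v k x - (\<Sum>i<N m. c m k i * indicator (P m i) x)) \<le> \<eta> m" for m k i
    using c[of m k] unfolding approx_def by blast+
  \<comment> \<open>Scaled to the common bound 1, so that one extraction over the countable set of
    pairs (precision, cell) suffices.\<close>
  define f where "f k mi = c (fst mi) k (snd mi) / M (fst mi)" for k and mi :: "nat \<times> nat"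
  have fb: "norm (f k mi) \<le> 1" for k mi
    using c_le[of "fst mi" k "snd mi"] M1[of "fst mi"] by (simp add: f_def)
  obtain r :: "nat \<Rightarrow> nat" where r: "strict_mono r" "\<And>mi. \<exists>l. (\<lambda>k. f (r k) mi) \<longlonglongrightarrow> l"
    using function_convergent_subsequence[of "UNIV :: (nat \<times> nat) set" f 1] fb by auto
  have "\<exists>l. (\<lambda>k. c m (r k) i) \<longlonglongrightarrow> l" for m i
  proof -
    obtain l where "(\<lambda>k. f (r k) (m, i)) \<longlonglongrightarrow> l" using r(2) by blast
    then have "(\<lambda>k. M m * f (r k) (m, i)) \<longlonglongrightarrow> M m * l" by (intro tendsto_intros)
    moreover have "M m * f k (m, i) = c m k i" for k using M1[of m] by (simp add: f_def)
    ultimately show ?thesis by auto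
  qed
  then obtain L where L: "\<And>m i. (\<lambda>k. c m (r k) i) \<longlonglongrightarrow> L m i" by metis
  have "\<exists>N. \<forall>k\<ge>N. \<forall>l\<ge>N. norm_pow p (\<lambda>x. v (r k) x - v (r l) x) \<le> e" if e: "e > 0" for e
  proof -
    define K where "K = 2 powr p * (1 + 2 powr p * 2)"
    have K: "K > 0" by (simp add: K_def add_pos_pos)
    obtain m where m: "K * \<eta> m \<le> e"
    proof -
      obtain m where "K / e < real m" using reals_Archimedean2 by blast
      then have "K / e < real (Suc m)" by simp
      then have "K * \<eta> m \<le> e" using e by (simp add: \<eta>_def field_simps)
      then show ?thesis using that by blast
    qed
    define g where "g k x = (\<Sum>i<N m. c m k i * indicator (P m i) x)" for k x
    have gLm: "g k \<in> Lp p muU" for k unfolding g_def[abs_def] by (rule gL)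
    \<comment> \<open>The constant \<open>2 * \<delta>\<close> has norm power exactly
      \<open>\<eta> m\<close>.\<close>
    define \<delta> where "\<delta> = (\<eta> m / volU) powr (1 / p) / 2"
    have \<delta>: "\<delta> > 0" using \<eta>[of m] volU_pos by (simp add: \<delta>_def)
    have d2: "(2 * \<delta>) powr p * volU = \<eta> m" using \<eta>[of m] volU_pos p by (simp add: \<delta>_def powr_powr)
    have "(\<lambda>k. \<Sum>i<N m. \<bar>c m (r k) i - L m i\<bar>) \<longlonglongrightarrow> (\<Sum>i<N m. \<bar>L m i - L m i\<bar>)"
      by (intro tendsto_intros L)
    then have "eventually (\<lambda>k. (\<Sum>i<N m. \<bar>c m (r k) i - L m i\<bar>) < \<delta>) sequentially"
      using \<delta> by (intro order_tendstoD) auto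
    then obtain N0 where N0: "\<And>k. k \<ge> N0 \<Longrightarrow> (\<Sum>i<N m. \<bar>c m (r k) i - L m i\<bar>) < \<delta>"
      by (auto simp: eventually_sequentially)
    have "norm_pow p (\<lambda>x. v (r k) x - v (r l) x) \<le> e" if kl: "k \<ge> N0" "l \<ge> N0" for k l
    proof -
      have glip: "\<bar>g (r k) x - g (r l) x\<bar> \<le> 2 * \<delta>" for x
      proof -
        have "g (r k) x - g (r l) x = (\<Sum>i<N m. (c m (r k) i - c m (r l) i) * indicator (P m i) x)"
          by (simp add: g_def sum_subtractf algebra_simps)
        also have "\<bar>\<dots>\<bar> \<le> (\<Sum>i<N m. \<bar>c m (r k) i - L m i\<bar> + \<bar>c m (r l) i - L m i\<bar>)"
          by (rule order_trans[OF sum_abs], rule sum_mono) (auto simp: abs_mult indicator_def)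
        also have "\<dots> = (\<Sum>i<N m. \<bar>c m (r k) i - L m i\<bar>) + (\<Sum>i<N m. \<bar>c m (r l) i - L m i\<bar>)"
          by (rule sum.distrib)
        finally show ?thesis using N0[OF kl(1)] N0[OF kl(2)] by linarith
      qed
      have gg: "(\<lambda>x. g (r k) x - g (r l) x) \<in> Lp p muU"
        by (rule Lp_diff[OF gLm gLm]) (use p in simp)
      have "norm_pow p (\<lambda>x. g (r k) x - g (r l) x) \<le> norm_pow p (\<lambda>x. 2 * \<delta>)"
        unfolding pint_def
      proof (rule integral_mono)
        show "integrable muU (\<lambda>x. \<bar>g (r k) x - g (r l) x\<bar> powr p)" using gg by (rule Lp_integrable)
        show "integrable muU (\<lambda>x. \<bar>2 * \<delta>\<bar> powr p)" using Lp_const_muU by (rule Lp_integrable)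
        show "\<bar>g (r k) x - g (r l) x\<bar> powr p \<le> \<bar>2 * \<delta>\<bar> powr p" for x
          using glip[of x] \<delta> p by (intro powr_mono2) auto
      qed
      then have gm: "norm_pow p (\<lambda>x. g (r k) x - g (r l) x) \<le> \<eta> m"
        using \<delta> d2 by (simp add: norm_pow_const)
      have vg: "(\<lambda>x. v (r j) x - g (r j) x) \<in> Lp p muU" for j
        by (rule Lp_diff[OF W_D(2)[OF v] gLm]) (use p in simp)
      have vgm: "norm_pow p (\<lambda>x. v (r j) x - g (r j) x) \<le> \<eta> m" for j
        using app[of "r j" m] by (simp add: g_def)
      have gv: "(\<lambda>x. (g (r k) x - g (r l) x) - (v (r l) x - g (r l) x)) \<in> Lp p muU"
        by (rule Lp_diff[OF gg vg]) (use p in simp)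
      have "norm_pow p (\<lambda>x. (v (r k) x - g (r k) x) + ((g (r k) x - g (r l) x) - (v (r l) x - g (r l) x)))
          \<le> 2 powr p * (norm_pow p (\<lambda>x. v (r k) x - g (r k) x)
             + norm_pow p (\<lambda>x. (g (r k) x - g (r l) x) - (v (r l) x - g (r l) x)))"
        by (rule pint_add_le[OF vg gv]) (use p in simp)
      also have "\<dots> \<le> 2 powr p * (\<eta> m + 2 powr p * (\<eta> m + \<eta> m))"
      proof (intro mult_left_mono add_mono vgm)
        have "norm_pow p (\<lambda>x. (g (r k) x - g (r l) x) - (v (r l) x - g (r l) x))
          \<le> 2 powr p * (norm_pow p (\<lambda>x. g (r k) x - g (r l) x) + norm_pow p (\<lambda>x. v (r l) x - g (r l) x))"
          by (rule pint_diff_le[OF gg vg]) (use p in simp)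
        also have "\<dots> \<le> 2 powr p * (\<eta> m + \<eta> m)" by (intro mult_left_mono add_mono gm vgm) simp
        finally show "norm_pow p (\<lambda>x. (g (r k) x - g (r l) x) - (v (r l) x - g (r l) x)) \<le> 2 powr p * (\<eta> m + \<eta> m)" .
      qed simp
      also have "\<dots> = K * \<eta> m" by (simp add: K_def algebra_simps)
      also have "(\<lambda>x. (v (r k) x - g (r k) x) + ((g (r k) x - g (r l) x) - (v (r l) x - g (r l) x))) = (\<lambda>x. v (r k) x - v (r l) x)"
        by (rule ext) simp
      finally show ?thesis using m by linarith
    qed
    then show ?thesis by blast
  qed
  with r(1) show ?thesis by blast
qed

section \<open>Existence of minimizers\<close>

lemma norm_pow_cong_AE:
  assumes f: "f \<in> borel_measurable borel" "g \<in> borel_measurable borel" and ae: "AE x in muU. f x = g x"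
  shows "norm_pow p f = norm_pow p g" "f \<in> Lp p muU \<longleftrightarrow> g \<in> Lp p muU" "balanced p f \<longleftrightarrow> balanced p g"
proof -
  have [measurable]: "f \<in> borel_measurable borel" "g \<in> borel_measurable borel" by fact+
  have ae1: "AE x in muU. \<bar>f x\<bar> powr p = \<bar>g x\<bar> powr p" using ae by eventually_elim simp
  have ae2: "AE x in muU. sgn_pow p (f x) = sgn_pow p (g x)" using ae by eventually_elim simp
  show "norm_pow p f = norm_pow p g" unfolding pint_def using ae1 by (intro integral_cong_AE) auto
  show "f \<in> Lp p muU \<longleftrightarrow> g \<in> Lp p muU"
    unfolding Lp_def using integrable_cong_AE[OF _ _ ae1] by auto
  have "(LINT x|muU. sgn_pow p (f x)) = (LINT x|muU. sgn_pow p (g x))"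
    using ae2 by (intro integral_cong_AE) auto
  then show "balanced p f \<longleftrightarrow> balanced p g" by (simp add: balanced_def)
qed

lemma exists_in_muU:
  assumes "AE x in muU. P x"
  shows "\<exists>x\<in>U. P x"
proof (rule ccontr)
  assume "\<not> ?thesis"
  then have "AE x in muU. False" using assms unfolding AE_muU by (auto elim!: eventually_mono)
  then have "emeasure muU (space muU) = 0" using AE_iff_measurable[of UNIV muU "\<lambda>x. False"] by simp
  then show False using volU_pos emeasure_muU by simp
qed

text \<open>Off \<open>U\<close> only averaged information is available, so a limit
  on \<open>U\<close> is extended by almost minimizing the energy among functions close to it in \<open>L\<^sup>p(U)\<close>; by
  uniform convexity the jumps of the almost minimizers form a Cauchy sequence.\<close>
lemma energy_lower_semicontinuous:
  fixes v :: "nat \<Rightarrow> 'a \<Rightarrow> real"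
  assumes p: "1 < p" and v: "\<And>k. v k \<in> W p" and g: "g \<in> Lp p muU"
    and lim: "(\<lambda>k. norm_pow p (\<lambda>x. v k x - g x)) \<longlonglongrightarrow> 0"
    and E: "\<And>e. e > 0 \<Longrightarrow> \<forall>\<^sub>F k in sequentially. energy p (v k) \<le> E + e"
  obtains w where "w \<in> W p" "AE x in muU. w x = g x" "energy p w \<le> E"
proof -
  have p0: "0 \<le> p" using p by simp
  define S where "S \<epsilon> = {w \<in> W p. norm_pow p (\<lambda>x. w x - g x) \<le> \<epsilon>}" for \<epsilon>
  \<comment> \<open>Increases as \<open>\<epsilon>\<close> shrinks and stays below \<open>E\<close>,
    hence has a limit. This is what makes almost minimizers for different \<open>\<epsilon>\<close>
    comparable.\<close>
  define I where "I \<epsilon> = (INF w\<in>S \<epsilon>. energy p w)" for \<epsilon>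
  have bdd: "bdd_below ((\<lambda>w. energy p w) ` S \<epsilon>)" for \<epsilon>
    by (intro bdd_belowI[of _ 0]) (auto simp: pint_nonneg)
  have Sv: "\<forall>\<^sub>F k in sequentially. v k \<in> S \<epsilon>" if "\<epsilon> > 0" for \<epsilon>
  proof -
    have "\<forall>\<^sub>F k in sequentially. norm_pow p (\<lambda>x. v k x - g x) < \<epsilon>"
      using lim that by (rule order_tendstoD)
    then show ?thesis by eventually_elim (simp add: S_def v less_imp_le)
  qed
  have Sne: "S \<epsilon> \<noteq> {}" if "\<epsilon> > 0" for \<epsilon>
    using eventually_happens'[OF _ Sv[OF that]] by auto
  have I_le: "I \<epsilon> \<le> energy p w" if "w \<in> S \<epsilon>" for w \<epsilon>
    unfolding I_def by (rule cINF_lower[OF bdd that])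
  have IE: "I \<epsilon> \<le> E" if \<epsilon>: "\<epsilon> > 0" for \<epsilon>
  proof (rule field_le_epsilon)
    fix e :: real assume "e > 0"
    have "\<forall>\<^sub>F k in sequentially. I \<epsilon> \<le> E + e"
      using Sv[OF \<epsilon>] E[OF \<open>e > 0\<close>]
    proof eventually_elim
      case (elim k)
      from I_le[OF elim(1)] elim(2) show ?case by linarith
    qed
    then show "I \<epsilon> \<le> E + e" by simp
  qed
  define \<epsilon> where "\<epsilon> k = 1 / real (Suc k)" for k
  have \<epsilon>: "\<epsilon> k > 0" for k by (simp add: \<epsilon>_def)
  have \<epsilon>_anti: "\<epsilon> l \<le> \<epsilon> k" if "k \<le> l" for k l using that by (simp add: \<epsilon>_def frac_le)
  have \<epsilon>0: "\<epsilon> \<longlonglongrightarrow> 0" unfolding \<epsilon>_def[abs_def] using LIMSEQ_inverse_real_of_nat by (simp add: inverse_eq_divide)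
  have S_mono: "S a \<subseteq> S b" if "a \<le> b" for a b using that by (auto simp: S_def)
  have I_mono: "I (\<epsilon> k) \<le> I (\<epsilon> l)" if "k \<le> l" for k l
    unfolding I_def by (rule cINF_superset_mono[OF Sne[OF \<epsilon>] bdd S_mono[OF \<epsilon>_anti[OF that]]]) simp
  have "\<exists>w\<in>S (\<epsilon> k). energy p w \<le> I (\<epsilon> k) + \<epsilon> k" for k
  proof -
    have "(INF w\<in>S (\<epsilon> k). energy p w) < I (\<epsilon> k) + \<epsilon> k" using \<epsilon>[of k] by (simp add: I_def)
    then show ?thesis using cINF_less_iff[OF Sne[OF \<epsilon>] bdd] by (metis less_imp_le)
  qed
  then obtain w where w: "\<And>k. w k \<in> S (\<epsilon> k)" "\<And>k. energy p (w k) \<le> I (\<epsilon> k) + \<epsilon> k" by metis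
  have wW: "w k \<in> W p" for k using w(1)[of k] by (simp add: S_def)
  have wE: "energy p (w k) \<le> E + \<epsilon> k" for k using w(2)[of k] IE[OF \<epsilon>[of k]] by linarith
  have wg: "norm_pow p (\<lambda>x. w k x - g x) \<le> \<epsilon> k" for k using w(1)[of k] by (simp add: S_def)
  have wgL: "(\<lambda>x. w k x - g x) \<in> Lp p muU" for k by (rule Lp_diff[OF W_D(2)[OF wW] g p0])
  have inc: "incseq (\<lambda>k. I (\<epsilon> k))" unfolding incseq_def using I_mono by blast
  obtain I\<^sub>0 where I0: "(\<lambda>k. I (\<epsilon> k)) \<longlonglongrightarrow> I\<^sub>0" "\<And>k. I (\<epsilon> k) \<le> I\<^sub>0"
    by (rule incseq_convergent[OF inc, of E]) (use IE[OF \<epsilon>] in auto)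
  \<comment> \<open>The midpoint stays in the convex set \<open>S (\<epsilon> N)\<close>, so its
    energy is at least \<open>I (\<epsilon> N)\<close>; the midpoint identity leaves the rest to the
    defect.\<close>
  have mid: "(LINT z|muH p. mid_defect p (dif (w k) z) (dif (w l) z)) \<le> I\<^sub>0 - I (\<epsilon> N) + \<epsilon> N"
    if kl: "k \<ge> N" "l \<ge> N" for k l N
  proof -
    have "(\<lambda>x. (w k x + w l x) / 2) \<in> S (\<epsilon> N)"
    proof -
      have "norm_pow p (\<lambda>x. ((w k x - g x) + (w l x - g x)) / 2)
          \<le> (norm_pow p (\<lambda>x. w k x - g x) + norm_pow p (\<lambda>x. w l x - g x)) / 2"
        by (rule pint_midpoint_le[OF p wgL wgL])
      also have "\<dots> \<le> \<epsilon> N" using wg[of k] wg[of l] \<epsilon>_anti[OF kl(1)] \<epsilon>_anti[OF kl(2)] by simp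
      also have "(\<lambda>x. ((w k x - g x) + (w l x - g x)) / 2) = (\<lambda>x. (w k x + w l x) / 2 - g x)"
        by (rule ext) (simp add: field_simps)
      finally show ?thesis using W_midpoint[OF wW wW p] by (simp add: S_def)
    qed
    from I_le[OF this] have le: "I (\<epsilon> N) \<le> pint p (muH p) (\<lambda>z. (dif (w k) z + dif (w l) z) / 2)"
      unfolding dif_midpoint .
    have "energy p (w j) \<le> I\<^sub>0 + \<epsilon> N" if "j \<ge> N" for j
      using w(2)[of j] I0(2)[of j] \<epsilon>_anti[OF that] by linarith
    from le this[OF kl(1)] this[OF kl(2)] show ?thesis
      using pint_midpoint(3)[OF p W_D(3)[OF wW[of k]] W_D(3)[OF wW[of l]]] by argo
  qed
  have H_Cauchy: "\<exists>N. \<forall>k\<ge>N. \<forall>l\<ge>N. pint p (muH p) (\<lambda>z. dif (w k) z - dif (w l) z) \<le> e" if e: "e > 0" for e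
  proof -
    define e' where "e' = e / (4 * (\<bar>E\<bar> + 2))"
    have e': "e' > 0" using e by (simp add: e'_def)
    obtain K where K: "K \<ge> 0"
      "\<And>a b. \<bar>a - b\<bar> powr p \<le> e' * (\<bar>a\<bar> powr p + \<bar>b\<bar> powr p) + K * mid_defect p a b"
      using diff_powr_le_mid_defect[OF p e'] by blast
    have "(\<lambda>N. K * (I\<^sub>0 - I (\<epsilon> N) + \<epsilon> N)) \<longlonglongrightarrow> K * (I\<^sub>0 - I\<^sub>0 + 0)"
      by (intro tendsto_intros I0(1) \<epsilon>0)
    then have "\<forall>\<^sub>F N in sequentially. K * (I\<^sub>0 - I (\<epsilon> N) + \<epsilon> N) < e / 2"
      using e by (intro order_tendstoD) auto
    then obtain N where N: "K * (I\<^sub>0 - I (\<epsilon> N) + \<epsilon> N) < e / 2"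
      by (auto simp: eventually_sequentially)
    have "pint p (muH p) (\<lambda>z. dif (w k) z - dif (w l) z) \<le> e" if kl: "k \<ge> N" "l \<ge> N" for k l
    proof -
      note Lk = W_D(3)[OF wW[of k]] and Ll = W_D(3)[OF wW[of l]]
      note imid = pint_midpoint(2)[OF p Lk Ll]
      have "pint p (muH p) (\<lambda>z. dif (w k) z - dif (w l) z)
        \<le> (LINT z|muH p. e' * (\<bar>dif (w k) z\<bar> powr p + \<bar>dif (w l) z\<bar> powr p) + K * mid_defect p (dif (w k) z) (dif (w l) z))"
        unfolding pint_def using Lp_diff[OF Lk Ll p0] Lk Ll imid
        by (intro integral_mono K Bochner_Integration.integrable_add integrable_mult_right Lp_integrable) auto
      also have "\<dots> = e' * (energy p (w k) + energy p (w l)) + K * (LINT z|muH p. mid_defect p (dif (w k) z) (dif (w l) z))"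
        using Lk Ll imid by (simp add: pint_def Lp_integrable)
      also have "\<dots> \<le> e' * ((\<bar>E\<bar> + 1) + (\<bar>E\<bar> + 1)) + K * (I\<^sub>0 - I (\<epsilon> N) + \<epsilon> N)"
      proof (intro add_mono mult_left_mono mid kl)
        have "\<epsilon> j \<le> 1" for j by (simp add: \<epsilon>_def)
        then show "energy p (w k) \<le> \<bar>E\<bar> + 1" "energy p (w l) \<le> \<bar>E\<bar> + 1"
          using wE[of k] wE[of l] abs_ge_self[of E] by (smt (verit))+
      qed (use e' K in auto)
      also have "e' * ((\<bar>E\<bar> + 1) + (\<bar>E\<bar> + 1)) \<le> e' * (2 * (\<bar>E\<bar> + 2))"
        using e' by (intro mult_left_mono) auto
      also have "\<dots> = e / 2" unfolding e'_def by (simp add: field_simps add_nonneg_eq_0_iff)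
      finally show ?thesis using N by linarith
    qed
    then show ?thesis by blast
  qed
  \<comment> \<open>Pointwise convergence of the jumps is all that is extracted; the energy of the
    limit is bounded by Fatou.\<close>
  obtain r1 where r1: "strict_mono r1" "AE z in muH p. convergent (\<lambda>k. dif (w (r1 k)) z)"
    by (rule Lp_Cauchy_AE_convergent_subseq[OF p W_D(3)[OF wW] H_Cauchy])
  have "\<exists>N. \<forall>k\<ge>N. \<forall>l\<ge>N. norm_pow p (\<lambda>x. w (r1 k) x - w (r1 l) x) \<le> e" if e: "e > 0" for e
  proof -
    have "(\<lambda>N. 2 powr p * (\<epsilon> N + \<epsilon> N)) \<longlonglongrightarrow> 2 powr p * (0 + 0)" by (intro tendsto_intros \<epsilon>0)
    then have "\<forall>\<^sub>F N in sequentially. 2 powr p * (\<epsilon> N + \<epsilon> N) < e"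
      using e by (intro order_tendstoD) auto
    then obtain N where N: "2 powr p * (\<epsilon> N + \<epsilon> N) < e" by (auto simp: eventually_sequentially)
    have "norm_pow p (\<lambda>x. w (r1 k) x - w (r1 l) x) \<le> e" if kl: "k \<ge> N" "l \<ge> N" for k l
    proof -
      have rN: "N \<le> r1 k" "N \<le> r1 l" using seq_suble[OF r1(1), of k] seq_suble[OF r1(1), of l] kl by auto
      have "norm_pow p (\<lambda>x. (w (r1 k) x - g x) - (w (r1 l) x - g x))
        \<le> 2 powr p * (norm_pow p (\<lambda>x. w (r1 k) x - g x) + norm_pow p (\<lambda>x. w (r1 l) x - g x))"
        by (rule pint_diff_le[OF wgL wgL p0])
      also have "\<dots> \<le> 2 powr p * (\<epsilon> N + \<epsilon> N)"
        using wg[of "r1 k"] wg[of "r1 l"] \<epsilon>_anti[OF rN(1)] \<epsilon>_anti[OF rN(2)]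
        by (intro mult_left_mono add_mono) auto
      finally show ?thesis using N by simp
    qed
    then show ?thesis by blast
  qed
  then obtain r2 where r2: "strict_mono r2" "AE x in muU. convergent (\<lambda>k. w (r1 (r2 k)) x)"
    by (rule Lp_Cauchy_AE_convergent_subseq[OF p W_D(2)[OF wW]])
  define \<rho> where "\<rho> k = r1 (r2 k)" for k
  have \<rho>: "k \<le> \<rho> k" for k
    using seq_suble[OF r1(1), of "r2 k"] seq_suble[OF r2(1), of k] by (simp add: \<rho>_def)
  have "AE z in lborel. 0 < kern p z \<longrightarrow> convergent (\<lambda>k. dif (w (\<rho> k)) z)"
    using r1(2) unfolding AE_muH
  proof eventually_elim
    case (elim z)
    then show ?case using convergent_subseq_convergent[OF _ r2(1)] by (auto simp: \<rho>_def o_def)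
  qed
  then have "AE z in lborel. z \<in> cross_dom U \<longrightarrow> convergent (\<lambda>k. dif (w (\<rho> k)) z)"
  proof eventually_elim
    case (elim z)
    then show ?case using kern_pos[of z p] by (cases "fst z = snd z") (auto simp: dif_def convergent_const)
  qed
  then have "AE z in (lborel :: 'a measure) \<Otimes>\<^sub>M lborel. z \<in> cross_dom U \<longrightarrow> convergent (\<lambda>k. dif (w (\<rho> k)) z)"
    by (subst lborel_prod)
  then have "AE x in lborel. AE y in lborel. (x, y) \<in> cross_dom U \<longrightarrow> convergent (\<lambda>k. dif (w (\<rho> k)) (x, y))"
    by (rule lborel_pair.AE_pair)
  then have "AE x in muU. AE y in lborel. (x, y) \<in> cross_dom U \<longrightarrow> convergent (\<lambda>k. dif (w (\<rho> k)) (x, y))"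
    unfolding AE_muU by eventually_elim simp
  then have "AE x in muU. convergent (\<lambda>k. w (\<rho> k) x) \<and>
      (AE y in lborel. (x, y) \<in> cross_dom U \<longrightarrow> convergent (\<lambda>k. dif (w (\<rho> k)) (x, y)))"
    using r2(2) by eventually_elim (simp add: \<rho>_def)
  \<comment> \<open>One point of \<open>U\<close> at which the values converge, and from which the
    jumps to almost every \<open>y\<close> converge, carries convergence to almost every point of
    the space.\<close>
  then obtain x where x: "x \<in> U" "convergent (\<lambda>k. w (\<rho> k) x)"
    "AE y in lborel. (x, y) \<in> cross_dom U \<longrightarrow> convergent (\<lambda>k. dif (w (\<rho> k)) (x, y))"
    using exists_in_muU by blast
  have conv: "AE y in lborel. convergent (\<lambda>k. w (\<rho> k) y)"
    using x(3)
  proof eventually_elim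
    case (elim y)
    then have "convergent (\<lambda>k. dif (w (\<rho> k)) (x, y))" using x(1) by (simp add: cross_dom_def)
    from convergent_diff[OF x(2) this] show ?case by (simp add: dif_def)
  qed
  have [measurable]: "w k \<in> borel_measurable borel" for k by (rule W_D(1)[OF wW])
  define w0 where "w0 y = lim (\<lambda>k. w (\<rho> k) y)" for y
  have w0_meas [measurable]: "w0 \<in> borel_measurable borel" unfolding w0_def[abs_def] by measurable
  have lim0: "AE y in lborel. (\<lambda>k. w (\<rho> k) y) \<longlonglongrightarrow> w0 y"
    using conv by eventually_elim (simp add: w0_def convergent_LIMSEQ_iff)
  have g_meas: "g \<in> borel_measurable borel" using Lp_measurable[OF g] by simp
  have limH: "AE z in muH p. (\<lambda>k. dif (w (\<rho> k)) z) \<longlonglongrightarrow> dif w0 z"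
    using AE_lborel_fst_snd[OF lim0] unfolding AE_muH
  proof eventually_elim
    case (elim z)
    then show ?case unfolding dif_def by (auto intro: tendsto_diff)
  qed
  have ev\<epsilon>: "\<forall>\<^sub>F k in sequentially. \<epsilon> (\<rho> k) \<le> e" if "e > 0" for e
  proof -
    have "\<forall>\<^sub>F k in sequentially. \<epsilon> k < e" using \<epsilon>0 that by (rule order_tendstoD)
    then show ?thesis
    proof eventually_elim
      case (elim k)
      from \<epsilon>_anti[OF \<rho>[of k]] elim show ?case by linarith
    qed
  qed
  have Fat: "dif w0 \<in> Lp p (muH p)" "pint p (muH p) (dif w0) \<le> E + e" if "e > 0" for e
  proof -
    have "\<forall>\<^sub>F k in sequentially. pint p (muH p) (dif (w (\<rho> k))) \<le> E + e"
      using ev\<epsilon>[OF that]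
    proof eventually_elim
      case (elim k)
      with wE[of "\<rho> k"] show ?case by linarith
    qed
    then show "dif w0 \<in> Lp p (muH p)" "pint p (muH p) (dif w0) \<le> E + e"
      using p Lp_Fatou[OF W_D(3)[OF wW] _ _ limH, of "E + e"] by auto
  qed
  have FatU: "(\<lambda>x. w0 x - g x) \<in> Lp p muU" "norm_pow p (\<lambda>x. w0 x - g x) \<le> e" if "e > 0" for e
  proof -
    have "AE x in muU. (\<lambda>k. w (\<rho> k) x - g x) \<longlonglongrightarrow> w0 x - g x"
      using lim0 unfolding AE_muU by eventually_elim (auto intro: tendsto_intros)
    moreover have "\<forall>\<^sub>F k in sequentially. norm_pow p (\<lambda>x. w (\<rho> k) x - g x) \<le> e"
      using ev\<epsilon>[OF that] by eventually_elim (rule order_trans[OF wg])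
    moreover have "(\<lambda>x. w0 x - g x) \<in> borel_measurable muU" using g_meas by simp
    ultimately show "(\<lambda>x. w0 x - g x) \<in> Lp p muU" "norm_pow p (\<lambda>x. w0 x - g x) \<le> e"
      using p Lp_Fatou[OF wgL, of "\<lambda>x. w0 x - g x" \<rho> e] by auto
  qed
  have "norm_pow p (\<lambda>x. w0 x - g x) \<le> 0"
    by (rule field_le_epsilon) (use FatU(2) in simp)
  then have "norm_pow p (\<lambda>x. w0 x - g x) = 0" using pint_nonneg[of p muU "\<lambda>x. w0 x - g x"] by linarith
  then have "AE x in muU. \<bar>w0 x - g x\<bar> powr p = 0"
    unfolding pint_def by (subst (asm) integral_nonneg_eq_0_iff_AE) (use Lp_integrable[OF FatU(1)[of 1]] in auto)
  then have eq: "AE x in muU. w0 x = g x" by eventually_elim simp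
  have "w0 \<in> Lp p muU" using norm_pow_cong_AE(2)[OF w0_meas g_meas eq] g by simp
  then have "w0 \<in> W p" using Fat(1)[of 1] w0_meas by (simp add: W_def)
  moreover have "energy p w0 \<le> E" by (rule field_le_epsilon) (use Fat(2) in simp)
  ultimately show ?thesis using eq that by blast
qed

text \<open>Compactness produces a limit on \<open>U\<close> only, but norm and constraint see
  nothing else; \<open>energy_lower_semicontinuous\<close> supplies the values elsewhere.\<close>

lemma exists_minimizer:
  assumes p: "1 < p"
  obtains w where "w \<in> W p" "balanced p w" "norm_pow p w = 1" "energy p w = 2 * lam p"
proof -
  have "\<exists>v. v \<in> W p \<and> balanced p v \<and> norm_pow p v = 1 \<and> energy p v \<le> 2 * lam p + 1 / real (Suc k)" for k
    by (rule minimizing_function[OF p]) simp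
  then obtain v where v: "\<And>k. v k \<in> W p" "\<And>k. balanced p (v k)" "\<And>k. norm_pow p (v k) = 1"
    "\<And>k. energy p (v k) \<le> 2 * lam p + 1 / real (Suc k)" by metis
  have "energy p (v k) \<le> 2 * lam p + 1" for k
    using v(4)[of k] by (rule order_trans) simp
  then obtain r :: "nat \<Rightarrow> nat" where r: "strict_mono r" and Cau:
    "\<And>e. e > 0 \<Longrightarrow> \<exists>N. \<forall>k\<ge>N. \<forall>l\<ge>N. norm_pow p (\<lambda>x. v (r k) x - v (r l) x) \<le> e"
    using Lp_compactness[where v = v and B = "2 * lam p + 1", OF p v(1) eq_refl[OF v(3)]] by blast
  obtain g where g: "g \<in> Lp p muU" and lim: "(\<lambda>k. norm_pow p (\<lambda>x. v (r k) x - g x)) \<longlonglongrightarrow> 0"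
    by (rule Lp_Cauchy_limit[OF p W_D(2)[OF v(1)] Cau])
  have "\<forall>\<^sub>F k in sequentially. energy p (v (r k)) \<le> 2 * lam p + e" if e: "e > 0" for e
  proof -
    have "(\<lambda>k. 1 / real (Suc k)) \<longlonglongrightarrow> 0" using LIMSEQ_inverse_real_of_nat by (simp add: inverse_eq_divide)
    then have "\<forall>\<^sub>F k in sequentially. 1 / real (Suc k) < e" using e by (rule order_tendstoD)
    then show ?thesis
    proof eventually_elim
      case (elim k)
      have "1 / real (Suc (r k)) \<le> 1 / real (Suc k)" using seq_suble[OF r, of k] by (intro divide_left_mono) auto
      then show ?case using v(4)[of "r k"] elim by linarith
    qed
  qed
  then obtain w where w: "w \<in> W p" "AE x in muU. w x = g x" "energy p w \<le> 2 * lam p"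
    using energy_lower_semicontinuous[OF p v(1) g lim] by blast
  have g_meas: "g \<in> borel_measurable borel" using Lp_measurable[OF g] by simp
  note cong = norm_pow_cong_AE[OF W_D(1)[OF w(1)] g_meas w(2)]
  have tend: "(\<lambda>k. norm_pow p (\<lambda>x. v (r k) x - c)) \<longlonglongrightarrow> norm_pow p (\<lambda>x. g x - c)" for c
  proof (rule tendsto_pint[OF p])
    show "(\<lambda>x. g x - c) \<in> Lp p muU" using Lp_diff[OF g Lp_const_muU] p by simp
    show "(\<lambda>x. v (r k) x - c) \<in> Lp p muU" for k using W_D(2)[OF W_shift[OF v(1) p]] .
    show "(\<lambda>k. norm_pow p (\<lambda>x. (v (r k) x - c) - (g x - c))) \<longlonglongrightarrow> 0" using lim by simp
  qed
  have ng: "norm_pow p g = 1"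
    using LIMSEQ_unique[OF tend[of 0]] v(3) by simp
  have "norm_pow p g \<le> norm_pow p (\<lambda>x. g x - c)" for c
  proof (rule LIMSEQ_le_const[OF tend], intro exI allI impI)
    fix k show "norm_pow p g \<le> norm_pow p (\<lambda>x. v (r k) x - c)"
      using v(2)[of "r k"] v(3)[of "r k"] unfolding balanced_iff[OF p W_D(2)[OF v(1)]] ng by metis
  qed
  then have bg: "balanced p g" using balanced_iff[OF p g] by blast
  have b: "balanced p w" and n: "norm_pow p w = 1" using cong bg ng by auto
  have "2 * lam p \<le> energy p w" using lam_le[OF p w(1) b] n by simp
  with that[OF w(1) b n] w(3) show ?thesis by linarith
qed

section \<open>The first non-zero eigenvalue\<close>

text \<open>The perturbed function need not be balanced and is compared after its balancing shift
  \<open>c\<close>. To first order the shift is free: its contribution to the tangent is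
  \<open>c\<close> times the integral of \<open>sgn_pow p (w x)\<close>, which is 0.\<close>

lemma minimizer_variation_ge:
  assumes p: "1 < p" and w: "w \<in> W p" and b: "balanced p w" and n: "norm_pow p w = 1"
    and E: "energy p w = 2 * lam p" and \<phi>: "\<phi> \<in> W p"
  shows "p * (LINT z|muH p. sgn_pow p (dif w z) * dif \<phi> z)
    \<ge> 2 * lam p * (p * (LINT x|muU. sgn_pow p (w x) * \<phi> x))"
proof (rule pint_derivative_ge[OF p W_D(3)[OF w] W_D(3)[OF \<phi>]])
  fix t :: real
  define I where "I = (LINT x|muU. sgn_pow p (w x) * \<phi> x)"
  have wt: "(\<lambda>x. w x + t * \<phi> x) \<in> W p" by (rule W_linear[OF w \<phi> p])
  obtain c where c: "2 * lam p * norm_pow p (\<lambda>x. w x + t * \<phi> x - c) \<le> energy p (\<lambda>x. w x + t * \<phi> x)"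
    by (rule lam_le_shift[OF p wt])
  have L: "(\<lambda>x. t * \<phi> x - c) \<in> Lp p muU"
    using W_D(2)[OF W_shift[OF W_cmult[OF \<phi>] p]] .
  note i1 = integrable_sgn_pow_mult[OF p W_D(2)[OF w] W_D(2)[OF \<phi>]]
  note i2 = integrable_sgn_pow_mult[OF p W_D(2)[OF w] Lp_const_muU[of 1]]
  have "(LINT x|muU. sgn_pow p (w x) * (t * \<phi> x - c)) = (LINT x|muU. t * (sgn_pow p (w x) * \<phi> x) - c * (sgn_pow p (w x) * 1))"
    by (rule Bochner_Integration.integral_cong) (auto simp: algebra_simps)
  also have "\<dots> = t * I - c * (LINT x|muU. sgn_pow p (w x) * 1)"
    using i1 i2 by (simp add: I_def)
  also have "(LINT x|muU. sgn_pow p (w x) * 1) = 0" using b by (simp add: balanced_def)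
  finally have int: "(LINT x|muU. sgn_pow p (w x) * (t * \<phi> x - c)) = t * I" by simp
  have "1 + p * (t * I) \<le> norm_pow p (\<lambda>x. w x + (t * \<phi> x - c))"
    using pint_ge_tangent[OF p W_D(2)[OF w] L] n int by simp
  also have "(\<lambda>x. w x + (t * \<phi> x - c)) = (\<lambda>x. w x + t * \<phi> x - c)" by (rule ext) simp
  finally have "2 * lam p * (1 + p * (t * I)) \<le> 2 * lam p * norm_pow p (\<lambda>x. w x + t * \<phi> x - c)"
    by (intro mult_left_mono) simp_all
  then have "2 * lam p * (1 + p * (t * I)) \<le> energy p (\<lambda>x. w x + t * \<phi> x)" using c by linarith
  then show "energy p w + t * (2 * lam p * (p * (LINT x|muU. sgn_pow p (w x) * \<phi> x)))
      \<le> pint p (muH p) (\<lambda>z. dif w z + t * dif \<phi> z)"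
    unfolding E dif_linear I_def[symmetric] by (simp add: algebra_simps)
qed

lemma minimizer_variation_eq:
  assumes p: "1 < p" and w: "w \<in> W p" and b: "balanced p w" and n: "norm_pow p w = 1"
    and E: "energy p w = 2 * lam p" and \<phi>: "\<phi> \<in> W p"
  shows "(LINT z|muH p. sgn_pow p (dif w z) * dif \<phi> z) = 2 * lam p * (LINT x|muU. sgn_pow p (w x) * \<phi> x)"
proof -
  define A where "A = (LINT z|muH p. sgn_pow p (dif w z) * dif \<phi> z)"
  define I where "I = (LINT x|muU. sgn_pow p (w x) * \<phi> x)"
  have "p * A \<ge> p * (2 * lam p * I)"
    using minimizer_variation_ge[OF assms] by (simp add: A_def I_def mult_ac)
  moreover have "p * (- A) \<ge> p * (2 * lam p * (- I))"
    using minimizer_variation_ge[OF assms(1-5) W_cmult[OF \<phi>, of "-1"]]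
    unfolding dif_cmult by (simp add: A_def I_def mult_ac)
  ultimately have "A = 2 * lam p * I" using p by (simp add: mult_le_cancel_left_pos)
  then show ?thesis by (simp add: A_def I_def)
qed

lemma balanced_const_zero:
  assumes "1 < p" "balanced p (\<lambda>x. c)"
  shows "c = 0"
proof -
  have "sgn_pow p c = 0" using assms(2) volU_pos by (simp add: balanced_def measure_muU)
  then have "\<bar>c\<bar> powr p = 0" using sgn_pow_mult_self[of p c] by simp
  then show ?thesis by simp
qed

lemma AE_lborel_imp_muU: "AE x in lborel. P x \<Longrightarrow> AE x in muU. P x"
  unfolding AE_muU by (auto elim!: eventually_mono)

lemma norm_pow_zero_imp:
  assumes "u \<in> Lp p muU" "norm_pow p u = 0"
  shows "AE x in muU. u x = 0"
proof -
  have "AE x in muU. \<bar>u x\<bar> powr p = 0"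
    using assms unfolding pint_def
    by (subst (asm) integral_nonneg_eq_0_iff_AE) (auto intro: Lp_integrable)
  then show ?thesis by eventually_elim simp
qed

text \<open>Zero energy leaves a constant, and either alternative rules out a nonzero one. The first
  gives \<open>lam p \<noteq> 0\<close>, the second shows that an eigenfunction does not vanish on
  \<open>U\<close>.\<close>

lemma zero_energy_balanced:
  assumes p: "1 < p" and u: "u \<in> W p" and E: "energy p u = 0"
    and h: "balanced p u \<or> norm_pow p u = 0"
  shows "AE x in lborel. u x = 0"
proof -
  obtain c where c: "AE x in lborel. u x = c" by (rule energy_zero_imp_const[OF u E])
  have c': "AE x in muU. u x = c" using c by (rule AE_lborel_imp_muU)
  have "c = 0"
    using h
  proof
    assume "balanced p u"
    then have "balanced p (\<lambda>x. c)" using norm_pow_cong_AE(3)[OF W_D(1)[OF u] _ c'] by simp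
    then show ?thesis by (rule balanced_const_zero[OF p])
  next
    assume "norm_pow p u = 0"
    then have "AE x in muU. u x = 0" using norm_pow_zero_imp[OF W_D(2)[OF u]] by blast
    with c' have "AE x in muU. c = 0" by eventually_elim simp
    then show ?thesis using exists_in_muU by blast
  qed
  with c show ?thesis by simp
qed

lemma is_eigenvalue_lam:
  assumes p: "1 < p"
  shows "is_eigenvalue U d s p (lam p)" "lam p \<noteq> 0"
proof -
  obtain w where w: "w \<in> W p" "balanced p w" "norm_pow p w = 1" "energy p w = 2 * lam p"
    using exists_minimizer[OF p] by blast
  have nz: "\<not> (AE x in lborel. w x = 0)"
  proof
    assume "AE x in lborel. w x = 0"
    then have "AE x in muU. w x = 0" by (rule AE_lborel_imp_muU)
    then have "norm_pow p w = norm_pow p (\<lambda>x. 0)"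
      by (intro norm_pow_cong_AE(1)[OF W_D(1)[OF w(1)]]) simp_all
    then show False using w(3) by (simp add: pint_def)
  qed
  show "lam p \<noteq> 0"
  proof
    assume "lam p = 0"
    then have "energy p w = 0" using w(4) by simp
    with zero_energy_balanced[OF p w(1)] w(2) nz show False by blast
  qed
  have "weak_solution U d s p (lam p) w"
    unfolding weak_solution_def
  proof (intro conjI ballI W_subset_W_sp[OF w(1)])
    fix v assume "v \<in> W_sp U d s p"
    then obtain v' where v': "v' \<in> W p" "AE x in lborel. v x = v' x" by (rule W_sp_obtain)
    have "H_form U d s p w v = (LINT z|muH p. sgn_pow p (dif w z) * dif v' z)"
      by (rule H_form_representative) (use W_D(1)[OF w(1)] W_D(1)[OF v'(1)] v'(2) in auto)
    moreover have "(LINT x:U|lebesgue. sgn_pow p (w x) * v x) = (LINT x|muU. sgn_pow p (w x) * v' x)"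
      by (rule sgn_pow_integral_representative) (use W_D(1)[OF w(1)] W_D(1)[OF v'(1)] v'(2) in auto)
    ultimately show "1 / 2 * H_form U d s p w v = lam p * (LINT x:U|lebesgue. sgn_pow p (w x) * v x)"
      using minimizer_variation_eq[OF p w v'(1)] by simp
  qed
  moreover have "nonzero_ae w" using nonzero_ae_cong[of w w] nz by simp
  ultimately show "is_eigenvalue U d s p (lam p)" unfolding is_eigenvalue_def by blast
qed

lemma lam_le_eigenvalue:
  assumes p: "1 < p" and m: "is_eigenvalue U d s p m" "m \<noteq> 0"
  shows "lam p \<le> m"
proof -
  obtain u where u: "weak_solution U d s p m u" "nonzero_ae u" using m(1) by (auto simp: is_eigenvalue_def)
  then have "u \<in> W_sp U d s p" by (simp add: weak_solution_def)
  then obtain u' where u': "u' \<in> W p" "AE x in lborel. u x = u' x" by (rule W_sp_obtain)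
  have weak: "1 / 2 * (LINT z|muH p. sgn_pow p (dif u' z) * dif v z) = m * (LINT x|muU. sgn_pow p (u' x) * v x)"
    if v: "v \<in> W p" for v
  proof -
    have "H_form U d s p u v = (LINT z|muH p. sgn_pow p (dif u' z) * dif v z)"
      by (rule H_form_representative) (use W_D(1)[OF u'(1)] W_D(1)[OF v] u'(2) in auto)
    moreover have "(LINT x:U|lebesgue. sgn_pow p (u x) * v x) = (LINT x|muU. sgn_pow p (u' x) * v x)"
      by (rule sgn_pow_integral_representative) (use W_D(1)[OF u'(1)] W_D(1)[OF v] u'(2) in auto)
    ultimately show ?thesis using u(1) W_subset_W_sp[OF v] by (simp add: weak_solution_def)
  qed
  have nz: "\<not> (AE x in lborel. u' x = 0)" using nonzero_ae_cong[OF u'(2)] u(2) by simp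
  have b: "balanced p u'"
    using weak[OF W_const[of 1]] m(2) by (simp add: balanced_def)
  have E: "energy p u' = 2 * m * norm_pow p u'"
    using weak[OF u'(1)] by (simp add: sgn_pow_mult_self pint_def)
  have pos: "norm_pow p u' > 0"
  proof (rule ccontr)
    assume "\<not> norm_pow p u' > 0"
    then have "norm_pow p u' = 0" using pint_nonneg[of p muU u'] by linarith
    with zero_energy_balanced[OF p u'(1)] E nz show False by simp
  qed
  have "2 * lam p * norm_pow p u' \<le> 2 * m * norm_pow p u'" using lam_le[OF p u'(1) b] E by simp
  then show ?thesis using pos by simp
qed

lemma is_first_nonzero_eigenvalue_lam:
  assumes "1 < p"
  shows "is_first_nonzero_eigenvalue U d s p (lam p)"
  unfolding is_first_nonzero_eigenvalue_def
  using is_eigenvalue_lam[OF assms] lam_le_eigenvalue[OF assms] by blast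

lemma minimizer_representative:
  assumes p: "1 < p" and u: "is_minimizer_sp U d s p u" "Lp_norm_pow U p u = 1"
  obtains u' where "u' \<in> W p" "AE x in lborel. u x = u' x" "balanced p u'" "norm_pow p u' = 1"
    "energy p u' = 2 * lam p"
proof -
  have adm: "u \<in> admissible_sp U d s p" using u(1) by (simp add: is_minimizer_sp_def)
  then have "u \<in> W_sp U d s p" by (simp add: admissible_sp_def)
  then obtain u' where u': "u' \<in> W p" "AE x in lborel. u x = u' x" by (rule W_sp_obtain)
  have b: "balanced p u'"
    using adm sgn_pow_integral_balanced[OF W_D(1)[OF u'(1)] u'(2)] by (simp add: admissible_sp_def)
  have "ennreal (norm_pow p u') = ennreal 1" using u(2) Lp_norm_pow_W[OF u'] by simp
  then have n: "norm_pow p u' = 1" by (subst (asm) ennreal_inj) (simp_all add: pint_nonneg)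
  have "quot (ennreal (energy p u')) (ennreal 2) = ennreal (lam p)"
    using u by (simp add: is_minimizer_sp_def H_energy_W[OF u'] lambda_sp_eq[OF p])
  then have "ennreal (energy p u' / 2) = ennreal (lam p)"
    by (subst (asm) quot_ennreal) (simp_all add: pint_nonneg)
  then have "energy p u' / 2 = lam p" by (subst (asm) ennreal_inj) (simp_all add: pint_nonneg)
  then show ?thesis using that[OF u' b n] by simp
qed

end

section \<open>Continuous representatives for large exponents\<close>

lemma geometric_steps_limit:
  fixes a :: "nat \<Rightarrow> real"
  assumes step: "\<And>k. \<bar>a k - a (Suc k)\<bar> \<le> c * \<gamma> ^ k" and \<gamma>: "0 \<le> \<gamma>" "\<gamma> < 1"
  obtains L where "a \<longlonglongrightarrow> L" "\<And>k. \<bar>L - a k\<bar> \<le> c * \<gamma> ^ k / (1 - \<gamma>)"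
proof -
  have sg: "summable (\<lambda>j. c * \<gamma> ^ (j + k))" for k
    using \<gamma> by (simp add: power_add mult.assoc[symmetric] summable_geometric summable_mult summable_mult2)
  have sD: "summable (\<lambda>j. a (j + k) - a (Suc (j + k)))" for k
    by (rule summable_comparison_test'[OF sg[of k], of 0]) (use step in simp)
  have lim: "(\<lambda>n. a k - (\<Sum>j<n. a (j + k) - a (Suc (j + k)))) \<longlonglongrightarrow> a k - (\<Sum>j. a (j + k) - a (Suc (j + k)))" for k
    by (intro tendsto_intros summable_LIMSEQ sD)
  have tel: "a k - (\<Sum>j<n. a (j + k) - a (Suc (j + k))) = a (n + k)" for n k
    by (induction n) simp_all
  define L where "L = a 0 - (\<Sum>j. a (j + 0) - a (Suc (j + 0)))"
  have aL: "a \<longlonglongrightarrow> L" using lim[of 0] unfolding tel L_def by simp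
  have "\<bar>L - a k\<bar> \<le> c * \<gamma> ^ k / (1 - \<gamma>)" for k
  proof -
    have "(\<lambda>n. a (n + k)) \<longlonglongrightarrow> L" using aL by (rule LIMSEQ_ignore_initial_segment)
    then have "L = a k - (\<Sum>j. a (j + k) - a (Suc (j + k)))"
      using lim[of k] unfolding tel by (rule LIMSEQ_unique)
    then have "\<bar>L - a k\<bar> = \<bar>\<Sum>j. a (j + k) - a (Suc (j + k))\<bar>" by simp
    also have "\<dots> \<le> (\<Sum>j. \<bar>a (j + k) - a (Suc (j + k))\<bar>)"
      by (rule summable_rabs, rule summable_comparison_test'[OF sg[of k], of 0]) (use step in simp)
    also have "\<dots> \<le> (\<Sum>j. c * \<gamma> ^ (j + k))"
      by (rule suminf_le[OF step _ sg], rule summable_comparison_test'[OF sg[of k], of 0]) (use step in simp)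
    also have "\<dots> = (\<Sum>j. c * \<gamma> ^ k * \<gamma> ^ j)" by (simp add: power_add mult_ac)
    also have "\<dots> = c * \<gamma> ^ k * (\<Sum>j. \<gamma> ^ j)" using \<gamma> by (intro suminf_mult summable_geometric) simp
    also have "(\<Sum>j. \<gamma> ^ j) = 1 / (1 - \<gamma>)" using \<gamma> by (intro suminf_geometric) simp
    finally show ?thesis by simp
  qed
  with aL that show ?thesis by blast
qed

context nonlocal_setting
begin

definition avg :: "'a set \<Rightarrow> ('a \<Rightarrow> real) \<Rightarrow> real" where
  "avg A u = (LINT x|lborel. indicator A x * u x) / measure lborel A"

lemma U_subset_emeasure: "A \<subseteq> U \<Longrightarrow> emeasure lborel A < top"
  using emeasure_bounded_finite[OF bounded_subset[OF U_bounded]] by simp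

lemma avg_powr_le:
  assumes p: "1 < p" and u: "u \<in> W p" and A: "A \<in> sets borel" "A \<subseteq> U" "0 < measure lborel A"
  shows "ennreal (measure lborel A * \<bar>c - avg A u\<bar> powr p)
    \<le> (\<integral>\<^sup>+y. indicator A y * ennreal (\<bar>c - u y\<bar> powr p) \<partial>lborel)"
proof -
  have [measurable]: "u \<in> borel_measurable borel" "A \<in> sets borel" using W_D(1)[OF u] A by auto
  define M where "M = density lborel (\<lambda>x. ennreal (indicator A x))"
  have eM: "emeasure M UNIV = emeasure lborel A"
    unfolding M_def by (subst emeasure_density) (auto simp: ennreal_indicator)
  have sM: "space M = UNIV" by (simp add: M_def)
  have fin: "finite_measure M"
    using U_subset_emeasure[OF A(2)] by (intro finite_measureI) (simp add: sM eM)
  have mM: "measure M (space M) = measure lborel A" by (simp add: measure_def sM eM)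
  have "integrable muU (\<lambda>x. 1 + \<bar>u x\<bar> powr p)"
    using Lp_integrable[OF W_D(2)[OF u]] finite_measure.integrable_const[OF finite_measure_muU, of "1::real"]
    by (rule Bochner_Integration.integrable_add[rotated])
  then have "integrable (density lborel (\<lambda>x. ennreal (indicator U x))) (\<lambda>x. 1 + \<bar>u x\<bar> powr p)"
    by (simp add: muU_def ennreal_indicator)
  then have iU: "integrable lborel (\<lambda>x. indicator U x * (1 + \<bar>u x\<bar> powr p))"
    by (subst (asm) integrable_density) auto
  have "integrable lborel (\<lambda>x. indicator A x * u x)"
  proof (rule Bochner_Integration.integrable_bound[OF iU])
    have "\<bar>t\<bar> \<le> 1 + \<bar>t\<bar> powr p" for t :: real
    proof (cases "\<bar>t\<bar> \<le> 1")
      case False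
      then have "\<bar>t\<bar> powr 1 \<le> \<bar>t\<bar> powr p" using p by (intro powr_mono) auto
      then show ?thesis using False by simp
    qed (smt (verit) powr_ge_zero)
    then show "AE x in lborel. norm (indicator A x * u x) \<le> norm (indicator U x * (1 + \<bar>u x\<bar> powr p))"
      using A(2) by (intro AE_I2) (auto simp: indicator_def)
  qed measurable
  then have int: "integrable M u" unfolding M_def by (subst integrable_density) auto
  have "(LINT x|M. u x) = (LINT x|lborel. indicator A x * u x)"
    unfolding M_def by (subst integral_density) auto
  then have av: "(LINT x|M. u x) / measure lborel A = avg A u" by (simp add: avg_def)
  have "ennreal (measure lborel A * \<bar>c - avg A u\<bar> powr p) \<le> (\<integral>\<^sup>+y. ennreal (\<bar>c - u y\<bar> powr p) \<partial>M)"
    using average_powr_le[OF p fin _ int, of c] A(3) unfolding mM av by simp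
  also have "\<dots> = (\<integral>\<^sup>+y. indicator A y * ennreal (\<bar>c - u y\<bar> powr p) \<partial>lborel)"
    unfolding M_def by (subst nn_integral_density) (auto simp: ennreal_indicator)
  finally show ?thesis .
qed

lemma avg_norm_le:
  assumes p: "1 < p" and u: "u \<in> W p" and A: "A \<in> sets borel" "A \<subseteq> U" "0 < measure lborel A"
  shows "measure lborel A * \<bar>avg A u\<bar> powr p \<le> norm_pow p u"
proof -
  have [measurable]: "u \<in> borel_measurable borel" by (rule W_D(1)[OF u])
  have "ennreal (measure lborel A * \<bar>0 - avg A u\<bar> powr p)
    \<le> (\<integral>\<^sup>+y. indicator A y * ennreal (\<bar>0 - u y\<bar> powr p) \<partial>lborel)" by (rule avg_powr_le[OF assms])
  also have "\<dots> \<le> (\<integral>\<^sup>+y. indicator U y * ennreal (\<bar>u y\<bar> powr p) \<partial>lborel)"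
    using A(2) by (intro nn_integral_mono) (auto simp: indicator_def)
  also have "\<dots> = ennreal (norm_pow p u)"
    unfolding nn_integral_eq_pint[OF W_D(2)[OF u], symmetric] by (rule nn_integral_muU[symmetric]) measurable
  finally show ?thesis by (simp add: ennreal_le_iff pint_nonneg)
qed

text \<open>The inner integral of the energy. By Tonelli it is finite for almost every
  \<open>x\<close> when \<open>u\<close> is in \<open>W p\<close>, and exactly at such points of
  \<open>U\<close> the value \<open>u x\<close> can be compared with averages.\<close>

definition local_energy :: "real \<Rightarrow> ('a \<Rightarrow> real) \<Rightarrow> 'a \<Rightarrow> ennreal" where
  "local_energy p u x = (\<integral>\<^sup>+y. ennreal (kern p (x, y) * \<bar>dif u (x, y)\<bar> powr p) \<partial>lborel)"

lemma nn_integral_local_energy: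
  assumes u: "u \<in> W p"
  shows "local_energy p u \<in> borel_measurable borel" "(\<integral>\<^sup>+x. local_energy p u x \<partial>lborel) = ennreal (energy p u)"
proof -
  have [measurable]: "u \<in> borel_measurable borel" by (rule W_D(1)[OF u])
  have m: "(\<lambda>z. ennreal (kern p z * \<bar>dif u z\<bar> powr p)) \<in> borel_measurable borel" by measurable
  show "local_energy p u \<in> borel_measurable borel"
    using nn_integral_lborel_pair(2)[OF m] by (simp add: local_energy_def[abs_def])
  show "(\<integral>\<^sup>+x. local_energy p u x \<partial>lborel) = ennreal (energy p u)"
    using nn_integral_lborel_pair(1)[OF m] nn_integral_dif_kern[OF u] by (simp add: local_energy_def)
qed

lemma point_avg_le:
  assumes p: "1 < p" and u: "u \<in> W p" and x: "x \<in> U"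
    and B: "B \<in> sets borel" "B \<subseteq> U" "0 < measure lborel B" and \<rho>: "\<And>b. b \<in> B \<Longrightarrow> d x b \<le> \<rho>"
  shows "ennreal (measure lborel B * \<bar>u x - avg B u\<bar> powr p)
    \<le> ennreal (\<rho> powr (real DIM('a) + p * s)) * local_energy p u x"
proof -
  have [measurable]: "u \<in> borel_measurable borel" by (rule W_D(1)[OF u])
  have m: "(\<lambda>y. ennreal (kern p (x, y) * \<bar>dif u (x, y)\<bar> powr p)) \<in> borel_measurable borel"
    by (rule measurable_compose[of "\<lambda>y. (x, y)" borel borel "\<lambda>z. ennreal (kern p z * \<bar>dif u z\<bar> powr p)"])
      (auto intro!: borel_measurable_continuous_onI continuous_intros)
  have "ennreal (measure lborel B * \<bar>u x - avg B u\<bar> powr p)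
    \<le> (\<integral>\<^sup>+y. indicator B y * ennreal (\<bar>u x - u y\<bar> powr p) \<partial>lborel)"
    by (rule avg_powr_le[OF p u B])
  also have "\<dots> \<le> (\<integral>\<^sup>+y. ennreal (\<rho> powr (real DIM('a) + p * s)) * ennreal (kern p (x, y) * \<bar>dif u (x, y)\<bar> powr p) \<partial>lborel)"
  proof (rule nn_integral_mono)
    fix y
    show "indicator B y * ennreal (\<bar>u x - u y\<bar> powr p)
      \<le> ennreal (\<rho> powr (real DIM('a) + p * s)) * ennreal (kern p (x, y) * \<bar>dif u (x, y)\<bar> powr p)"
    proof (cases "y \<in> B")
      case True
      have "ennreal (\<bar>dif u (x, y)\<bar> powr p) \<le> ennreal (\<rho> powr (real DIM('a) + p * s) * (kern p (x, y) * \<bar>dif u (x, y)\<bar> powr p))"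
        by (intro ennreal_leI dif_powr_le_kern p) (use x \<rho>[OF True] in \<open>auto simp: cross_dom_def\<close>)
      then show ?thesis using True by (simp add: dif_def ennreal_mult)
    qed simp
  qed
  also have "\<dots> = ennreal (\<rho> powr (real DIM('a) + p * s)) * local_energy p u x"
    unfolding local_energy_def by (rule nn_integral_cmult) (use m in simp)
  finally show ?thesis .
qed

text \<open>Jensen in each variable: over \<open>B\<close> at a fixed point of \<open>A\<close>,
  then over \<open>A\<close>. The energy of \<open>A \<times> B\<close> controls the double integral
  that remains.\<close>

lemma avg_diff_le:
  assumes p: "1 < p" and u: "u \<in> W p"
    and A: "A \<in> sets borel" "A \<subseteq> U" "0 < measure lborel A"
    and B: "B \<in> sets borel" "B \<subseteq> U" "0 < measure lborel B"
    and \<rho>: "\<And>a b. a \<in> A \<Longrightarrow> b \<in> B \<Longrightarrow> d a b \<le> \<rho>"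
  shows "measure lborel A * measure lborel B * \<bar>avg A u - avg B u\<bar> powr p
    \<le> \<rho> powr (real DIM('a) + p * s) * energy p u"
proof -
  have [measurable]: "u \<in> borel_measurable borel" "A \<in> sets borel" using W_D(1)[OF u] A by auto
  note le = nn_integral_local_energy[OF u]
  have [measurable]: "local_energy p u \<in> borel_measurable borel" by (rule le(1))
  have "ennreal (measure lborel B) * ennreal (measure lborel A * \<bar>avg B u - avg A u\<bar> powr p)
    \<le> ennreal (measure lborel B) * (\<integral>\<^sup>+y. indicator A y * ennreal (\<bar>avg B u - u y\<bar> powr p) \<partial>lborel)"
    by (intro mult_left_mono avg_powr_le[OF p u A]) simp
  also have "\<dots> = (\<integral>\<^sup>+y. ennreal (measure lborel B) * (indicator A y * ennreal (\<bar>avg B u - u y\<bar> powr p)) \<partial>lborel)"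
    by (rule nn_integral_cmult[symmetric]) measurable
  also have "\<dots> \<le> (\<integral>\<^sup>+y. ennreal (\<rho> powr (real DIM('a) + p * s)) * local_energy p u y \<partial>lborel)"
  proof (rule nn_integral_mono)
    fix y
    show "ennreal (measure lborel B) * (indicator A y * ennreal (\<bar>avg B u - u y\<bar> powr p))
      \<le> ennreal (\<rho> powr (real DIM('a) + p * s)) * local_energy p u y"
    proof (cases "y \<in> A")
      case True
      have "ennreal (measure lborel B * \<bar>u y - avg B u\<bar> powr p)
        \<le> ennreal (\<rho> powr (real DIM('a) + p * s)) * local_energy p u y"
        by (rule point_avg_le[OF p u _ B]) (use True A(2) \<rho> in auto)
      then show ?thesis using True by (simp add: abs_minus_commute ennreal_mult)
    qed simp
  qed
  also have "\<dots> = ennreal (\<rho> powr (real DIM('a) + p * s)) * ennreal (energy p u)"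
    by (subst nn_integral_cmult) (simp_all add: le)
  finally have "ennreal (measure lborel B * (measure lborel A * \<bar>avg B u - avg A u\<bar> powr p))
      \<le> ennreal (\<rho> powr (real DIM('a) + p * s) * energy p u)"
    by (simp add: ennreal_mult pint_nonneg)
  then show ?thesis
    by (subst (asm) ennreal_le_iff) (simp_all add: pint_nonneg abs_minus_commute mult_ac)
qed

end

section \<open>Chaining of cell averages\<close>

locale dense_setting = nonlocal_setting U d s C
  for U :: "'a::euclidean_space set" and d :: "'a \<Rightarrow> 'a \<Rightarrow> real" and s C :: real +
  fixes \<kappa> r0 :: real
  assumes \<kappa>0: "0 < \<kappa>" and \<kappa>1: "\<kappa> \<le> 1" and r0: "0 < r0" and r01: "r0 \<le> 1"
    and density: "\<And>x r. x \<in> closure U \<Longrightarrow> 0 < r \<Longrightarrow> r \<le> r0 \<Longrightarrow> \<kappa> * r ^ DIM('a) \<le> measure lborel (U \<inter> ball x r)"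
begin

definition cell :: "'a \<Rightarrow> real \<Rightarrow> 'a set" where "cell x r = U \<inter> ball x r"

lemma cell_sets: "cell x r \<in> sets borel" "cell x r \<subseteq> U"
  using U_open by (auto simp: cell_def)

lemma cell_measure:
  assumes "x \<in> closure U" "0 < r" "r \<le> r0"
  shows "\<kappa> * r ^ DIM('a) \<le> measure lborel (cell x r)" "0 < measure lborel (cell x r)"
proof -
  show "\<kappa> * r ^ DIM('a) \<le> measure lborel (cell x r)" using density[OF assms] by (simp add: cell_def)
  moreover have "0 < \<kappa> * r ^ DIM('a)" using \<kappa>0 assms by simp
  ultimately show "0 < measure lborel (cell x r)" by linarith
qed

definition rad :: "nat \<Rightarrow> real" where "rad k = r0 / 2 ^ k"

lemma rad: "0 < rad k" "rad k \<le> r0" "rad k \<le> 1" "rad (Suc k) = rad k / 2"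
proof -
  show "0 < rad k" using r0 by (simp add: rad_def)
  show "rad k \<le> r0" using r0 by (simp add: rad_def divide_le_eq)
  then show "rad k \<le> 1" using r01 by linarith
  show "rad (Suc k) = rad k / 2" by (simp add: rad_def)
qed

lemma rad_tendsto: "rad \<longlonglongrightarrow> 0"
proof -
  have "(\<lambda>k. r0 * (1/2) ^ k) \<longlonglongrightarrow> r0 * 0" by (intro tendsto_intros LIMSEQ_power_zero) simp
  then show ?thesis by (simp add: rad_def[abs_def] power_one_over)
qed

text \<open>The first factor comes from the distance \<open>3 * C * t\<close> between points of two
  neighbouring cells, the second from their volumes, each at least
  \<open>\<kappa> * (t / 2) ^ DIM('a)\<close>.\<close>

definition cK :: real where "cK = (3 * C) powr (real DIM('a) + 1) * (4 ^ DIM('a) / \<kappa>\<^sup>2)"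

lemma cK_pos: "cK > 0"
  using C1 \<kappa>0 by (simp add: cK_def)

text \<open>The constant does not depend on \<open>p\<close>; \<open>p \<ge> 2 n / s\<close> makes the exponent \<open>s - n / p\<close> at
  least \<open>s / 2\<close>.\<close>
lemma avg_cell_diff:
  assumes p: "1 < p" "2 * real DIM('a) \<le> p * s" and u: "u \<in> W p"
    and F: "0 \<le> F" "energy p u \<le> F powr p"
    and xy: "x \<in> closure U" "y \<in> closure U" "norm (x - y) \<le> t"
    and t: "0 < t" "t \<le> r0" and r: "t / 2 \<le> r" "r \<le> t" "t / 2 \<le> r'" "r' \<le> t"
  shows "\<bar>avg (cell x r) u - avg (cell y r') u\<bar> \<le> F * cK * t powr (s / 2)"
proof -
  define n where "n = real DIM('a)"
  define q where "q = n + p * s"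
  define m where "m = \<bar>avg (cell x r) u - avg (cell y r') u\<bar>"
  have rp: "0 < r" "r \<le> r0" "0 < r'" "r' \<le> r0" using t r by auto
  have t1: "t \<le> 1" using t r01 by linarith
  have cx: "\<kappa> * (t / 2) ^ DIM('a) \<le> measure lborel (cell x r)"
  proof -
    have "\<kappa> * (t / 2) ^ DIM('a) \<le> \<kappa> * r ^ DIM('a)" using \<kappa>0 t r by (intro mult_left_mono power_mono) auto
    also have "\<dots> \<le> measure lborel (cell x r)" by (rule cell_measure(1)[OF xy(1) rp(1,2)])
    finally show ?thesis .
  qed
  have cy: "\<kappa> * (t / 2) ^ DIM('a) \<le> measure lborel (cell y r')"
  proof -
    have "\<kappa> * (t / 2) ^ DIM('a) \<le> \<kappa> * r' ^ DIM('a)" using \<kappa>0 t r by (intro mult_left_mono power_mono) auto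
    also have "\<dots> \<le> measure lborel (cell y r')" by (rule cell_measure(1)[OF xy(2) rp(3,4)])
    finally show ?thesis .
  qed
  have dist: "d a b \<le> 3 * C * t" if "a \<in> cell x r" "b \<in> cell y r'" for a b
  proof -
    have "dist a b \<le> dist a x + dist x y + dist y b"
      by (rule order_trans[OF dist_triangle[of a b x]]) (use dist_triangle[of x b y] in simp)
    also have "\<dots> \<le> 3 * t"
      using that xy(3) r by (simp add: cell_def dist_commute dist_norm[of x y])
    finally have "C * norm (a - b) \<le> C * (3 * t)" using C1 by (intro mult_left_mono) (auto simp: dist_norm)
    then show ?thesis using d_upper[of a b] by simp
  qed
  have "(\<kappa> * (t / 2) ^ DIM('a)) * (\<kappa> * (t / 2) ^ DIM('a)) * m powr p
      \<le> measure lborel (cell x r) * measure lborel (cell y r') * m powr p"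
    using cx cy \<kappa>0 t by (intro mult_right_mono mult_mono) auto
  also have "\<dots> \<le> (3 * C * t) powr q * energy p u"
    unfolding m_def q_def n_def
    by (rule avg_diff_le[OF p(1) u cell_sets cell_measure(2)[OF xy(1) rp(1,2)] cell_sets cell_measure(2)[OF xy(2) rp(3,4)] dist])
  also have "\<dots> \<le> (3 * C * t) powr q * F powr p" using F by (intro mult_left_mono) auto
  finally have 1: "(\<kappa> * (t / 2) ^ DIM('a)) * (\<kappa> * (t / 2) ^ DIM('a)) * m powr p \<le> (3 * C * t) powr q * F powr p" .
  have "(\<kappa> * (t / 2) ^ DIM('a)) * (\<kappa> * (t / 2) ^ DIM('a)) = \<kappa>\<^sup>2 / 4 ^ DIM('a) * t powr (2 * n)"
  proof -
    have "t powr (2 * n) = t ^ DIM('a) * t ^ DIM('a)"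
      using t by (simp add: n_def powr_realpow[symmetric] powr_add[symmetric])
    moreover have "(4::real) ^ DIM('a) = 2 ^ DIM('a) * 2 ^ DIM('a)" by (simp flip: power_mult_distrib)
    ultimately show ?thesis by (simp add: power_divide power2_eq_square)
  qed
  with 1 have "\<kappa>\<^sup>2 / 4 ^ DIM('a) * t powr (2 * n) * m powr p \<le> (3 * C * t) powr q * F powr p" by simp
  then have "m powr p \<le> (3 * C * t) powr q * F powr p / (\<kappa>\<^sup>2 / 4 ^ DIM('a) * t powr (2 * n))"
  proof -
    have "0 < \<kappa>\<^sup>2 / 4 ^ DIM('a) * t powr (2 * n)" using \<kappa>0 t by simp
    then show ?thesis
      using \<open>\<kappa>\<^sup>2 / 4 ^ DIM('a) * t powr (2 * n) * m powr p \<le> (3 * C * t) powr q * F powr p\<close>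
      by (simp only: pos_le_divide_eq mult.commute)
  qed
  also have "\<dots> = F powr p * ((3 * C) powr q * (4 ^ DIM('a) / \<kappa>\<^sup>2) * (t powr q / t powr (2 * n)))"
    using C1 t by (simp add: powr_mult mult_ac)
  also have "t powr q / t powr (2 * n) = t powr (p * s - n)"
    unfolding powr_diff[symmetric] by (simp add: q_def)
  \<comment> \<open>Every factor is enlarged to a \<open>p\<close>-th power so that the root is free
    of \<open>p\<close>: \<open>q \<le> (n + 1) * p\<close> as \<open>s < 1\<close>, the volume
    constant is at least 1, and \<open>t \<le> 1\<close> lets the exponent drop to
    \<open>p * s / 2\<close>.\<close>
  also have "F powr p * ((3 * C) powr q * (4 ^ DIM('a) / \<kappa>\<^sup>2) * t powr (p * s - n))
      \<le> F powr p * ((3 * C) powr ((n + 1) * p) * (4 ^ DIM('a) / \<kappa>\<^sup>2) powr p * t powr (s / 2 * p))"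
  proof (intro mult_left_mono mult_mono)
    have "q \<le> (n + 1) * p"
    proof -
      have "n \<le> n * p" using p by (simp add: n_def)
      moreover have "p * s \<le> p" using p s1 by simp
      ultimately show ?thesis by (simp add: q_def algebra_simps)
    qed
    then show "(3 * C) powr q \<le> (3 * C) powr ((n + 1) * p)" using C1 by (intro powr_mono) auto
    have "\<kappa>\<^sup>2 \<le> 1" using \<kappa>0 \<kappa>1 by (simp add: power_le_one)
    then have "1 \<le> 4 ^ DIM('a) / \<kappa>\<^sup>2"
      using \<kappa>0 by (simp add: le_divide_eq) (meson one_le_numeral one_le_power order_trans)
    then have "(4 ^ DIM('a) / \<kappa>\<^sup>2) powr 1 \<le> (4 ^ DIM('a) / \<kappa>\<^sup>2) powr p" using p by (intro powr_mono) auto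
    then show "4 ^ DIM('a) / \<kappa>\<^sup>2 \<le> (4 ^ DIM('a) / \<kappa>\<^sup>2) powr p" using \<kappa>0 by simp
    show "t powr (p * s - n) \<le> t powr (s / 2 * p)"
      using t t1 p(2) by (intro powr_mono') (auto simp: n_def mult.commute)
  qed simp_all
  also have "\<dots> = (F * cK * t powr (s / 2)) powr p"
  proof -
    have "(F * (A * Q) * T) powr p = F powr p * (A powr p * Q powr p * T powr p)"
      if "0 \<le> A" "0 \<le> Q" "0 \<le> T" for A Q T using that F(1) by (simp add: powr_mult)
    from this[of "(3 * C) powr (n + 1)" "4 ^ DIM('a) / \<kappa>\<^sup>2" "t powr (s / 2)"] show ?thesis
      unfolding cK_def n_def powr_powr by simp
  qed
  finally have "m powr p \<le> (F * cK * t powr (s / 2)) powr p" .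
  then have "m \<le> F * cK * t powr (s / 2)"
    using powr_less_mono2[of p "F * cK * t powr (s / 2)" m] F(1) cK_pos p(1) by fastforce
  then show ?thesis by (simp add: m_def)
qed

text \<open>The ratio of successive chaining bounds when the radius is halved; \<open>cM\<close> is
  the sum of the resulting series.\<close>

definition gam :: real where "gam = (1/2) powr (s / 2)"
definition cM :: real where "cM = cK / (1 - gam)"

lemma gam: "0 < gam" "gam < 1"
  using s0 powr_less_mono2[of "s / 2" "1/2" 1] by (auto simp: gam_def)

lemma cM: "0 < cM" "cK \<le> cM"
proof -
  show "0 < cM" using cK_pos gam by (simp add: cM_def)
  show "cK \<le> cM" using cK_pos gam unfolding cM_def by (simp add: le_divide_eq algebra_simps)
qed

lemma rad_powr: "rad k powr (s / 2) = r0 powr (s / 2) * gam ^ k"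
proof -
  have "rad k = r0 * (1/2) powr real k" using r0 by (simp add: rad_def powr_realpow power_one_over)
  then have "rad k powr (s / 2) = r0 powr (s / 2) * ((1/2) powr real k) powr (s / 2)"
    using r0 by (simp add: powr_mult)
  also have "((1/2::real) powr real k) powr (s / 2) = gam powr real k"
    by (simp add: gam_def powr_powr mult.commute)
  finally show ?thesis using gam by (simp add: powr_realpow)
qed

lemma rad_powr_tendsto: "(\<lambda>k. c * rad k powr (s / 2)) \<longlonglongrightarrow> 0"
proof -
  have "(\<lambda>k. c * (r0 powr (s / 2) * gam ^ k)) \<longlonglongrightarrow> c * (r0 powr (s / 2) * 0)"
    using gam by (intro tendsto_intros LIMSEQ_power_zero) simp
  then show ?thesis by (simp add: rad_powr)
qed

text \<open>Cell averages converge geometrically at every point of the closure. For the modulus, two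
  values are compared through averages at the scale of their distance: two chaining errors and one
  difference make the factor 3. At a point of \<open>U\<close> with finite local energy the averages
  approach \<open>u x\<close> at a rate, so no differentiation theorem is involved.\<close>

lemma continuous_representative:
  assumes p: "1 < p" "2 * real DIM('a) \<le> p * s" and u: "u \<in> W p"
    and F: "0 \<le> F" "energy p u \<le> F powr p"
  obtains w where "AE x in muU. u x = w x"
    "\<And>x k. x \<in> closure U \<Longrightarrow> \<bar>w x - avg (cell x (rad k)) u\<bar> \<le> F * cM * rad k powr (s / 2)"
    "\<And>x y k. x \<in> closure U \<Longrightarrow> y \<in> closure U \<Longrightarrow> norm (x - y) \<le> rad k \<Longrightarrow>
      \<bar>w x - w y\<bar> \<le> 3 * F * cM * rad k powr (s / 2)"
proof -
  define m where "m x k = avg (cell x (rad k)) u" for x k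
  have step: "\<bar>m x k - m x (Suc k)\<bar> \<le> (F * cK * r0 powr (s / 2)) * gam ^ k" if x: "x \<in> closure U" for x k
  proof -
    have "\<bar>m x k - m x (Suc k)\<bar> \<le> F * cK * rad k powr (s / 2)"
      unfolding m_def by (rule avg_cell_diff[OF p u F x x]) (use rad[of k] rad[of "Suc k"] in auto)
    then show ?thesis by (simp add: rad_powr mult_ac)
  qed
  have "\<exists>L. x \<in> closure U \<longrightarrow> m x \<longlonglongrightarrow> L \<and> (\<forall>k. \<bar>L - m x k\<bar> \<le> (F * cK * r0 powr (s / 2)) * gam ^ k / (1 - gam))" for x
  proof (cases "x \<in> closure U")
    case True
    show ?thesis
      by (rule geometric_steps_limit[OF step[OF True] less_imp_le[OF gam(1)] gam(2)]) blast
  qed simp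
  then obtain w where "\<forall>x. x \<in> closure U \<longrightarrow> m x \<longlonglongrightarrow> w x \<and> (\<forall>k. \<bar>w x - m x k\<bar> \<le> (F * cK * r0 powr (s / 2)) * gam ^ k / (1 - gam))"
    by metis
  then have lim: "m x \<longlonglongrightarrow> w x" and wm': "\<bar>w x - m x k\<bar> \<le> (F * cK * r0 powr (s / 2)) * gam ^ k / (1 - gam)"
    if "x \<in> closure U" for x k using that by auto
  have wm: "\<bar>w x - m x k\<bar> \<le> F * cM * rad k powr (s / 2)" if "x \<in> closure U" for x k
    using wm'[OF that, of k] by (simp add: rad_powr cM_def mult_ac)
  show ?thesis
  proof (rule that)
    show "\<bar>w x - avg (cell x (rad k)) u\<bar> \<le> F * cM * rad k powr (s / 2)" if "x \<in> closure U" for x k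
      using wm[OF that] by (simp add: m_def)
    show "\<bar>w x - w y\<bar> \<le> 3 * F * cM * rad k powr (s / 2)"
      if xy: "x \<in> closure U" "y \<in> closure U" "norm (x - y) \<le> rad k" for x y k
    proof -
      have "\<bar>m x k - m y k\<bar> \<le> F * cK * rad k powr (s / 2)"
        unfolding m_def by (rule avg_cell_diff[OF p u F xy]) (use rad[of k] in auto)
      also have "\<dots> \<le> F * cM * rad k powr (s / 2)"
        using F cM by (intro mult_right_mono mult_left_mono) auto
      finally show ?thesis using wm[OF xy(1), of k] wm[OF xy(2), of k] by linarith
    qed
    have "AE x in lborel. local_energy p u x \<noteq> \<infinity>"
      by (rule nn_integral_noteq_infinite) (use nn_integral_local_energy[OF u] in auto)
    then show "AE x in muU. u x = w x"
      unfolding AE_muU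
    proof eventually_elim
      case (elim x)
      show ?case
      proof
        assume x: "x \<in> U"
        then have xc: "x \<in> closure U" using closure_subset by blast
        define J where "J = enn2real (local_energy p u x)"
        have J: "local_energy p u x = ennreal J" "J \<ge> 0"
          using elim by (auto simp: J_def top.not_eq_extremum)
        define B where "B = C powr (real DIM('a) + p * s) * J / \<kappa>"
        have bd: "\<bar>u x - m x k\<bar> powr p \<le> B * rad k powr (p * s)" for k
        proof -
          note cm = cell_measure[OF xc rad(1,2)[of k]]
          have "ennreal (measure lborel (cell x (rad k)) * \<bar>u x - m x k\<bar> powr p)
              \<le> ennreal ((C * rad k) powr (real DIM('a) + p * s)) * local_energy p u x"
            unfolding m_def
          proof (rule point_avg_le[OF p(1) u x cell_sets cm(2)])
            fix b assume "b \<in> cell x (rad k)"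
            then have "norm (x - b) \<le> rad k" by (simp add: cell_def dist_norm)
            then have "C * norm (x - b) \<le> C * rad k" using C1 by (intro mult_left_mono) auto
            then show "d x b \<le> C * rad k" using d_upper[of x b] by linarith
          qed
          also have "\<dots> = ennreal ((C * rad k) powr (real DIM('a) + p * s) * J)" by (simp add: J ennreal_mult)
          finally have "measure lborel (cell x (rad k)) * \<bar>u x - m x k\<bar> powr p \<le> (C * rad k) powr (real DIM('a) + p * s) * J"
            by (subst (asm) ennreal_le_iff) (use J in simp_all)
          then have "\<kappa> * rad k ^ DIM('a) * \<bar>u x - m x k\<bar> powr p \<le> (C * rad k) powr (real DIM('a) + p * s) * J"
            using cm(1) by (meson mult_right_mono order_trans powr_ge_zero)
          also have "(C * rad k) powr (real DIM('a) + p * s)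
              = rad k ^ DIM('a) * (C powr (real DIM('a) + p * s) * rad k powr (p * s))"
          proof -
            have "(C * rad k) powr (real DIM('a) + p * s) = C powr (real DIM('a) + p * s) * rad k powr (real DIM('a) + p * s)"
              using C1 rad(1)[of k] by (simp add: powr_mult)
            also have "rad k powr (real DIM('a) + p * s) = rad k powr real DIM('a) * rad k powr (p * s)" by (rule powr_add)
            also have "rad k powr real DIM('a) = rad k ^ DIM('a)" using rad(1)[of k] by (simp add: powr_realpow)
            finally show ?thesis by simp
          qed
          finally have "rad k ^ DIM('a) * (\<kappa> * \<bar>u x - m x k\<bar> powr p)
              \<le> rad k ^ DIM('a) * (C powr (real DIM('a) + p * s) * rad k powr (p * s) * J)"
            by (simp add: mult_ac)
          then have "\<kappa> * \<bar>u x - m x k\<bar> powr p \<le> C powr (real DIM('a) + p * s) * rad k powr (p * s) * J"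
            using rad(1)[of k] by (subst (asm) mult_le_cancel_left_pos) simp_all
          then show ?thesis using \<kappa>0 by (simp add: B_def pos_le_divide_eq mult_ac)
        qed
        have ps: "p * s > 0" using p s0 by simp
        have l1: "(\<lambda>k. B * rad k powr (p * s)) \<longlonglongrightarrow> B * 0"
          using ps rad(1) by (intro tendsto_intros tendsto_zero_powrI[OF rad_tendsto tendsto_const]) (auto intro: always_eventually less_imp_le)
        have l2: "(\<lambda>k. \<bar>u x - m x k\<bar> powr p) \<longlonglongrightarrow> \<bar>u x - w x\<bar> powr p"
          using p by (intro tendsto_powr' tendsto_rabs tendsto_diff lim[OF xc] tendsto_const) auto
        have "\<bar>u x - w x\<bar> powr p \<le> B * 0"
          by (rule LIMSEQ_le[OF l2 l1]) (use bd in blast)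
        then show "u x = w x" using powr_ge_zero[of "\<bar>u x - w x\<bar>" p] by simp
      qed
    qed
  qed
qed

end

section \<open>The limit of large exponents\<close>

lemma eventually_powr_gt:
  fixes q :: "nat \<Rightarrow> real"
  assumes "filterlim q at_top sequentially" "1 < b"
  shows "\<forall>\<^sub>F j in sequentially. M < b powr q j"
proof -
  have "\<forall>\<^sub>F j in sequentially. log b (max M 1) < q j"
    using assms(1) by (simp add: filterlim_at_top_dense)
  then show ?thesis
  proof eventually_elim
    case (elim j)
    have "max M 1 = b powr log b (max M 1)" using assms(2) by (subst powr_log_cancel) auto
    also have "\<dots> < b powr q j" using elim assms(2) by (intro powr_less_mono) auto
    finally show ?case by simp
  qed
qed

context nonlocal_setting
begin

lemma U_ball_measure_pos: "x \<in> closure U \<Longrightarrow> 0 < \<delta> \<Longrightarrow> 0 < measure lborel (U \<inter> ball x \<delta>)"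
  by (rule measure_open_inter_pos) auto

lemma set_muU_lower_AE:
  assumes f: "f \<in> Lp p muU" and A: "A \<in> sets borel" "A \<subseteq> U" and p: "0 < p"
    and h: "0 \<le> h" "AE x in muU. x \<in> A \<longrightarrow> h \<le> \<bar>f x\<bar>"
  shows "h powr p * measure lborel A \<le> norm_pow p f"
proof -
  define f' where "f' x = (if x \<in> A \<and> \<bar>f x\<bar> < h then h else f x)" for x
  have [measurable]: "f \<in> borel_measurable borel" "A \<in> sets borel" using Lp_measurable[OF f] A by auto
  have eq: "AE x in muU. f' x = f x" using h(2) by eventually_elim (auto simp: f'_def)
  have m: "f' \<in> borel_measurable borel" unfolding f'_def[abs_def] by measurable
  have "f' \<in> Lp p muU" using norm_pow_cong_AE(2)[OF m _ eq] f Lp_measurable[OF f] by simp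
  then have "h powr p * measure lborel A \<le> norm_pow p f'"
    by (rule set_muU_lower[OF _ A p h(1)]) (auto simp: f'_def)
  also have "\<dots> = norm_pow p f" using norm_pow_cong_AE(1)[OF m _ eq] Lp_measurable[OF f] by simp
  finally show ?thesis .
qed

subsection \<open>Properties of uniform limits of normalized balanced functions\<close>

lemma continuous_on_closure_ball:
  fixes g :: "'a \<Rightarrow> real"
  assumes "continuous_on (closure U) g" "x \<in> closure U" "e > 0"
  obtains \<delta> where "\<delta> > 0" "\<And>y. y \<in> U \<inter> ball x \<delta> \<Longrightarrow> \<bar>g y - g x\<bar> < e"
proof -
  obtain \<delta> where "\<delta> > 0" "\<forall>y\<in>closure U. dist y x < \<delta> \<longrightarrow> dist (g y) (g x) < e"
    using assms unfolding continuous_on_iff by blast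
  then show ?thesis
    using that[of \<delta>] closure_subset[of U] by (auto simp: dist_real_def dist_commute)
qed

lemma uniform_limit_AE:
  fixes u w :: "nat \<Rightarrow> 'a \<Rightarrow> real"
  assumes "uniform_limit (closure U) w g sequentially" "\<And>j. AE x in muU. u j x = w j x" "e > 0"
  shows "\<forall>\<^sub>F j in sequentially. AE x in muU. x \<in> U \<and> \<bar>u j x - g x\<bar> < e"
proof -
  have "\<forall>\<^sub>F j in sequentially. \<forall>x\<in>closure U. dist (w j x) (g x) < e"
    using assms(1,3) by (rule uniform_limitD)
  then show ?thesis
  proof eventually_elim
    case (elim j)
    have "AE x in muU. x \<in> U" by (simp add: AE_muU)
    with assms(2)[of j] show ?case
    proof eventually_elim
      case (elim x)
      then show ?case
        using \<open>\<forall>x\<in>closure U. dist (w j x) (g x) < e\<close> closure_subset[of U] by (auto simp: dist_real_def)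
    qed
  qed
qed

context
  fixes q :: "nat \<Rightarrow> real" and u :: "nat \<Rightarrow> 'a \<Rightarrow> real" and g :: "'a \<Rightarrow> real"
  assumes q: "filterlim q at_top sequentially" "\<And>j. 1 < q j"
    and u: "\<And>j. u j \<in> W (q j)" "\<And>j. norm_pow (q j) (u j) = 1" "\<And>j. balanced (q j) (u j)"
    and lim: "\<forall>e>0. \<forall>\<^sub>F j in sequentially. AE x in muU. x \<in> U \<and> \<bar>u j x - g x\<bar> < e"
    and g: "continuous_on (closure U) g"
begin

text \<open>A value above 1 would persist with margin \<open>e\<close> on a set of positive measure
  \<open>\<mu>\<close>, and \<open>(1 + e) powr q j * \<mu>\<close> outgrows the norm 1.\<close>

lemma limit_le_one:
  assumes x: "x \<in> closure U"
  shows "\<bar>g x\<bar> \<le> 1"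
proof (rule ccontr)
  assume neg: "\<not> \<bar>g x\<bar> \<le> 1"
  define e where "e = (\<bar>g x\<bar> - 1) / 3"
  have e: "e > 0" using neg by (simp add: e_def)
  have "3 * e = \<bar>g x\<bar> - 1" by (simp add: e_def)
  then have gx: "\<bar>g x\<bar> = 1 + 3 * e" by linarith
  obtain \<delta> where \<delta>: "\<delta> > 0" "\<And>y. y \<in> U \<inter> ball x \<delta> \<Longrightarrow> \<bar>g y - g x\<bar> < e"
    using continuous_on_closure_ball[OF g x e] by blast
  define \<mu> where "\<mu> = measure lborel (U \<inter> ball x \<delta>)"
  have \<mu>: "\<mu> > 0" unfolding \<mu>_def by (rule U_ball_measure_pos[OF x \<delta>(1)])
  have "\<forall>\<^sub>F j in sequentially. 1 / \<mu> < (1 + e) powr q j"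
    by (rule eventually_powr_gt[OF q(1)]) (use e in simp)
  then have "\<forall>\<^sub>F j in sequentially. False"
    using lim[rule_format, OF e]
  proof eventually_elim
    case (elim j)
    have "(1 + e) powr q j * measure lborel (U \<inter> ball x \<delta>) \<le> norm_pow (q j) (u j)"
    proof (rule set_muU_lower_AE[OF W_D(2)[OF u(1)]])
      show "AE y in muU. y \<in> U \<inter> ball x \<delta> \<longrightarrow> 1 + e \<le> \<bar>u j y\<bar>"
        using elim(2)
      proof eventually_elim
        case (elim y)
        show ?case
        proof
          assume "y \<in> U \<inter> ball x \<delta>"
          from \<delta>(2)[OF this] conjunct2[OF elim] show "1 + e \<le> \<bar>u j y\<bar>" using gx by linarith
        qed
      qed
    qed (use U_open e q(2)[of j] in auto)
    then have "(1 + e) powr q j * \<mu> \<le> 1" using u(2)[of j] by (simp add: \<mu>_def)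
    then show False using elim(1) \<mu> by (simp add: field_simps)
  qed
  then show False by simp
qed

text \<open>Otherwise the functions stay below \<open>1 - \<eta> / 2\<close> for large
  \<open>j\<close>, and their norm powers tend to 0.\<close>

lemma limit_norm_ge:
  assumes \<eta>: "0 < \<eta>" "\<eta> < 1"
  shows "\<exists>x\<in>U. 1 - \<eta> < \<bar>g x\<bar>"
proof (rule ccontr)
  assume neg: "\<not> ?thesis"
  define e where "e = \<eta> / 2"
  have e: "0 < e" "e < 1" using \<eta> by (auto simp: e_def)
  have "\<forall>\<^sub>F j in sequentially. volU < (1 / (1 - e)) powr q j"
    by (rule eventually_powr_gt[OF q(1)]) (use e in simp)
  then have "\<forall>\<^sub>F j in sequentially. False"
    using lim[rule_format, OF e(1)]
  proof eventually_elim
    case (elim j)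
    have "norm_pow (q j) (u j) \<le> norm_pow (q j) (\<lambda>x. 1 - e)"
      unfolding pint_def
    proof (rule integral_mono_AE)
      show "AE x in muU. \<bar>u j x\<bar> powr q j \<le> \<bar>1 - e\<bar> powr q j"
        using elim(2)
      proof eventually_elim
        case (elim x)
        then have "\<bar>g x\<bar> \<le> 1 - \<eta>" using neg by (auto simp: not_less)
        moreover have "\<eta> = 2 * e" by (simp add: e_def)
        ultimately have "\<bar>u j x\<bar> \<le> \<bar>1 - e\<bar>" using conjunct2[OF elim] by linarith
        then show ?case using q(2)[of j] by (intro powr_mono2) auto
      qed
    qed (use Lp_integrable[OF W_D(2)[OF u(1)]] Lp_integrable[OF Lp_const_muU] in auto)
    then have "1 \<le> (1 - e) powr q j * volU" using u(2)[of j] e by (simp add: norm_pow_const)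
    moreover have "volU * (1 - e) powr q j < 1"
    proof -
      have "volU < 1 / (1 - e) powr q j" using elim(1) e by (simp add: powr_divide)
      then show ?thesis using e by (simp add: pos_less_divide_eq)
    qed
    ultimately show False by (simp add: mult.commute)
  qed
  then show False by simp
qed

text \<open>In the balance condition the larger amplitude wins: near \<open>x0\<close> the positive
  part contributes at least \<open>a powr (q j - 1) * \<mu>\<close>, while values above
  \<open>- b\<close> can cancel at most \<open>b powr (q j - 1) * volU\<close>.\<close>

lemma limit_sign_change:
  assumes x0: "x0 \<in> U" "h < g x0" and h: "0 \<le> h'" "h' < h"
  shows "\<exists>x\<in>U. g x < - h'"
proof (rule ccontr)
  assume neg: "\<not> ?thesis"
  define e where "e = (h - h') / 4"
  have e: "e > 0" using h by (simp add: e_def)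
  \<comment> \<open>A quarter of the gap is given up at either end for the uniform error, so
    \<open>b < a\<close> remains.\<close>
  define a b where "a = h - e" and "b = h' + e"
  have "h - h' = 4 * e" by (simp add: e_def)
  then have ab: "0 < b" "b < a" using h e unfolding a_def b_def by linarith+
  have xc: "x0 \<in> closure U" using x0 closure_subset by blast
  obtain \<delta> where \<delta>: "\<delta> > 0" "\<And>y. y \<in> U \<inter> ball x0 \<delta> \<Longrightarrow> \<bar>g y - g x0\<bar> < g x0 - h"
    using continuous_on_closure_ball[OF g xc, of "g x0 - h"] x0 by auto
  define A where "A = U \<inter> ball x0 \<delta>"
  have A: "A \<in> sets borel" "A \<subseteq> U" using U_open by (auto simp: A_def)
  define \<mu> where "\<mu> = measure lborel A"
  have \<mu>: "\<mu> > 0" unfolding \<mu>_def A_def by (rule U_ball_measure_pos[OF xc \<delta>(1)])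
  have eA: "emeasure muU A = emeasure lborel A"
    unfolding muU_def using A by (subst emeasure_density) (auto simp: indicator_inter_arith[symmetric] Int_absorb1)
  have intA: "integrable muU (indicator A :: 'a \<Rightarrow> real)"
    using A finite_measure.emeasure_finite[OF finite_measure_muU, of A]
    by (intro integrable_real_indicator) (auto simp: top.not_eq_extremum)
  have "filterlim (\<lambda>j. - 1 + q j) at_top sequentially"
    by (rule filterlim_tendsto_add_at_top[OF tendsto_const q(1)])
  then have q1: "filterlim (\<lambda>j. q j - 1) at_top sequentially" by simp
  have "\<forall>\<^sub>F j in sequentially. volU / \<mu> < (a / b) powr (q j - 1)"
    by (rule eventually_powr_gt[OF q1]) (use ab in simp)
  then have "\<forall>\<^sub>F j in sequentially. False"
    using lim[rule_format, OF e]
  proof eventually_elim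
    case (elim j)
    have int: "integrable muU (\<lambda>x. sgn_pow (q j) (u j x))"
      using integrable_sgn_pow_mult[OF q(2) W_D(2)[OF u(1)] Lp_const_muU[of 1]] by simp
    have "(LINT x|muU. a powr (q j - 1) * indicator A x - b powr (q j - 1)) \<le> (LINT x|muU. sgn_pow (q j) (u j x))"
    proof (rule integral_mono_AE)
      show "integrable muU (\<lambda>x. a powr (q j - 1) * indicator A x - b powr (q j - 1))"
        using intA finite_measure.integrable_const[OF finite_measure_muU]
        by (intro Bochner_Integration.integrable_diff integrable_mult_right) auto
      show "AE x in muU. a powr (q j - 1) * indicator A x - b powr (q j - 1) \<le> sgn_pow (q j) (u j x)"
        using elim(2)
      proof eventually_elim
        case (elim x)
        have lo: "- b \<le> u j x" using neg elim by (auto simp: b_def not_less)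
        have up: "a \<le> u j x" if "x \<in> A"
          using \<delta>(2)[of x] that elim by (auto simp: A_def a_def)
        show ?case
        proof (cases "x \<in> A")
          case True
          have "a powr (q j - 1) \<le> max (u j x) 0 powr (q j - 1)"
            using up[OF True] ab q(2)[of j] by (intro powr_mono2) auto
          moreover have "max (- u j x) 0 = 0" using up[OF True] ab by auto
          ultimately show ?thesis using True unfolding sgn_pow_pos_part by simp (smt (verit) powr_ge_zero)
        next
          case False
          have "max (- u j x) 0 powr (q j - 1) \<le> b powr (q j - 1)"
            using lo ab q(2)[of j] by (intro powr_mono2) auto
          then show ?thesis using False unfolding sgn_pow_pos_part by simp (smt (verit) powr_ge_zero)
        qed
      qed
    qed (rule int)
    also have "\<dots> = 0" using u(3)[of j] by (simp add: balanced_def)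
    also have "(LINT x|muU. a powr (q j - 1) * indicator A x - b powr (q j - 1)) = a powr (q j - 1) * \<mu> - b powr (q j - 1) * volU"
    proof -
      have "measure muU A = \<mu>" using eA by (simp add: measure_def \<mu>_def)
      then show ?thesis
        using intA finite_measure.integrable_const[OF finite_measure_muU] A
        by (subst Bochner_Integration.integral_diff) (auto simp: measure_muU)
    qed
    finally have le: "a powr (q j - 1) * \<mu> \<le> b powr (q j - 1) * volU" by simp
    have "(a / b) powr (q j - 1) = a powr (q j - 1) / b powr (q j - 1)"
      using ab by (simp add: powr_divide)
    also have "\<dots> \<le> volU / \<mu>"
      using ab \<mu> le by (simp add: pos_divide_le_eq pos_le_divide_eq mult_ac)
    finally show False using elim(1) by simp
  qed
  then show False by simp
qed

end

text \<open>Some value comes close to 1 in modulus, and balance forces the opposite sign to be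
  reached almost as far; passing to \<open>- g\<close> treats a negative value.\<close>

lemma limit_sup_inf:
  fixes q :: "nat \<Rightarrow> real" and u :: "nat \<Rightarrow> 'a \<Rightarrow> real" and g :: "'a \<Rightarrow> real"
  assumes q: "filterlim q at_top sequentially" "\<And>j. 1 < q j"
    and u: "\<And>j. u j \<in> W (q j)" "\<And>j. norm_pow (q j) (u j) = 1" "\<And>j. balanced (q j) (u j)"
    and lim: "\<forall>e>0. \<forall>\<^sub>F j in sequentially. AE x in muU. x \<in> U \<and> \<bar>u j x - g x\<bar> < e"
    and g: "continuous_on (closure U) g"
  shows "(SUP x\<in>U. g x) = 1" "(INF x\<in>U. g x) = - 1" "\<And>x. x \<in> U \<Longrightarrow> \<bar>g x\<bar> \<le> 1"
proof -
  note le1 = limit_le_one[OF q u lim g] and ge1 = limit_norm_ge[OF q u lim g]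
    and sgn = limit_sign_change[OF q u lim g]
  have u': "(\<lambda>x. - u j x) \<in> W (q j)" "norm_pow (q j) (\<lambda>x. - u j x) = 1" "balanced (q j) (\<lambda>x. - u j x)" for j
    using W_cmult[OF u(1)[of j], of "-1"] u(2)[of j] u(3)[of j]
    by (simp_all add: pint_uminus balanced_def sgn_pow_uminus)
  have lim': "\<forall>e>0. \<forall>\<^sub>F j in sequentially. AE x in muU. x \<in> U \<and> \<bar>- u j x - - g x\<bar> < e"
  proof -
    have "\<bar>- s - - t\<bar> = \<bar>s - t\<bar>" for s t :: real by simp
    then show ?thesis using lim by simp
  qed
  have g': "continuous_on (closure U) (\<lambda>x. - g x)" using g by (intro continuous_intros)
  note sgn' = limit_sign_change[OF q u' lim' g']
  show b: "\<bar>g x\<bar> \<le> 1" if "x \<in> U" for x using le1[of x] closure_subset that by blast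
  have both: "(\<exists>x\<in>U. g x > t) \<and> (\<exists>x\<in>U. g x < - t)" if t: "0 \<le> t" "t < 1" for t
  proof -
    define t1 where "t1 = (t + 1) / 2"
    have t1: "t < t1" "t1 < 1" "0 \<le> t1" using t by (auto simp: t1_def)
    define t2 where "t2 = (t1 + 1) / 2"
    have t2: "t1 < t2" "t2 < 1" using t1 by (auto simp: t2_def)
    obtain x where x: "x \<in> U" "t2 < \<bar>g x\<bar>" using ge1[of "1 - t2"] t2 t1 by auto
    show ?thesis
    proof (cases "g x > 0")
      case True
      then obtain y where "y \<in> U" "g y < - t1" using sgn[OF x(1), of t2 t1] x t2 t1 by auto
      then show ?thesis using True x t1 t2 by (intro conjI bexI[of _ x] bexI[of _ y]) auto
    next
      case False
      then obtain y where "y \<in> U" "- g y < - t1" using sgn'[OF x(1), of t2 t1] x t2 t1 by auto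
      then show ?thesis using False x t1 t2 by (intro conjI bexI[of _ x] bexI[of _ y]) auto
    qed
  qed
  show "(SUP x\<in>U. g x) = 1"
  proof (rule cSup_eq_non_empty)
    show "g ` U \<noteq> {}" using U_ne by simp
    show "z \<le> 1" if "z \<in> g ` U" for z using b that by (auto simp: abs_le_iff)
    show "1 \<le> z" if z: "\<And>y. y \<in> g ` U \<Longrightarrow> y \<le> z" for z
    proof (rule ccontr)
      assume "\<not> 1 \<le> z"
      then obtain x where "x \<in> U" "g x > max z 0" using both[of "max z 0"] by auto
      then show False using z[of "g x"] by auto
    qed
  qed
  show "(INF x\<in>U. g x) = - 1"
  proof (rule cInf_eq_non_empty)
    show "g ` U \<noteq> {}" using U_ne by simp
    show "- 1 \<le> z" if "z \<in> g ` U" for z using b that by (auto simp: abs_le_iff)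
    show "z \<le> - 1" if z: "\<And>y. y \<in> g ` U \<Longrightarrow> z \<le> y" for z
    proof (rule ccontr)
      assume "\<not> z \<le> - 1"
      then obtain x where "x \<in> U" "g x < - max (- z) 0" using both[of "max (- z) 0"] by auto
      then show False using z[of "g x"] by auto
    qed
  qed
qed

subsection \<open>The diameter and the upper bound\<close>

lemma diam_d_attained:
  obtains x0 y0 where "x0 \<in> closure U" "y0 \<in> closure U" "d x0 y0 = diam_d d U"
    "\<And>x y. x \<in> closure U \<Longrightarrow> y \<in> closure U \<Longrightarrow> d x y \<le> diam_d d U"
proof -
  have "compact (closure U \<times> closure U)"
    using U_bounded by (intro compact_Times) (simp_all add: compact_closure)
  moreover have "closure U \<times> closure U \<noteq> {}" using U_ne by simp
  ultimately obtain z where z: "z \<in> closure U \<times> closure U"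
    "\<And>w. w \<in> closure U \<times> closure U \<Longrightarrow> d (fst w) (snd w) \<le> d (fst z) (snd z)"
    using continuous_attains_sup[OF _ _ continuous_on_subset[OF continuous_d subset_UNIV]] by metis
  have "diam_d d U = d (fst z) (snd z)"
    unfolding diam_d_def
  proof (rule cSup_eq_maximum)
    show "d (fst z) (snd z) \<in> (\<lambda>(x, y). d x y) ` (closure U \<times> closure U)"
      using z(1) by (intro image_eqI[of _ _ z]) (auto simp: case_prod_unfold)
    show "t \<le> d (fst z) (snd z)" if "t \<in> (\<lambda>(x, y). d x y) ` (closure U \<times> closure U)" for t
      using that z(2) by force
  qed
  then show ?thesis using that[of "fst z" "snd z"] z by (force simp: mem_Times_iff)
qed

lemma d_le_diam: "x \<in> closure U \<Longrightarrow> y \<in> closure U \<Longrightarrow> d x y \<le> diam_d d U"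
  using diam_d_attained by metis

lemma diam_d_pos: "diam_d d U > 0"
proof -
  obtain x0 where x0: "x0 \<in> U" using U_ne by blast
  have "U \<noteq> {x0}" using U_open not_open_singleton by blast
  then obtain y0 where y0: "y0 \<in> U" "y0 \<noteq> x0" using x0 by blast
  have "0 < d x0 y0" using d_pos y0 by metis
  also have "\<dots> \<le> diam_d d U" using x0 y0 closure_subset[of U] by (intro d_le_diam) auto
  finally show ?thesis .
qed

text \<open>The test function gives \<open>K * (D powr (1 - s) / (D / 2 - e)) powr p\<close> as a
  bound. The loss \<open>e\<close> is chosen to make this base equal \<open>y'\<close>, halfway
  between the limit and \<open>y\<close>; it is positive because \<open>y'\<close> exceeds the
  limit.\<close>

lemma lam_root_upper:
  assumes y: "2 / diam_d d U powr s < y"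
  shows "\<forall>\<^sub>F p in at_top. lam p powr (1 / p) < y"
proof -
  define D where "D = diam_d d U"
  have D: "D > 0" using diam_d_pos by (simp add: D_def)
  obtain x0 y0 where xy: "x0 \<in> closure U" "y0 \<in> closure U" "d x0 y0 = D"
    using diam_d_attained unfolding D_def by metis
  define y' where "y' = (y + 2 / D powr s) / 2"
  have y': "2 / D powr s < y'" "y' < y" using y by (auto simp: y'_def D_def)
  have y'0: "0 < y'" using y'(1) D by (smt (verit) divide_pos_pos powr_gt_zero)
  define e where "e = D / 2 - D powr (1 - s) / y'"
  have De: "D / 2 - e = D powr (1 - s) / y'" by (simp add: e_def)
  have "D powr (1 - s) / y' < D / 2"
  proof -
    have "D powr (1 - s) / y' = D / (y' * D powr s)" using D by (simp add: powr_diff mult.commute)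
    also have "\<dots> < D / 2"
    proof (rule divide_strict_left_mono)
      show "2 < y' * D powr s" using y'(1) D by (simp add: divide_less_eq)
    qed (use D y'0 in simp_all)
    finally show ?thesis .
  qed
  then have e: "0 < e" "e < D / 2" using y'0 D by (auto simp: e_def)
  obtain \<mu> where \<mu>: "\<mu> > 0" "\<And>p c. 1 < p \<Longrightarrow> (D / 2 - e) powr p * \<mu> \<le> norm_pow p (\<lambda>x. truncd x0 D x - c)"
    by (rule truncd_shift_norm_lower[OF xy(1,2) xy(3)[symmetric] D e]) blast
  define G where "G = (LINT z|lborel. kern 2 z * min (d (fst z) (snd z)) D powr 2)"
  have G: "G \<ge> 0" unfolding G_def by (intro integral_nonneg_AE) simp
  \<comment> \<open>Collects all that does not depend on \<open>p\<close>; the power of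
    \<open>D\<close> is left over from \<open>(1 - s) * (p - 2)\<close>, and \<open>G + 1\<close>
    keeps \<open>K\<close> positive.\<close>
  define K where "K = (G + 1) * D powr (- (2 * (1 - s))) / (2 * \<mu>)"
  have K: "K > 0" using G D \<mu> by (simp add: K_def)
  have bound: "lam p powr (1 / p) \<le> y' * K powr (1 / p)" if p: "2 \<le> p" for p
  proof -
    have p1: "1 < p" using p by simp
    note v = truncd_W[OF p1 D, of x0]
    obtain c where "2 * lam p * norm_pow p (\<lambda>x. truncd x0 D x - c) \<le> energy p (truncd x0 D)"
      using lam_le_shift[OF p1 v(1)] by blast
    moreover have "energy p (truncd x0 D) \<le> D powr ((1 - s) * (p - 2)) * G"
      using v(2) truncated_kernel_mono[OF p D] unfolding G_def by linarith
    moreover have "2 * lam p * ((D / 2 - e) powr p * \<mu>) \<le> 2 * lam p * norm_pow p (\<lambda>x. truncd x0 D x - c)"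
      by (intro mult_left_mono \<mu>(2)[OF p1]) simp
    moreover have "D powr ((1 - s) * (p - 2)) * G \<le> D powr ((1 - s) * (p - 2)) * (G + 1)"
      by (intro mult_left_mono) simp_all
    ultimately have "2 * lam p * ((D / 2 - e) powr p * \<mu>) \<le> D powr ((1 - s) * (p - 2)) * (G + 1)" by linarith
    also have "D powr ((1 - s) * (p - 2)) = D powr ((1 - s) * p) * D powr (- (2 * (1 - s)))"
      by (simp only: powr_add[symmetric]) (simp add: algebra_simps)
    finally have "lam p * (2 * \<mu> * (D / 2 - e) powr p) \<le> D powr ((1 - s) * p) * D powr (- (2 * (1 - s))) * (G + 1)"
      by (simp add: mult_ac)
    moreover have "0 < 2 * \<mu> * (D / 2 - e) powr p" using \<mu>(1) e by simp
    ultimately have "lam p \<le> D powr ((1 - s) * p) * D powr (- (2 * (1 - s))) * (G + 1) / (2 * \<mu> * (D / 2 - e) powr p)"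
      by (simp only: pos_le_divide_eq)
    also have "\<dots> = K * (D powr ((1 - s) * p) / (D / 2 - e) powr p)" by (simp add: K_def)
    also have "D powr ((1 - s) * p) / (D / 2 - e) powr p = y' powr p"
      using D y'0 unfolding De by (simp add: powr_divide powr_powr)
    finally have "lam p powr (1 / p) \<le> (K * y' powr p) powr (1 / p)"
      using p by (intro powr_mono2) auto
    also have "\<dots> = K powr (1 / p) * y'" using K y'0 p by (simp add: powr_mult powr_powr)
    finally show ?thesis by (simp add: mult.commute)
  qed
  have "((\<lambda>p. 1 / p) \<longlongrightarrow> (0::real)) at_top"
    by (rule tendsto_divide_0[OF tendsto_const]) (simp add: filterlim_at_top_imp_at_infinity filterlim_ident)
  then have "((\<lambda>p. y' * K powr (1 / p)) \<longlongrightarrow> y' * K powr 0) at_top"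
    using K by (intro tendsto_intros) auto
  then have "\<forall>\<^sub>F p in at_top. y' * K powr (1 / p) < y"
    using y'(2) K by (intro order_tendstoD) auto
  then show ?thesis
    using eventually_ge_at_top[of 2] by eventually_elim (use bound in \<open>force intro: le_less_trans\<close>)
qed

section \<open>The limit problem\<close>

abbreviation Lam :: real where "Lam \<equiv> 2 / diam_d d U powr s"

lemma AE_lebesgue_on_U: "(AE x in lebesgue_on U. P x) \<longleftrightarrow> (AE x in muU. P x)"
proof -
  have "U \<inter> space lebesgue \<in> sets lebesgue" using U_sets by (simp add: sets_completionI_sets)
  then show ?thesis by (simp add: AE_restrict_space_iff AE_completion_iff AE_muU)
qed

lemma AE_muU_continuous_le:
  fixes f :: "'a \<Rightarrow> real"
  assumes f: "continuous_on U f" and ae: "AE x in muU. f x \<le> t" and x: "x \<in> U"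
  shows "f x \<le> t"
proof (rule ccontr)
  assume "\<not> f x \<le> t"
  define V where "V = {y \<in> U. t < f y}"
  have V: "open V" unfolding V_def using continuous_on_open_vimage[OF U_open, of f] f
      open_greaterThan[of t] by (auto simp: vimage_def greaterThan_def Int_def conj_commute)
  have "measure lborel (U \<inter> V) > 0"
    by (rule measure_open_inter_pos[OF V, of x]) (use x closure_subset \<open>\<not> f x \<le> t\<close> in \<open>auto simp: V_def\<close>)
  moreover have "AE y in lborel. y \<notin> U \<inter> V"
    using ae unfolding AE_muU by eventually_elim (auto simp: V_def)
  then have "U \<inter> V \<in> null_sets lborel" using V U_open by (subst AE_iff_null_sets) auto
  ultimately show False by (simp add: measure_def null_sets_def)
qed

lemma Linf_norm_le:
  assumes "u \<in> borel_measurable (lebesgue_on U)" "\<And>x. x \<in> U \<Longrightarrow> \<bar>u x\<bar> \<le> t"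
  shows "Linf_norm U u \<le> ennreal t"
  unfolding Linf_norm_def
proof (rule esssup_I)
  show "(\<lambda>x. ennreal \<bar>u x\<bar>) \<in> borel_measurable (lebesgue_on U)" using assms(1) by measurable
  have "AE x in muU. x \<in> U" by (simp add: AE_muU)
  then show "AE x in lebesgue_on U. ennreal \<bar>u x\<bar> \<le> ennreal t"
    unfolding AE_lebesgue_on_U by eventually_elim (intro ennreal_leI assms(2))
qed

lemma le_Linf_norm:
  assumes u: "continuous_on U u" and t: "0 \<le> t" "Linf_norm U u \<le> ennreal t" and x: "x \<in> U"
  shows "\<bar>u x\<bar> \<le> t"
proof (rule AE_muU_continuous_le[OF _ _ x])
  show "continuous_on U (\<lambda>x. \<bar>u x\<bar>)" using u by (intro continuous_intros)
  have "AE x in lebesgue_on U. ennreal \<bar>u x\<bar> \<le> Linf_norm U u"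
    unfolding Linf_norm_def by (rule esssup_AE)
  then have "AE x in muU. ennreal \<bar>u x\<bar> \<le> Linf_norm U u" by (simp add: AE_lebesgue_on_U)
  then show "AE x in muU. \<bar>u x\<bar> \<le> t"
  proof eventually_elim
    case (elim x)
    then have "ennreal \<bar>u x\<bar> \<le> ennreal t" using t(2) by (rule order_trans)
    then show ?case using t(1) by (simp add: ennreal_le_iff)
  qed
qed

text \<open>When supremum and infimum are opposite, the oscillation is twice the supremum; this is
  the origin of \<open>2 / diam_d d U powr s\<close>.\<close>

lemma Holder_oscillation:
  fixes f :: "'a \<Rightarrow> real"
  assumes h: "0 \<le> h" "\<forall>x\<in>U. \<forall>y\<in>U. \<bar>f x - f y\<bar> \<le> h * d x y powr s"
  shows "(SUP x\<in>U. f x) - (INF x\<in>U. f x) \<le> h * diam_d d U powr s"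
    and "bdd_above (f ` U)" "bdd_below (f ` U)"
proof -
  define R where "R = h * diam_d d U powr s"
  have osc: "f x - f y \<le> R" if "x \<in> U" "y \<in> U" for x y
  proof -
    have "d x y \<le> diam_d d U" using that closure_subset[of U] by (intro d_le_diam) auto
    then have "h * d x y powr s \<le> R" using h(1) s0 unfolding R_def by (intro mult_left_mono powr_mono2) auto
    moreover have "\<bar>f x - f y\<bar> \<le> h * d x y powr s" using h(2) that by blast
    ultimately show ?thesis by linarith
  qed
  obtain x0 where x0: "x0 \<in> U" using U_ne by blast
  have osc': "f x \<le> f y + R" "f y - R \<le> f x" if "x \<in> U" "y \<in> U" for x y
    using osc[OF that] osc[OF that(2,1)] by linarith+
  show "bdd_above (f ` U)" using osc'(1)[OF _ x0] by (auto intro!: bdd_aboveI)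
  show "bdd_below (f ` U)" using osc'(2)[OF _ x0] by (auto intro!: bdd_belowI)
  have "(SUP x\<in>U. f x) - R \<le> f y" if "y \<in> U" for y
  proof -
    have "(SUP x\<in>U. f x) \<le> f y + R" using U_ne osc'(1)[OF _ that] by (intro cSUP_least) auto
    then show ?thesis by linarith
  qed
  then have "(SUP x\<in>U. f x) - R \<le> (INF x\<in>U. f x)" using U_ne by (intro cINF_greatest) auto
  then show "(SUP x\<in>U. f x) - (INF x\<in>U. f x) \<le> h * diam_d d U powr s" by (simp add: R_def)
qed

lemma Holder_le_of_SUP:
  assumes "(SUP (x, y)\<in>S. ennreal (\<bar>f x - f y\<bar> / d x y powr s)) = ennreal h" "0 \<le> h"
    and xy: "x \<noteq> y \<Longrightarrow> (x, y) \<in> S"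
  shows "\<bar>f x - f y\<bar> \<le> h * d x y powr s"
proof (cases "x = y")
  case False
  then have "ennreal (\<bar>f x - f y\<bar> / d x y powr s) \<le> ennreal h"
    unfolding assms(1)[symmetric] using SUP_upper[OF xy, of "\<lambda>(x, y). ennreal (\<bar>f x - f y\<bar> / d x y powr s)"] by simp
  then have "\<bar>f x - f y\<bar> / d x y powr s \<le> h" using assms(2) by (simp add: ennreal_le_iff)
  then show ?thesis using d_pos[OF False] by (simp add: pos_divide_le_eq)
qed (use assms in simp)

lemma SUP_Holder_le:
  assumes h: "0 \<le> h" and "\<And>x y. (x, y) \<in> S \<Longrightarrow> \<bar>f x - f y\<bar> \<le> h * d x y powr s"
  shows "(SUP (x, y)\<in>S. ennreal (\<bar>f x - f y\<bar> / d x y powr s)) \<le> ennreal h"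
proof (rule SUP_least)
  fix z assume z: "z \<in> S"
  obtain x y where xy: "z = (x, y)" by (cases z)
  have "\<bar>f x - f y\<bar> / d x y powr s \<le> h"
  proof (cases "x = y")
    case False
    then show ?thesis using assms(2)[of x y] z xy d_pos[OF False] by (simp add: pos_divide_le_eq)
  qed (use h in simp)
  then show "(case z of (x, y) \<Rightarrow> ennreal (\<bar>f x - f y\<bar> / d x y powr s)) \<le> ennreal h"
    using xy by (simp add: ennreal_leI)
qed

lemma Lam_le_quot:
  assumes u: "u \<in> admissible_sinf U d s"
  shows "ennreal Lam \<le> quot (H_infty U d s u) (Linf_norm U u)"
proof (cases "Linf_norm U u = 0")
  case False
  have W: "u \<in> borel_measurable lebesgue" "Linf_norm U u + H_infty U d s u < top"
    and bal: "(SUP x\<in>U. u x) + (INF x\<in>U. u x) = 0"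
    using u by (auto simp: admissible_sinf_def W_sinf_def)
  define h where "h = enn2real (H_infty U d s u)"
  define l where "l = enn2real (Linf_norm U u)"
  have h: "H_infty U d s u = ennreal h" "0 \<le> h" using W(2) by (auto simp: h_def less_top)
  have l: "Linf_norm U u = ennreal l" "0 < l"
  proof -
    show "Linf_norm U u = ennreal l" using W(2) by (simp add: l_def less_top)
    with False have "l \<noteq> 0" by auto
    then show "0 < l" using enn2real_nonneg[of "Linf_norm U u"] unfolding l_def by linarith
  qed
  have Hol: "\<bar>u x - u y\<bar> \<le> h * d x y powr s" if "x \<in> U" "y \<in> U" for x y
    by (rule Holder_le_of_SUP[OF h(1)[unfolded H_infty_def] h(2)]) (use that in \<open>auto simp: cross_dom_def\<close>)
  then have "\<forall>x\<in>U. \<forall>y\<in>U. \<bar>u x - u y\<bar> \<le> h * d x y powr s" by blast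
  note osc = Holder_oscillation[OF h(2) this]
  define S where "S = (SUP x\<in>U. u x)"
  have S: "\<bar>u x\<bar> \<le> S" if "x \<in> U" for x
  proof -
    have "u x \<le> S" unfolding S_def using osc(2) that by (rule cSUP_upper2[OF _ _ order_refl])
    moreover have "(INF x\<in>U. u x) \<le> u x" using osc(3) that by (rule cINF_lower2[OF _ _ order_refl])
    ultimately show ?thesis using bal unfolding S_def by linarith
  qed
  have "u \<in> borel_measurable (lebesgue_on U)" using W(1) by (rule measurable_restrict_space1)
  from Linf_norm_le[OF this S] have "ennreal l \<le> ennreal S" by (simp only: l(1))
  moreover have "0 \<le> S" using S U_ne by fastforce
  ultimately have lS: "l \<le> S" by (simp add: ennreal_le_iff)
  have "2 * S \<le> h * diam_d d U powr s" using osc(1) bal unfolding S_def by linarith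
  then have "2 * l \<le> h * diam_d d U powr s" using lS by linarith
  then have "Lam \<le> h / l" using l(2) diam_d_pos by (simp add: divide_le_eq le_divide_eq mult_ac)
  then show ?thesis using l h by (simp add: quot_ennreal ennreal_leI)
qed (simp add: quot_def)

text \<open>The truncated distance from an end point of a diameter, lowered by \<open>D / 2\<close>,
  attains the infimum. Its truncation matters because \<open>H_infty\<close> also sees pairs with
  one point far from \<open>U\<close>.\<close>

lemma Lambda_sinf_eq: "Lambda_sinf U d s = ennreal Lam"
proof (rule antisym)
  show "ennreal Lam \<le> Lambda_sinf U d s" unfolding Lambda_sinf_def by (intro INF_greatest Lam_le_quot)
  define D where "D = diam_d d U"
  have D: "D > 0" using diam_d_pos by (simp add: D_def)
  obtain x0 y0 where xy: "x0 \<in> closure U" "y0 \<in> closure U" "d x0 y0 = D"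
    and Dle: "\<And>x y. x \<in> closure U \<Longrightarrow> y \<in> closure U \<Longrightarrow> d x y \<le> D"
    using diam_d_attained unfolding D_def by metis
  define u where "u x = truncd x0 D x - D / 2" for x
  have u_cont: "continuous_on UNIV u"
    unfolding u_def truncd_def by (intro continuous_intros continuous_d_left)
  have u_meas: "u \<in> borel_measurable borel" using u_cont by (rule borel_measurable_continuous_onI)
  have ux0: "u x0 = - D / 2" using d_zero_iff[of x0 x0] D by (simp add: u_def truncd_def)
  have uy0: "u y0 = D / 2" using xy(3) d_commute[of x0 y0] by (simp add: u_def truncd_def)
  have ub: "\<bar>u x\<bar> \<le> D / 2" for x
    using d_nonneg[of x x0] D unfolding u_def truncd_def by linarith
  \<comment> \<open>The end points of the diameter lie in the closure, whereas supremum, infimum and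
    norm refer to \<open>U\<close>; closed sublevel sets bridge this.\<close>
  have closed_le: "u x \<le> z" if "\<And>y. y \<in> U \<Longrightarrow> u y \<le> z" "x \<in> closure U" for x z
  proof -
    have "closed {x. u x \<le> z}" using u_cont by (intro closed_Collect_le continuous_on_const)
    then have "closure U \<subseteq> {x. u x \<le> z}" using that(1) by (intro closure_minimal) auto
    then show ?thesis using that(2) by blast
  qed
  have closed_ge: "z \<le> u x" if "\<And>y. y \<in> U \<Longrightarrow> z \<le> u y" "x \<in> closure U" for x z
  proof -
    have "closed {x. z \<le> u x}" using u_cont by (intro closed_Collect_le continuous_on_const)
    then have "closure U \<subseteq> {x. z \<le> u x}" using that(1) by (intro closure_minimal) auto
    then show ?thesis using that(2) by blast
  qed
  have sup: "(SUP x\<in>U. u x) = D / 2"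
  proof (rule cSup_eq_non_empty)
    show "u ` U \<noteq> {}" using U_ne by simp
    have "u x \<le> D / 2" for x using ub[of x] by linarith
    then show "t \<le> D / 2" if "t \<in> u ` U" for t using that by blast
    show "D / 2 \<le> z" if "\<And>t. t \<in> u ` U \<Longrightarrow> t \<le> z" for z
      using closed_le[of z y0] that xy(2) uy0 by auto
  qed
  have inf: "(INF x\<in>U. u x) = - (D / 2)"
  proof (rule cInf_eq_non_empty)
    show "u ` U \<noteq> {}" using U_ne by simp
    have "- (D / 2) \<le> u x" for x using ub[of x] by linarith
    then show "- (D / 2) \<le> t" if "t \<in> u ` U" for t using that by blast
    show "z \<le> - (D / 2)" if "\<And>t. t \<in> u ` U \<Longrightarrow> z \<le> t" for z
      using closed_ge[of z x0] that xy(1) ux0 by auto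
  qed
  have Hol: "\<bar>u x - u y\<bar> \<le> D powr (1 - s) * d x y powr s" for x y
  proof (cases "x = y")
    case False
    define m where "m = min (d x y) D"
    have m: "0 < m" "m \<le> d x y" "m \<le> D" using d_pos[OF False] D by (auto simp: m_def)
    have "\<bar>u x - u y\<bar> \<le> m" using dif_truncd_le[OF D, of x0 "(x, y)"] by (simp add: dif_def u_def m_def)
    also have "m = m powr (1 - s) * m powr s" using m by (simp flip: powr_add)
    also have "\<dots> \<le> D powr (1 - s) * d x y powr s" using m s0 s1 by (intro mult_mono powr_mono2) auto
    finally show ?thesis .
  qed simp
  have H: "H_infty U d s u \<le> ennreal (D powr (1 - s))"
    unfolding H_infty_def by (rule SUP_Holder_le) (use Hol in auto)
  have mU: "u \<in> borel_measurable (lebesgue_on U)"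
    using u_meas by (intro measurable_restrict_space1 measurable_completion) simp
  have Li: "Linf_norm U u \<le> ennreal (D / 2)" by (rule Linf_norm_le[OF mU]) (rule ub)
  have Lfin: "Linf_norm U u = ennreal (enn2real (Linf_norm U u))"
    using Li by (metis ennreal_enn2real ennreal_less_top order_le_less_trans)
  define l where "l = enn2real (Linf_norm U u)"
  have l0: "0 \<le> l" by (simp add: l_def)
  have "\<bar>u x\<bar> \<le> l" if "x \<in> U" for x
    by (rule le_Linf_norm[OF continuous_on_subset[OF u_cont] l0 _ that]) (use Lfin in \<open>auto simp: l_def\<close>)
  then have "u y0 \<le> l" using closed_le[of l y0] xy(2) by (auto simp: abs_le_iff)
  then have lD: "D / 2 \<le> l" using uy0 by simp
  have nz: "nonzero_ae u"
  proof -
    have "\<not> (AE x in lborel. u x = 0)"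
    proof
      assume "AE x in lborel. u x = 0"
      then have "AE x in muU. u x \<le> 0" unfolding AE_muU by eventually_elim simp
      then have "u x \<le> 0" if "x \<in> U" for x
        using AE_muU_continuous_le[OF continuous_on_subset[OF u_cont]] that by blast
      then have "u y0 \<le> 0" using closed_le[of 0 y0] xy(2) by auto
      then show False using uy0 D by simp
    qed
    then show ?thesis by (simp add: nonzero_ae_def AE_completion_iff)
  qed
  have "Linf_norm U u + H_infty U d s u \<le> ennreal (D / 2) + ennreal (D powr (1 - s))" by (intro add_mono Li H)
  also have "\<dots> < top" by simp
  finally have "u \<in> W_sinf U d s"
    unfolding W_sinf_def using u_meas by (simp add: measurable_completion)
  then have "u \<in> admissible_sinf U d s" using nz sup inf by (simp add: admissible_sinf_def)
  then have "Lambda_sinf U d s \<le> quot (H_infty U d s u) (Linf_norm U u)"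
    unfolding Lambda_sinf_def by (rule INF_lower)
  also have "\<dots> = H_infty U d s u / ennreal l"
    using lD D Lfin by (simp add: quot_def l_def[symmetric])
  also have "\<dots> \<le> ennreal (D powr (1 - s)) / ennreal l" by (rule divide_right_mono_ennreal[OF H])
  also have "\<dots> = ennreal (D powr (1 - s) / l)" using lD D by (simp add: divide_ennreal)
  also have "\<dots> \<le> ennreal (D powr (1 - s) / (D / 2))"
    using lD D by (intro ennreal_leI divide_left_mono) auto
  also have "D powr (1 - s) / (D / 2) = Lam" using D by (simp add: powr_diff D_def)
  finally show "Lambda_sinf U d s \<le> ennreal Lam" .
qed

text \<open>The Holder bound is one inequality for the seminorm; the oscillation 2 across the
  diameter forces the other, and the norm is 1.\<close>

lemma is_minimizer_Lambda_N_limit: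
  assumes g: "continuous_on U g" and sup: "(SUP x\<in>U. g x) = 1" and inf: "(INF x\<in>U. g x) = - 1"
    and b: "\<And>x. x \<in> U \<Longrightarrow> \<bar>g x\<bar> \<le> 1"
    and Hol: "\<And>x y. x \<in> U \<Longrightarrow> y \<in> U \<Longrightarrow> \<bar>g x - g y\<bar> \<le> Lam * d x y powr s"
  shows "is_minimizer_Lambda_N U d s g"
proof -
  have L0: "0 \<le> Lam" using diam_d_pos by simp
  have Hle: "Holder_seminorm U d s g \<le> ennreal Lam"
    unfolding Holder_seminorm_def by (rule SUP_Holder_le[OF L0]) (use Hol in auto)
  define h where "h = enn2real (Holder_seminorm U d s g)"
  have h: "Holder_seminorm U d s g = ennreal h" "0 \<le> h"
    using Hle by (auto simp: h_def) (metis ennreal_enn2real ennreal_less_top order_le_less_trans)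
  have "\<bar>g x - g y\<bar> \<le> h * d x y powr s" if "x \<in> U" "y \<in> U" for x y
    by (rule Holder_le_of_SUP[OF h(1)[unfolded Holder_seminorm_def] h(2)]) (use that in auto)
  then have "\<forall>x\<in>U. \<forall>y\<in>U. \<bar>g x - g y\<bar> \<le> h * d x y powr s" by blast
  from Holder_oscillation(1)[OF h(2) this] have "2 \<le> h * diam_d d U powr s" using sup inf by simp
  then have "Lam \<le> h" using diam_d_pos by (simp add: divide_le_eq)
  then have Heq: "Holder_seminorm U d s g = ennreal Lam"
    using Hle h by (simp add: antisym ennreal_leI)
  have mU: "g \<in> borel_measurable (lebesgue_on U)"
    using g U_open by (intro continuous_imp_measurable_on_sets_lebesgue) (auto simp: sets_completionI_sets)
  have Li: "Linf_norm U g \<le> ennreal 1" by (rule Linf_norm_le[OF mU b])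
  define l where "l = enn2real (Linf_norm U g)"
  have l: "Linf_norm U g = ennreal l" "0 \<le> l"
    using Li by (auto simp: l_def) (metis ennreal_1 ennreal_enn2real ennreal_less_top order_le_less_trans)
  have "g x \<le> l" if "x \<in> U" for x
    using le_Linf_norm[OF g l(2) _ that] l(1) by auto
  then have "(SUP x\<in>U. g x) \<le> l" using U_ne by (intro cSUP_least) auto
  then have "1 \<le> l" using sup by simp
  moreover have "l \<le> 1" using Li l by (simp add: ennreal_le_iff flip: ennreal_1)
  ultimately have Leq: "Linf_norm U g = 1" using l(1) by simp
  have "\<exists>x\<in>U. g x \<noteq> 0"
  proof (rule ccontr)
    assume "\<not> ?thesis"
    then have "(SUP x\<in>U. g x) = (SUP x\<in>U. 0)" by (intro SUP_cong) auto
    then show False using sup U_ne by simp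
  qed
  moreover have "g \<in> W_sinf_on U d s"
    using b Heq unfolding W_sinf_on_def by (auto simp: bounded_iff)
  moreover have "quot (Holder_seminorm U d s g) (Linf_norm U g) = ennreal (Lambda_N U d s)"
    unfolding Heq Leq by (simp add: quot_def Lambda_N_def divide_ennreal_def)
  ultimately show ?thesis using sup inf by (simp add: is_minimizer_Lambda_N_def)
qed

end

context dense_setting
begin

section \<open>The sharp Holder bound and uniform convergence\<close>

text \<open>Unlike in \<open>avg_cell_diff\<close> nothing is rounded: for fixed \<open>k\<close>
  the exponents \<open>s + n / p\<close> and \<open>2 / p\<close> tend to \<open>s\<close> and 0, so
  only \<open>F\<close> remains as the constant.\<close>

lemma two_point_estimate:
  assumes p: "1 < p" and u: "u \<in> W p" and F: "0 \<le> F" "energy p u \<le> F powr p"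
    and xy: "x \<in> closure U" "y \<in> closure U"
  shows "\<bar>avg (cell x (rad k)) u - avg (cell y (rad k)) u\<bar>
    \<le> F * (d x y + 2 * C * rad k) powr (s + real DIM('a) / p) / (\<kappa> * rad k ^ DIM('a)) powr (2 / p)"
proof -
  define \<rho> where "\<rho> = d x y + 2 * C * rad k"
  define v where "v = \<kappa> * rad k ^ DIM('a)"
  define m where "m = \<bar>avg (cell x (rad k)) u - avg (cell y (rad k)) u\<bar>"
  have v: "0 < v" using \<kappa>0 rad(1)[of k] by (simp add: v_def)
  have \<rho>0: "0 < \<rho>" using d_nonneg[of x y] C1 rad(1)[of k] by (simp add: \<rho>_def add_nonneg_pos)
  have dist: "d a b \<le> \<rho>" if "a \<in> cell x (rad k)" "b \<in> cell y (rad k)" for a b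
  proof -
    have "norm (a - x) \<le> rad k" "norm (y - b) \<le> rad k"
      using that by (auto simp: cell_def dist_norm norm_minus_commute)
    then have "C * norm (a - x) \<le> C * rad k" "C * norm (y - b) \<le> C * rad k"
      using C1 by (auto intro: mult_left_mono)
    then have "d a x \<le> C * rad k" "d y b \<le> C * rad k" using d_upper[of a x] d_upper[of y b] by linarith+
    then show ?thesis using d_triangle[of a b x] d_triangle[of x b y] unfolding \<rho>_def by linarith
  qed
  note cx = cell_measure[OF xy(1) rad(1,2)[of k]] and cy = cell_measure[OF xy(2) rad(1,2)[of k]]
  have "v * v * m powr p \<le> measure lborel (cell x (rad k)) * measure lborel (cell y (rad k)) * m powr p"
    using cx cy v by (intro mult_right_mono mult_mono) (auto simp: v_def)
  also have "\<dots> \<le> \<rho> powr (real DIM('a) + p * s) * energy p u"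
    unfolding m_def by (rule avg_diff_le[OF p u cell_sets cx(2) cell_sets cy(2) dist])
  also have "\<dots> \<le> \<rho> powr (real DIM('a) + p * s) * F powr p" using F by (intro mult_left_mono) auto
  finally have "m powr p \<le> \<rho> powr (real DIM('a) + p * s) * F powr p / (v * v)"
    using v by (simp add: pos_le_divide_eq mult.commute)
  then have "m \<le> (\<rho> powr (real DIM('a) + p * s) * F powr p / (v * v)) powr (1 / p)"
    using p by (intro le_powr_inverse) (auto simp: m_def)
  also have "\<dots> = F * \<rho> powr ((real DIM('a) + p * s) * (1 / p)) / v powr (2 / p)"
  proof -
    have "v * v = v powr 2" using v by (simp add: powr_numeral power2_eq_square)
    moreover have "(X * Y / Z) powr e = X powr e * Y powr e / Z powr e"
      if "0 \<le> X" "0 \<le> Y" "0 \<le> Z" for X Y Z e :: real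
      using that by (simp add: powr_divide powr_mult)
    moreover have "(F powr p) powr (1 / p) = F" using F(1) p by (simp add: powr_powr)
    moreover have "(v powr 2) powr (1 / p) = v powr (2 / p)" by (simp only: powr_powr) simp
    ultimately show ?thesis by (simp add: powr_powr del: powr_numeral)
  qed
  also have "(real DIM('a) + p * s) * (1 / p) = s + real DIM('a) / p" using p by (simp add: field_simps)
  finally show ?thesis by (simp add: m_def \<rho>_def v_def)
qed

text \<open>The Arzela-Ascoli step. The two-point estimate at a fixed scale \<open>rad k\<close> has a sharp constant in the
  limit of large exponents; the scale is sent to \<open>0\<close> afterwards.\<close>
lemma minimizers_subsequence:
  fixes q :: "nat \<Rightarrow> real" and u :: "nat \<Rightarrow> 'a \<Rightarrow> real"
  assumes q: "filterlim q at_top sequentially" "\<And>j. 1 < q j" "\<And>j. 2 * real DIM('a) \<le> q j * s"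
    and u: "\<And>j. u j \<in> W (q j)" "\<And>j. norm_pow (q j) (u j) = 1" "\<And>j. balanced (q j) (u j)"
      "\<And>j. energy (q j) (u j) = 2 * lam (q j)"
    and L: "(\<lambda>j. lam (q j) powr (1 / q j)) \<longlonglongrightarrow> L"
  shows "\<exists>(r :: nat \<Rightarrow> nat) w g. strict_mono r \<and> (\<forall>j. AE x in muU. u j x = w j x) \<and>
    (\<forall>j. continuous_on (closure U) (w j)) \<and> continuous_on (closure U) g \<and>
    uniform_limit (closure U) (\<lambda>j. w (r j)) g sequentially \<and>
    (\<forall>x\<in>U. \<forall>y\<in>U. \<bar>g x - g y\<bar> \<le> L * d x y powr s) \<and>
    (SUP x\<in>U. g x) = 1 \<and> (INF x\<in>U. g x) = - 1 \<and> (\<forall>x\<in>U. \<bar>g x\<bar> \<le> 1) \<and> Lam \<le> L"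
proof -
  \<comment> \<open>The root of the energy; it has the same limit \<open>L\<close>, since the root
    of 2 tends to 1.\<close>
  define F where "F j = (2 * lam (q j)) powr (1 / q j)" for j
  have F0: "0 \<le> F j" for j by (simp add: F_def)
  have FE: "energy (q j) (u j) \<le> F j powr q j" for j
    using q(2)[of j] u(4)[of j] by (simp add: F_def powr_powr)
  have q_inv: "(\<lambda>j. c / q j) \<longlonglongrightarrow> 0" for c
    by (rule tendsto_divide_0[OF tendsto_const]) (rule filterlim_at_top_imp_at_infinity[OF q(1)])
  have "(\<lambda>j. 2 powr (1 / q j) * lam (q j) powr (1 / q j)) \<longlonglongrightarrow> 2 powr 0 * L"
    by (intro tendsto_intros L q_inv) simp
  then have FL: "F \<longlonglongrightarrow> L" by (simp add: F_def[abs_def] powr_mult)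
  have L0: "0 \<le> L" by (rule LIMSEQ_le_const[OF FL]) (use F0 in auto)
  obtain Fm where Fm: "\<And>j. F j \<le> Fm" "0 \<le> Fm"
  proof -
    have "Bseq F" using FL convergentI convergent_imp_Bseq by blast
    then obtain K where "0 < K" "\<And>j. norm (F j) \<le> K" by (auto simp: Bseq_def)
    then show ?thesis using that[of K] by (force simp: abs_le_iff)
  qed
  define good where "good j w \<longleftrightarrow> (AE x in muU. u j x = w x) \<and>
      (\<forall>x\<in>closure U. \<forall>k. \<bar>w x - avg (cell x (rad k)) (u j)\<bar> \<le> F j * cM * rad k powr (s / 2)) \<and>
      (\<forall>x\<in>closure U. \<forall>y\<in>closure U. \<forall>k. norm (x - y) \<le> rad k \<longrightarrow> \<bar>w x - w y\<bar> \<le> 3 * F j * cM * rad k powr (s / 2))"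
    for j w
  have "\<exists>w. good j w" for j
    by (rule continuous_representative[OF q(2,3) u(1) F0 FE, of j]) (auto simp: good_def)
  then obtain w where good: "\<And>j. good j (w j)" by metis
  have w_ae: "AE x in muU. u j x = w j x" for j using good[of j] by (simp add: good_def)
  have w_avg: "\<bar>w j x - avg (cell x (rad k)) (u j)\<bar> \<le> F j * cM * rad k powr (s / 2)"
    if "x \<in> closure U" for j x k using good[of j] that by (simp add: good_def)
  have w_mod: "\<bar>w j x - w j y\<bar> \<le> 3 * Fm * cM * rad k powr (s / 2)"
    if "x \<in> closure U" "y \<in> closure U" "norm (x - y) \<le> rad k" for j x y k
  proof -
    have "\<bar>w j x - w j y\<bar> \<le> 3 * F j * cM * rad k powr (s / 2)" using good[of j] that by (simp add: good_def)
    also have "\<dots> \<le> 3 * Fm * cM * rad k powr (s / 2)"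
      using Fm(1)[of j] cM by (intro mult_right_mono mult_left_mono) auto
    finally show ?thesis .
  qed
  have equi: "\<exists>k. \<forall>j. \<forall>x\<in>closure U. \<forall>y\<in>closure U. norm (x - y) \<le> rad k \<longrightarrow> \<bar>w j x - w j y\<bar> < e"
    if e: "e > 0" for e
  proof -
    have "\<forall>\<^sub>F k in sequentially. 3 * Fm * cM * rad k powr (s / 2) < e"
      using rad_powr_tendsto e by (rule order_tendstoD)
    then obtain k where k: "3 * Fm * cM * rad k powr (s / 2) < e" by (auto simp: eventually_sequentially)
    show ?thesis
    proof (intro exI[of _ k] allI ballI impI)
      fix j x y assume "x \<in> closure U" "y \<in> closure U" "norm (x - y) \<le> rad k"
      from w_mod[OF this, of j] show "\<bar>w j x - w j y\<bar> < e" using k by linarith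
    qed
  qed
  have w_cont: "continuous_on (closure U) (w j)" for j
    unfolding continuous_on_iff
  proof (intro ballI allI impI)
    fix x e assume x: "x \<in> closure U" and "(0::real) < e"
    then obtain k where k: "\<forall>j. \<forall>x\<in>closure U. \<forall>y\<in>closure U. norm (x - y) \<le> rad k \<longrightarrow> \<bar>w j x - w j y\<bar> < e"
      using equi by blast
    show "\<exists>\<delta>>0. \<forall>x'\<in>closure U. dist x' x < \<delta> \<longrightarrow> dist (w j x') (w j x) < e"
      using k x rad(1)[of k] by (intro exI[of _ "rad k"]) (auto simp: dist_norm)
  qed
  \<comment> \<open>Bounds averages over the largest cells: one above 1 is at most its own
    \<open>q j\<close>-th power, which the normalization bounds by the inverse volume.\<close>
  define Z where "Z = max 1 (1 / (\<kappa> * rad 0 ^ DIM('a)))"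
  have w_bound: "norm (w j x) \<le> Z + Fm * cM * rad 0 powr (s / 2)" if x: "x \<in> closure U" for j x
  proof -
    define a where "a = \<bar>avg (cell x (rad 0)) (u j)\<bar>"
    note cm = cell_measure[OF x rad(1,2)[of 0]]
    have v: "0 < \<kappa> * rad 0 ^ DIM('a)" using \<kappa>0 rad(1)[of 0] by simp
    have "a \<le> Z"
    proof (cases "a \<le> 1")
      case False
      have "(\<kappa> * rad 0 ^ DIM('a)) * a powr q j \<le> measure lborel (cell x (rad 0)) * a powr q j"
        using cm(1) by (intro mult_right_mono) auto
      also have "\<dots> \<le> 1"
        using avg_norm_le[OF q(2) u(1) cell_sets cm(2), of j] u(2)[of j] by (simp add: a_def)
      finally have "a powr q j \<le> 1 / (\<kappa> * rad 0 ^ DIM('a))" using v by (simp add: pos_le_divide_eq mult.commute)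
      moreover have "a powr 1 \<le> a powr q j" using False q(2)[of j] by (intro powr_mono) auto
      ultimately show ?thesis using False by (simp add: Z_def)
    qed (simp add: Z_def)
    moreover have "F j * cM * rad 0 powr (s / 2) \<le> Fm * cM * rad 0 powr (s / 2)"
      using Fm(1)[of j] cM by (intro mult_right_mono) auto
    ultimately show ?thesis using w_avg[OF x, of j 0] unfolding a_def real_norm_def by linarith
  qed
  have cpt: "compact (closure U)" using U_bounded by (simp add: compact_closure)
  obtain g r where g: "continuous_on (closure U) g" and r: "strict_mono (r :: nat \<Rightarrow> nat)"
    and conv: "\<And>e. 0 < e \<Longrightarrow> \<exists>N. \<forall>n x. n \<ge> N \<and> x \<in> closure U \<longrightarrow> norm (w (r n) x - g x) < e"
  proof (rule Arzela_Ascoli[OF cpt w_bound])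
    fix x and e :: real assume x: "x \<in> closure U" and "0 < e"
    then obtain k where k: "\<forall>j. \<forall>x\<in>closure U. \<forall>y\<in>closure U. norm (x - y) \<le> rad k \<longrightarrow> \<bar>w j x - w j y\<bar> < e"
      using equi by blast
    show "\<exists>\<delta>. 0 < \<delta> \<and> (\<forall>n y. y \<in> closure U \<and> norm (x - y) < \<delta> \<longrightarrow> norm (w n x - w n y) < e)"
      using k x rad(1)[of k] by (intro exI[of _ "rad k"]) auto
  qed blast+
  have ul: "uniform_limit (closure U) (\<lambda>j. w (r j)) g sequentially"
    unfolding uniform_limit_iff eventually_sequentially using conv by (force simp: dist_norm)
  have r_lim: "filterlim r at_top sequentially" by (rule filterlim_subseq[OF r])
  have pt: "(\<lambda>j. w (r j) x) \<longlonglongrightarrow> g x" if "x \<in> closure U" for x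
    by (rule tendsto_uniform_limitI[OF ul that])
  have Hol: "\<bar>g x - g y\<bar> \<le> L * d x y powr s" if xy: "x \<in> closure U" "y \<in> closure U" for x y
  proof -
    have step: "\<bar>g x - g y\<bar> \<le> L * (d x y + 2 * C * rad k) powr s + 2 * (L * cM * rad k powr (s / 2))" for k
    proof (rule LIMSEQ_le)
      define R where "R = d x y + 2 * C * rad k"
      define v where "v = \<kappa> * rad k ^ DIM('a)"
      have v: "v > 0" using \<kappa>0 rad(1)[of k] by (simp add: v_def)
      have R: "R > 0" using d_nonneg[of x y] C1 rad(1)[of k] by (simp add: R_def add_nonneg_pos)
      show "(\<lambda>j. \<bar>w (r j) x - w (r j) y\<bar>) \<longlonglongrightarrow> \<bar>g x - g y\<bar>"
        by (intro tendsto_intros pt xy)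
      have qr: "(\<lambda>j. c / q (r j)) \<longlonglongrightarrow> 0" for c
        using filterlim_compose[OF q_inv r_lim, of c] .
      have Fr: "(\<lambda>j. F (r j)) \<longlonglongrightarrow> L" by (rule filterlim_compose[OF FL r_lim])
      have tend: "(\<lambda>j. F (r j) * R powr (s + real DIM('a) / q (r j)) / v powr (2 / q (r j)) + 2 * (F (r j) * cM * rad k powr (s / 2)))
        \<longlonglongrightarrow> L * R powr (s + 0) / v powr 0 + 2 * (L * cM * rad k powr (s / 2))"
        using v R by (intro tendsto_intros Fr qr) auto
      have eq: "L * R powr (s + 0) / v powr 0 = L * R powr s" using v by simp
      show "(\<lambda>j. F (r j) * (d x y + 2 * C * rad k) powr (s + real DIM('a) / q (r j)) / (\<kappa> * rad k ^ DIM('a)) powr (2 / q (r j)) + 2 * (F (r j) * cM * rad k powr (s / 2)))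
        \<longlonglongrightarrow> L * (d x y + 2 * C * rad k) powr s + 2 * (L * cM * rad k powr (s / 2))"
        using tend[unfolded eq] unfolding R_def v_def .
      show "\<exists>N. \<forall>j\<ge>N. \<bar>w (r j) x - w (r j) y\<bar> \<le> F (r j) * (d x y + 2 * C * rad k) powr (s + real DIM('a) / q (r j)) / (\<kappa> * rad k ^ DIM('a)) powr (2 / q (r j)) + 2 * (F (r j) * cM * rad k powr (s / 2))"
      proof (intro exI allI impI)
        fix j :: nat
        show "\<bar>w (r j) x - w (r j) y\<bar> \<le> F (r j) * (d x y + 2 * C * rad k) powr (s + real DIM('a) / q (r j)) / (\<kappa> * rad k ^ DIM('a)) powr (2 / q (r j)) + 2 * (F (r j) * cM * rad k powr (s / 2))"
          using two_point_estimate[OF q(2)[of "r j"] u(1)[of "r j"] F0 FE xy, of k]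
            w_avg[OF xy(1), of "r j" k] w_avg[OF xy(2), of "r j" k]
          by linarith
      qed
    qed
    have "(\<lambda>k. L * (d x y + 2 * C * rad k) powr s + 2 * (L * cM * rad k powr (s / 2)))
      \<longlonglongrightarrow> L * (d x y + 2 * C * 0) powr s + 2 * 0"
      using s0 d_nonneg[of x y] C1 rad(1)
      by (intro tendsto_add tendsto_mult tendsto_const tendsto_powr' rad_tendsto rad_powr_tendsto) (auto intro!: always_eventually add_nonneg_nonneg mult_nonneg_nonneg less_imp_le)
    from LIMSEQ_le_const[OF this, of "\<bar>g x - g y\<bar>"] step show ?thesis by simp
  qed
  have q': "filterlim (\<lambda>j. q (r j)) at_top sequentially" by (rule filterlim_compose[OF q(1) r_lim])
  have lim: "\<forall>e>0. \<forall>\<^sub>F j in sequentially. AE x in muU. x \<in> U \<and> \<bar>u (r j) x - g x\<bar> < e"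
    using uniform_limit_AE[OF ul w_ae] by blast
  note si = limit_sup_inf[OF q' q(2) u(1,2,3) lim g]
  have HolU: "\<forall>x\<in>U. \<forall>y\<in>U. \<bar>g x - g y\<bar> \<le> L * d x y powr s"
    using Hol closure_subset[of U] by blast
  from Holder_oscillation(1)[OF L0 this] have "2 \<le> L * diam_d d U powr s" using si by simp
  then have "Lam \<le> L" using diam_d_pos by (simp add: divide_le_eq)
  show ?thesis
    by (rule exI[of _ r], rule exI[of _ w], rule exI[of _ g])
      (intro conjI allI ballI r w_ae w_cont g ul HolU[rule_format] si \<open>Lam \<le> L\<close>)
qed

text \<open>If roots at most \<open>y\<close> occurred at arbitrarily large exponents, a subsequence
  of them would converge to some \<open>L \<le> y\<close>, and the minimizers at these exponents
  would give \<open>Lam \<le> L\<close>.\<close>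

lemma lam_root_lower:
  assumes y: "y < Lam"
  shows "\<forall>\<^sub>F p in at_top. y < lam p powr (1 / p)"
proof (rule ccontr)
  assume neg: "\<not> ?thesis"
  \<comment> \<open>From here on the chaining condition \<open>2 * real DIM('a) \<le> p * s\<close>
    holds.\<close>
  define p0 where "p0 = max 2 (2 * real DIM('a) / s)"
  have "\<exists>p. max p0 (real j) \<le> p \<and> lam p powr (1 / p) \<le> y" for j
  proof -
    obtain p where "max p0 (real j) \<le> p" "\<not> y < lam p powr (1 / p)"
      using neg unfolding eventually_at_top_linorder by blast
    then show ?thesis by (intro exI[of _ p]) simp
  qed
  then obtain q where q: "\<And>j. max p0 (real j) \<le> q j" "\<And>j. lam (q j) powr (1 / q j) \<le> y" by metis
  have q1: "1 < q j" and q2: "2 * real DIM('a) \<le> q j * s" for j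
  proof -
    show "1 < q j" using q(1)[of j] by (simp add: p0_def)
    have "2 * real DIM('a) / s \<le> q j" using q(1)[of j] by (simp add: p0_def)
    then show "2 * real DIM('a) \<le> q j * s" using s0 by (simp add: pos_divide_le_eq)
  qed
  have q_lim: "filterlim q at_top sequentially"
    by (rule filterlim_at_top_mono[OF filterlim_real_sequentially]) (use q(1) in \<open>auto intro: always_eventually\<close>)
  have bnd: "lam (q j) powr (1 / q j) \<in> {0..y}" for j using q(2) by simp
  obtain L and r :: "nat \<Rightarrow> nat"
    where L: "L \<in> {0..y}" "strict_mono r" "((\<lambda>j. lam (q j) powr (1 / q j)) \<circ> r) \<longlonglongrightarrow> L"
    by (rule seq_compactE[OF compact_imp_seq_compact[OF compact_Icc] allI[OF bnd]])
  have "\<exists>w. w \<in> W (q j) \<and> balanced (q j) w \<and> norm_pow (q j) w = 1 \<and> energy (q j) w = 2 * lam (q j)" for j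
    using exists_minimizer[OF q1] by blast
  then obtain u where u: "\<And>j. u j \<in> W (q j)" "\<And>j. balanced (q j) (u j)" "\<And>j. norm_pow (q j) (u j) = 1"
    "\<And>j. energy (q j) (u j) = 2 * lam (q j)" by metis
  have l1: "filterlim (\<lambda>j. q (r j)) at_top sequentially"
    by (rule filterlim_compose[OF q_lim filterlim_subseq[OF L(2)]])
  have l2: "(\<lambda>j. lam (q (r j)) powr (1 / q (r j))) \<longlonglongrightarrow> L" using L(3) by (simp add: o_def)
  have "Lam \<le> L"
    using minimizers_subsequence[OF l1 q1 q2 u(1,3,2,4) l2] by blast
  then show False using L(1) y by simp
qed

lemma lam_root_tendsto: "((\<lambda>p. lam p powr (1 / p)) \<longlongrightarrow> Lam) at_top"
  by (rule order_tendstoI) (use lam_root_lower lam_root_upper in auto)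

lemma minimizers_converge:
  fixes u :: "real \<Rightarrow> 'a \<Rightarrow> real"
  assumes u: "\<And>p. 1 < p \<Longrightarrow> is_minimizer_sp U d s p (u p) \<and> Lp_norm_pow U p (u p) = 1"
  shows "\<exists>(pj :: nat \<Rightarrow> real) u_inf. (\<forall>j. pj j > 1) \<and> filterlim pj at_top sequentially \<and>
    is_minimizer_Lambda_N U d s u_inf \<and> converges_in_C_closure U (\<lambda>j. u (pj j)) u_inf"
proof -
  define p0 where "p0 = max 2 (2 * real DIM('a) / s)"
  define q where "q j = p0 + real j" for j
  have q1: "1 < q j" and q2: "2 * real DIM('a) \<le> q j * s" for j
  proof -
    show "1 < q j" by (simp add: q_def p0_def)
    have "2 * real DIM('a) / s \<le> q j" by (simp add: q_def p0_def)
    then show "2 * real DIM('a) \<le> q j * s" using s0 by (simp add: pos_divide_le_eq)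
  qed
  have q_lim: "filterlim q at_top sequentially"
    unfolding q_def[abs_def] by (rule filterlim_tendsto_add_at_top[OF tendsto_const filterlim_real_sequentially])
  have "\<exists>v. v \<in> W (q j) \<and> (AE x in lborel. u (q j) x = v x) \<and> balanced (q j) v \<and> norm_pow (q j) v = 1 \<and>
      energy (q j) v = 2 * lam (q j)" for j
  proof -
    obtain v where "v \<in> W (q j)" "AE x in lborel. u (q j) x = v x" "balanced (q j) v" "norm_pow (q j) v = 1"
      "energy (q j) v = 2 * lam (q j)"
      by (rule minimizer_representative[OF q1 conjunct1[OF u[OF q1]] conjunct2[OF u[OF q1]]])
    then show ?thesis by blast
  qed
  then have "\<forall>j. \<exists>v. v \<in> W (q j) \<and> (AE x in lborel. u (q j) x = v x) \<and> balanced (q j) v \<and>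
      norm_pow (q j) v = 1 \<and> energy (q j) v = 2 * lam (q j)" by blast
  from choice[OF this] obtain v where
    "\<forall>j. v j \<in> W (q j) \<and> (AE x in lborel. u (q j) x = v j x) \<and> balanced (q j) (v j) \<and>
      norm_pow (q j) (v j) = 1 \<and> energy (q j) (v j) = 2 * lam (q j)" by blast
  then have v: "v j \<in> W (q j)" "AE x in lborel. u (q j) x = v j x"
    "balanced (q j) (v j)" "norm_pow (q j) (v j) = 1" "energy (q j) (v j) = 2 * lam (q j)" for j
    by blast+
  have L: "(\<lambda>j. lam (q j) powr (1 / q j)) \<longlonglongrightarrow> Lam"
    by (rule filterlim_compose[OF lam_root_tendsto q_lim])
  obtain r :: "nat \<Rightarrow> nat" and w g where r: "strict_mono r" and ae: "\<forall>j. AE x in muU. v j x = w j x"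
    and wc: "\<forall>j. continuous_on (closure U) (w j)" and g: "continuous_on (closure U) g"
    and ul: "uniform_limit (closure U) (\<lambda>j. w (r j)) g sequentially"
    and Hol: "\<forall>x\<in>U. \<forall>y\<in>U. \<bar>g x - g y\<bar> \<le> Lam * d x y powr s"
    and sup: "(SUP x\<in>U. g x) = 1" and inf: "(INF x\<in>U. g x) = - 1" and b: "\<forall>x\<in>U. \<bar>g x\<bar> \<le> 1"
    using minimizers_subsequence[OF q_lim q1 q2 v(1,4,3,5) L] by blast
  have "is_minimizer_Lambda_N U d s g"
    by (rule is_minimizer_Lambda_N_limit[OF continuous_on_subset[OF g closure_subset] sup inf])
      (use b Hol in auto)
  moreover have "converges_in_C_closure U (\<lambda>j. u (q (r j))) g"
    unfolding converges_in_C_closure_def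
  proof (intro conjI g exI[of _ "\<lambda>j. w (r j)"] allI wc[rule_format] ul)
    fix j
    show "AE x in lebesgue_on U. w (r j) x = u (q (r j)) x"
      unfolding AE_lebesgue_on_U using ae[rule_format, of "r j"] AE_lborel_imp_muU[OF v(2)[of "r j"]] by eventually_elim simp
  qed
  moreover have "filterlim (\<lambda>j. q (r j)) at_top sequentially"
    by (rule filterlim_compose[OF q_lim filterlim_subseq[OF r]])
  ultimately show ?thesis using q1 by (intro exI[of _ "\<lambda>j. q (r j)"] exI[of _ g]) auto
qed

end

theorem theorem1p3:
  fixes U :: "'a::euclidean_space set"
    and d :: "'a \<Rightarrow> 'a \<Rightarrow> real"
    and s :: real
  assumes "smooth_bounded_domain U"
    and "0 < s" and "s < 1"
    and "euclidean_equivalent_distance d"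
  shows "(\<forall>p>1. lambda_sp U d s p < top \<and>
            is_first_nonzero_eigenvalue U d s p (enn2real (lambda_sp U d s p)))
       \<and> ((\<lambda>p. enn2real (lambda_sp U d s p) powr (1 / p))
             \<longlongrightarrow> 2 / (diam_d d U) powr s) at_top
       \<and> Lambda_sinf U d s = ennreal (2 / (diam_d d U) powr s)
       \<and> (\<forall>u :: real \<Rightarrow> 'a \<Rightarrow> real.
            (\<forall>p>1. is_minimizer_sp U d s p (u p) \<and> Lp_norm_pow U p (u p) = 1) \<longrightarrow>
            (\<exists>(pj :: nat \<Rightarrow> real) u_inf.
               (\<forall>j. pj j > 1) \<and> filterlim pj at_top sequentially \<and>
               is_minimizer_Lambda_N U d s u_inf \<and>
               converges_in_C_closure U (\<lambda>j. u (pj j)) u_inf))"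
proof -
  obtain \<kappa> r0 where dens: "0 < \<kappa>" "\<kappa> \<le> 1" "0 < r0" "r0 \<le> 1"
    "\<And>x r. x \<in> closure U \<Longrightarrow> 0 < r \<Longrightarrow> r \<le> r0 \<Longrightarrow> \<kappa> * r ^ DIM('a) \<le> measure lborel (U \<inter> ball x r)"
    using smooth_bounded_domain_density[OF assms(1)] by blast
  obtain C where C: "1 \<le> C" "\<And>x y. norm (x - y) / C \<le> d x y \<and> d x y \<le> C * norm (x - y)"
    and metric: "Metric_space UNIV d"
    using assms(4) unfolding euclidean_equivalent_distance_def by blast
  interpret dense_setting U d s C \<kappa> r0
    by (intro dense_setting.intro nonlocal_setting.intro dense_setting_axioms.intro)
      (use assms C metric dens in \<open>auto simp: smooth_bounded_domain_def\<close>)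
  show ?thesis
    using lambda_sp_finite is_first_nonzero_eigenvalue_lam lam_root_tendsto Lambda_sinf_eq minimizers_converge
    unfolding lam_def by blast
qed

end
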